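(* Let $d_1>0$ and $d_2>0$ be integers, let $t_1<t_2<\cdots<t_{d_1+d_2+1}$ be real numbers, and let $\{n_{c,1,i}\}_{i=1}^{d_1}$ and $\{n_{c,2,i}\}_{i=1}^{d_2}$ be sequences of integers greater than $1$. Let $\overrightarrow{G}$ be the digraph obtained as follows: take a balanced tree of type $(\{n_{c,1,i}\}_{i=1}^{d_1},d_1)$ with root $v_{0,1}$ and reverse the orientation of all of its edges; take another balanced tree of type $(\{n_{c,2,i}\}_{i=1}^{d_2},d_2)$ with root $v_{0,2}$ (keeping its orientation); and identify $v_{0,1}$ with $v_{0,2}$. Put $l:=\sum_{i=1}^{d_1}(n_{c,1,i}+1)+\sum_{i=1}^{d_2}(n_{c,2,i}+1)+2$. Then there exists a real number $R_0>0$ such that for every real number $R>R_0$ there exist an integer $k\ge 2$ and an RA-region $(D,\{S_j\}_{j=1}^{l})$ of $\mathbb{R}^k$, with $\overline{D}$ compact, such that: (i) each $S_j$ ($1\le j\le l$) is a cylinder in $\mathbb{R}^k$ of the circle $C_R:=\{x=(x_1,x_2)\in\mathbb{R}^2 \mid \|x\|=R\}$; (ii) the Poincaré-Reeb digraph of $(D,\{S_j\}_{j=1}^{l})$ is isomorphic, as a digraph, to $\overrightarrow{G}$; (iii) the image of the vertex set of the Poincaré-Reeb graph $PR_{(D,\{S_j\}_{j=1}^l)}$ under the induced function $\overline{\pi_{(D,\{S_j\}_{j=1}^l)}}:PR_{(D,\{S_j\}_{j=1}^l)}\to\mathbb{R}$ is exactly $\{t_1,\dots,t_{d_1+d_2+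1}\}$.
   Context: **Graphs and digraphs.** A graph is a finite connected $1$-dimensional CW complex such that the closure of each $1$-cell is homeomorphic to $D^1=[-1,1]$; its vertices are the $0$-cells and its edges are the $1$-cells. A digraph is a graph all of whose edges are oriented. Two digraphs are isomorphic if there is a homeomorphism between them mapping vertex set onto vertex set and preserving the orientations of edges. **Balanced trees.** A rooted tree is a tree (a graph with first Betti number $0$ and more than one vertex) with a chosen vertex $v_0$ (the root), regarded as a digraph by orienting every edge away from $v_0$; thus $v_0$ is the unique source and every other vertex has indegree $1$. Its leaves are the sinks (vertices of outdegree $0$). The depth of a vertex $v$ is the number of edges in the unique path from $v_0$ to $v$ (so $v_0$ has depth $0$). The number of children of a non-leaf vertex is its outdegree. A balanced tree of type $(\{n_{c,i}\}_{i=1}^{d},d)$ is a rooted tree in which every leaf has depth $d$ and, for each $0\le i\le d-1$, every vertex of depth $i$ has exactly $n_{c,i+1}$ children. **Cylinders of a circle.** For $k\ge 2$, a cylinder in $\mathbb{R}^k$ of a circle $C\subset\mathbb{R}^2$ is any subset of $\mathbb{R}^k$ obtained from $C\times\mathbb{R}^{k-2}\subset\mathbb{R}^2\times\mathbb{R}^{k-2}=\mathbb{R}^k$ by a finite composition of translations, rotations around points, and reflections (i.e. by a Euclidean isometry of $\mathbb{R}^k$). It is a non-singular real algebraic hypersurface, the zero set of a real polynomial of degree $2$. **RA-regions.** Let $\overline{D}$ denote the closure of $D$ in $\mathbb{R}^k$. An RA-region of $\mathbb{R}^k$ is a pair $(D,\{S_j\}_{j=1}^{l})$ where $D\subset\mathbb{R}^k$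 is a non-empty connected open set and each $S_j$ is a non-singular real algebraic hypersurface of $\mathbb{R}^k$, which is a union of some connected components of the zero set of a real polynomial $f_j$, with $S_j\cap\overline{D}\neq\emptyset$ for all $j$, such that: (1) there is an open neighborhood $U_D$ of $\overline{D}$ with $D=U_D\cap\bigcap_{j=1}^{l}\{x\mid f_j(x)>0\}$ and $U_D\cap S_j=U_D\cap\{x\mid f_j(x)=0\}$ for every $j$; (2) (transversality) for all indices $1\le i_1<\cdots<i_{l'}\le l$ and every point $p\in\overline{D}\cap\bigcap_{j=1}^{l'}S_{i_j}$, one has $\dim\bigcap_{j=1}^{l'}T_pS_{i_j}=k-l'$. **Poincaré-Reeb digraph.** Let $(D,\{S_j\}_{j=1}^l)$ be an RA-region of $\mathbb{R}^k$ with $\overline{D}$ compact, and let $\pi_{k,1}:\mathbb{R}^k\to\mathbb{R}$ be the projection to the first coordinate. Declare two points of $\overline{D}$ equivalent if they lie in the same connected component of some level set of $\pi_{k,1}|_{\overline{D}}$. Let $PR_{(D,\{S_j\}_{j=1}^l)}$ be the quotient space, $q:\overline{D}\to PR_{(D,\{S_j\}_{j=1}^l)}$ the quotient map, and $\overline{\pi_{(D,\{S_j\}_{j=1}^l)}}:PR_{(D,\{S_j\}_{j=1}^l)}\to\mathbb{R}$ the unique continuous function with $\pi_{k,1}|_{\overline{D}}=\overline{\pi_{(D,\{S_j\}_{j=1}^l)}}\circ q$. A point $p\in\overline{D}$ is called singular if either (a) $p$ lies in exactly $l'<k$ of the hypersurfaces, say $S_{i_1},\dots,S_{i_{l'}}$,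 and $p$ is a critical point of the restriction of $\pi_{k,1}$ to the $(k-l')$-dimensional manifold consisting of all points of $\overline{D}$ contained in $S_{i_1},\dots,S_{i_{l'}}$ and in no other $S_j$; or (b) $p$ lies in $k$ of the hypersurfaces $S_j$. The space $PR_{(D,\{S_j\}_{j=1}^l)}$ has the structure of a graph whose vertices are exactly the points corresponding to components of level sets containing at least one singular point; this is the Poincaré-Reeb graph. The function $\overline{\pi_{(D,\{S_j\}_{j=1}^l)}}$ is injective on each edge; orienting each edge from its endpoint with the smaller value to its endpoint with the larger value gives the Poincaré-Reeb digraph. *)

theory Defs
  imports
    "HOL-Analysis.Analysis"
    "HOL-Homology.Homology"
    "HOL-Library.Function_Algebras"
    "Graph_Theory.Graph_Theory"
begin

no_notation eq_closure_of (\<open>closure'_of\<index>\<close>)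

section \<open>Identification spaces\<close>

definition quotient_topology :: "'a topology \<Rightarrow> ('a \<Rightarrow> 'b) \<Rightarrow> 'b topology" where
  "quotient_topology X q =
     topology (\<lambda>U. U \<subseteq> q ` topspace X \<and> openin X {x \<in> topspace X. q x \<in> U})"

lemma openin_quotient_topology:
  "openin (quotient_topology X q) U \<longleftrightarrow>
     U \<subseteq> q ` topspace X \<and> openin X {x \<in> topspace X. q x \<in> U}"
proof -
  have "istopology (\<lambda>U. U \<subseteq> q ` topspace X \<and> openin X {x \<in> topspace X. q x \<in> U})"
    unfolding istopology_def
  proof (intro conjI allI impI)
    fix S T
    assume "S \<subseteq> q ` topspace X \<and> openin X {x \<in> topspace X. q x \<in> S}"
      and "T \<subseteq> q ` topspace X \<and> openin X {x \<in> topspace X. q x \<in> T}"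
    moreover have "{x \<in> topspace X. q x \<in> S \<inter> T} =
        {x \<in> topspace X. q x \<in> S} \<inter> {x \<in> topspace X. q x \<in> T}" by auto
    ultimately show "S \<inter> T \<subseteq> q ` topspace X"
      and "openin X {x \<in> topspace X. q x \<in> S \<inter> T}" by auto
  next
    fix \<K>
    assume *: "\<forall>K\<in>\<K>. K \<subseteq> q ` topspace X \<and> openin X {x \<in> topspace X. q x \<in> K}"
    then show "\<Union>\<K> \<subseteq> q ` topspace X" by auto
    have "{x \<in> topspace X. q x \<in> \<Union>\<K>} = (\<Union>K\<in>\<K>. {x \<in> topspace X. q x \<in> K})" by auto
    then show "openin X {x \<in> topspace X. q x \<in> \<Union>\<K>}" using * by auto
  qed
  then show ?thesis by (simp add: quotient_topology_def topology_inverse')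
qed

lemma topspace_quotient_topology: "topspace (quotient_topology X q) = q ` topspace X"
proof
  show "topspace (quotient_topology X q) \<subseteq> q ` topspace X"
    using openin_topspace[of "quotient_topology X q"] unfolding openin_quotient_topology
    by (rule conjunct1)
  have "{x \<in> topspace X. q x \<in> q ` topspace X} = topspace X" by auto
  then have "openin (quotient_topology X q) (q ` topspace X)"
    by (simp add: openin_quotient_topology)
  then show "q ` topspace X \<subseteq> topspace (quotient_topology X q)"
    by (rule openin_subset)
qed

lemma quotient_map_quotient_topology: "quotient_map X (quotient_topology X q) q"
  by (simp add: quotient_map_def topspace_quotient_topology openin_quotient_topology)

definition coproduct_topology :: "'a topology \<Rightarrow> 'b topology \<Rightarrow> ('a + 'b) topology" where
  "coproduct_topology X Y = topology (\<lambda>U. openin X (Inl -` U) \<and> openin Y (Inr -` U))"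

lemma openin_coproduct_topology:
  "openin (coproduct_topology X Y) U \<longleftrightarrow> openin X (Inl -` U) \<and> openin Y (Inr -` U)"
proof -
  have "istopology (\<lambda>U. openin X (Inl -` U) \<and> openin Y (Inr -` U))"
    unfolding istopology_def by (auto simp: vimage_Union)
  then show ?thesis by (simp add: coproduct_topology_def topology_inverse')
qed

lemma topspace_coproduct_topology:
  "topspace (coproduct_topology X Y) = Inl ` topspace X \<union> Inr ` topspace Y"
proof
  have "openin X (Inl -` topspace (coproduct_topology X Y))"
       "openin Y (Inr -` topspace (coproduct_topology X Y))"
    using openin_topspace[of "coproduct_topology X Y"] by (simp_all only: openin_coproduct_topology)
  then have "Inl -` topspace (coproduct_topology X Y) \<subseteq> topspace X"
       "Inr -` topspace (coproduct_topology X Y) \<subseteq> topspace Y"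
    by (auto dest: openin_subset)
  then show "topspace (coproduct_topology X Y) \<subseteq> Inl ` topspace X \<union> Inr ` topspace Y"
    by (intro subsetI, rename_tac z, case_tac z) auto
  have "Inl -` (Inl ` topspace X \<union> Inr ` topspace Y) = topspace X"
       "Inr -` (Inl ` topspace X \<union> Inr ` topspace Y) = topspace Y" by auto
  then have "openin (coproduct_topology X Y) (Inl ` topspace X \<union> Inr ` topspace Y)"
    by (simp add: openin_coproduct_topology)
  then show "Inl ` topspace X \<union> Inr ` topspace Y \<subseteq> topspace (coproduct_topology X Y)"
    by (rule openin_subset)
qed

section \<open>Topological digraphs\<close>

text \<open>
  A digraph is kept as its underlying space together with its cell structure: the arcs are the
  open 1-cells (as sets of points), and the orientation of a 1-cell is recorded by its tail and
  its head.
\<close>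

record 'a top_digraph =
  tspace :: "'a topology"
  cells :: "('a, 'a set) pre_digraph"

abbreviation tverts :: "'a top_digraph \<Rightarrow> 'a set" where
  "tverts G \<equiv> verts (cells G)"

abbreviation tarcs :: "'a top_digraph \<Rightarrow> 'a set set" where
  "tarcs G \<equiv> arcs (cells G)"

abbreviation open_edges :: "'a topology \<Rightarrow> 'a set \<Rightarrow> 'a set set" where
  "open_edges X V \<equiv> connected_components_of (subtopology X (topspace X - V))"

text \<open>
  A finite connected 1-dimensional CW complex in which every closed 1-cell is an arc. The map
  \<open>\<phi>\<close> is the characteristic map of the cell \<open>e\<close>; as there are finitely many cells, the
  weak topology condition is automatic in a Hausdorff space.
\<close>

definition is_top_digraph :: "'a top_digraph \<Rightarrow> bool" where
  "is_top_digraph G \<longleftrightarrow>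
     Hausdorff_space (tspace G) \<and> connected_space (tspace G) \<and>
     finite (tverts G) \<and> tverts G \<subseteq> topspace (tspace G) \<and>
     finite (tarcs G) \<and> tarcs G \<noteq> {} \<and> tarcs G = open_edges (tspace G) (tverts G) \<and>
     (\<forall>e \<in> tarcs G. tail (cells G) e \<in> tverts G \<and> head (cells G) e \<in> tverts G \<and>
        (\<exists>\<phi>. homeomorphic_map (top_of_set {-1..1::real})
               (subtopology (tspace G) (tspace G closure_of e)) \<phi> \<and>
             \<phi> ` {-1<..<1} = e \<and> \<phi> (-1) = tail (cells G) e \<and> \<phi> 1 = head (cells G) e))"

definition top_digraph_iso :: "'a top_digraph \<Rightarrow> 'b top_digraph \<Rightarrow> bool" where
  "top_digraph_iso G H \<longleftrightarrow>
     (\<exists>h. homeomorphic_map (tspace G) (tspace H) h \<and> h ` tverts G = tverts H \<and>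
          (`) h ` tarcs G = tarcs H \<and>
          (\<forall>e \<in> tarcs G. tail (cells H) (h ` e) = h (tail (cells G) e) \<and>
                         head (cells H) (h ` e) = h (head (cells G) e)))"

definition reverse_digraph :: "'a top_digraph \<Rightarrow> 'a top_digraph" where
  "reverse_digraph G =
     \<lparr>tspace = tspace G,
      cells = \<lparr>verts = tverts G, arcs = tarcs G, tail = head (cells G), head = tail (cells G)\<rparr>\<rparr>"

text \<open>
  In the space obtained from the disjoint union of two digraphs by identifying the vertices
  \<open>v\<close> and \<open>w\<close>, the common point is represented by \<open>Inl v\<close>. Open edges contain no vertex, so
  those of the second digraph are just tagged with \<open>Inr\<close>.
\<close>

definition identify_points :: "'a \<Rightarrow> 'b \<Rightarrow> 'a + 'b \<Rightarrow> 'a + 'b" where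
  "identify_points v w z = (if z = Inr w then Inl v else z)"

definition wedge_end ::
  "('a set \<Rightarrow> 'a) \<Rightarrow> ('b set \<Rightarrow> 'b) \<Rightarrow> 'a set set \<Rightarrow> 'a \<Rightarrow> 'b \<Rightarrow> ('a + 'b) set \<Rightarrow> 'a + 'b"
  where
  "wedge_end a b E v w e =
     (if e \<in> (`) Inl ` E then Inl (a (Inl -` e)) else identify_points v w (Inr (b (Inr -` e))))"

definition wedge_digraph ::
  "'a top_digraph \<Rightarrow> 'a \<Rightarrow> 'b top_digraph \<Rightarrow> 'b \<Rightarrow> ('a + 'b) top_digraph" where
  "wedge_digraph G v H w =
     \<lparr>tspace = quotient_topology (coproduct_topology (tspace G) (tspace H)) (identify_points v w),
      cells = \<lparr>verts = identify_points v w ` (Inl ` tverts G \<union> Inr ` tverts H),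
               arcs = (`) Inl ` tarcs G \<union> (`) Inr ` tarcs H,
               tail = wedge_end (tail (cells G)) (tail (cells H)) (tarcs G) v w,
               head = wedge_end (head (cells G)) (head (cells H)) (tarcs G) v w\<rparr>\<rparr>"

section \<open>Balanced trees\<close>

text \<open>The first singular homology group has rank 0, that is, all of its elements are torsion.\<close>

definition first_betti_number_zero :: "'a topology \<Rightarrow> bool" where
  "first_betti_number_zero X \<longleftrightarrow>
     (\<forall>c \<in> carrier (homology_group 1 X). \<exists>n::nat. n > 0 \<and>
        c [^]\<^bsub>homology_group 1 X\<^esub> n = \<one>\<^bsub>homology_group 1 X\<^esub>)"

definition rooted_tree :: "'a top_digraph \<Rightarrow> 'a \<Rightarrow> bool" where
  "rooted_tree T v0 \<longleftrightarrow>
     is_top_digraph T \<and> first_betti_number_zero (tspace T) \<and> card (tverts T) > 1 \<and>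
     v0 \<in> tverts T \<and>
     (\<forall>v \<in> tverts T. v0 \<rightarrow>\<^sup>*\<^bsub>cells T\<^esub> v) \<and>
     in_degree (cells T) v0 = 0 \<and>
     (\<forall>v \<in> tverts T - {v0}. in_degree (cells T) v = 1)"

definition depth :: "'a top_digraph \<Rightarrow> 'a \<Rightarrow> 'a \<Rightarrow> nat" where
  "depth T v0 v = length (THE p. pre_digraph.apath (cells T) v0 p v)"

definition balanced_tree :: "'a top_digraph \<Rightarrow> 'a \<Rightarrow> (nat \<Rightarrow> nat) \<Rightarrow> nat \<Rightarrow> bool" where
  "balanced_tree T v0 n d \<longleftrightarrow>
     rooted_tree T v0 \<and>
     (\<forall>v \<in> tverts T. out_degree (cells T) v = 0 \<longrightarrow> depth T v0 v = d) \<and>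
     (\<forall>i < d. \<forall>v \<in> tverts T. depth T v0 v = i \<longrightarrow> out_degree (cells T) v = n (i + 1))"

section \<open>Hypersurfaces and RA-regions\<close>

text \<open>
  The space \<open>\<real>\<^sup>k\<close> is \<^const>\<open>Euclidean_space\<close> \<open>k\<close>: its coordinates are numbered from 0 to
  \<open>k - 1\<close>, and all further entries vanish.
\<close>

inductive polynomial_on :: "nat \<Rightarrow> ((nat \<Rightarrow> real) \<Rightarrow> real) \<Rightarrow> bool" for k where
  const: "polynomial_on k (\<lambda>x. c)"
| coord: "i < k \<Longrightarrow> polynomial_on k (\<lambda>x. x i)"
| add: "polynomial_on k f \<Longrightarrow> polynomial_on k g \<Longrightarrow> polynomial_on k (\<lambda>x. f x + g x)"
| mult: "polynomial_on k f \<Longrightarrow> polynomial_on k g \<Longrightarrow> polynomial_on k (\<lambda>x. f x * g x)"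

definition partial_deriv :: "nat \<Rightarrow> ((nat \<Rightarrow> real) \<Rightarrow> real) \<Rightarrow> (nat \<Rightarrow> real) \<Rightarrow> real" where
  "partial_deriv i f x = deriv (\<lambda>s. f (x(i := s))) (x i)"

definition nonsingular_hypersurface ::
  "nat \<Rightarrow> ((nat \<Rightarrow> real) \<Rightarrow> real) \<Rightarrow> (nat \<Rightarrow> real) set \<Rightarrow> bool" where
  "nonsingular_hypersurface k f S \<longleftrightarrow>
     polynomial_on k f \<and>
     (\<exists>\<C> \<subseteq> connected_components_of
              (subtopology (Euclidean_space k) {x \<in> topspace (Euclidean_space k). f x = 0}).
        S = \<Union>\<C>) \<and>
     (\<forall>p \<in> S. \<exists>i < k. partial_deriv i f p \<noteq> 0)"

text \<open>The velocities at \<open>p\<close> of the \<open>C\<^sup>1\<close> curves in \<open>M\<close> through \<open>p\<close>.\<close>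

definition tangent_space :: "(nat \<Rightarrow> real) set \<Rightarrow> (nat \<Rightarrow> real) \<Rightarrow> (nat \<Rightarrow> real) set" where
  "tangent_space M p =
     {v. \<exists>\<gamma> \<epsilon>. \<epsilon> > 0 \<and> \<gamma> 0 = p \<and> (\<forall>s \<in> {-\<epsilon><..<\<epsilon>}. \<gamma> s \<in> M) \<and>
          (\<forall>i. (\<lambda>s. \<gamma> s i) C1_differentiable_on {-\<epsilon><..<\<epsilon>} \<and>
               ((\<lambda>s. \<gamma> s i) has_real_derivative v i) (at 0))}"

definition fun_scale :: "real \<Rightarrow> (nat \<Rightarrow> real) \<Rightarrow> (nat \<Rightarrow> real)" where
  "fun_scale c v = (\<lambda>i. c * v i)"

lemma vector_space_fun_scale: "vector_space fun_scale"
  unfolding vector_space_def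
  by (intro conjI allI ext) (simp_all add: fun_scale_def distrib_left distrib_right fun_eq_iff)

abbreviation fun_dim :: "(nat \<Rightarrow> real) set \<Rightarrow> nat" where
  "fun_dim \<equiv> vector_space.dim fun_scale"

definition RA_region ::
  "nat \<Rightarrow> nat \<Rightarrow> (nat \<Rightarrow> real) set \<Rightarrow> (nat \<Rightarrow> (nat \<Rightarrow> real) set) \<Rightarrow> bool" where
  "RA_region k l D S \<longleftrightarrow>
     D \<noteq> {} \<and> connectedin (Euclidean_space k) D \<and> openin (Euclidean_space k) D \<and>
     (\<exists>f. (\<forall>j \<in> {1..l}. nonsingular_hypersurface k (f j) (S j) \<and>
                         S j \<inter> (Euclidean_space k closure_of D) \<noteq> {}) \<and>
          (\<exists>U. openin (Euclidean_space k) U \<and> Euclidean_space k closure_of D \<subseteq> U \<and>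
               D = U \<inter> {x. \<forall>j \<in> {1..l}. f j x > 0} \<and>
               (\<forall>j \<in> {1..l}. U \<inter> S j = U \<inter> {x. f j x = 0}))) \<and>
     (\<forall>I \<subseteq> {1..l}. I \<noteq> {} \<longrightarrow>
        (\<forall>p \<in> (Euclidean_space k closure_of D) \<inter> (\<Inter>j\<in>I. S j).
           int (fun_dim (\<Inter>j\<in>I. tangent_space (S j) p)) = int k - int (card I)))"

section \<open>Cylinders of circles\<close>

definition euclidean_isometry :: "nat \<Rightarrow> ((nat \<Rightarrow> real) \<Rightarrow> (nat \<Rightarrow> real)) \<Rightarrow> bool" where
  "euclidean_isometry k \<phi> \<longleftrightarrow>
     \<phi> ` topspace (Euclidean_space k) = topspace (Euclidean_space k) \<and>
     (\<forall>x \<in> topspace (Euclidean_space k). \<forall>y \<in> topspace (Euclidean_space k).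
        L2_set (\<lambda>i. \<phi> x i - \<phi> y i) {..<k} = L2_set (\<lambda>i. x i - y i) {..<k})"

definition circle :: "real \<Rightarrow> (nat \<Rightarrow> real) set" where
  "circle R = {x \<in> topspace (Euclidean_space 2). L2_set x {..<2} = R}"

definition is_cylinder :: "nat \<Rightarrow> (nat \<Rightarrow> real) set \<Rightarrow> (nat \<Rightarrow> real) set \<Rightarrow> bool" where
  "is_cylinder k C S \<longleftrightarrow>
     (\<exists>\<phi>. euclidean_isometry k \<phi> \<and>
          S = \<phi> ` {x \<in> topspace (Euclidean_space k). (\<lambda>i. if i < 2 then x i else 0) \<in> C})"

section \<open>The Poincare-Reeb digraph\<close>

definition singular_point ::
  "nat \<Rightarrow> nat \<Rightarrow> (nat \<Rightarrow> real) set \<Rightarrow> (nat \<Rightarrow> (nat \<Rightarrow> real) set) \<Rightarrow> (nat \<Rightarrow> real) \<Rightarrow> bool"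
  where
  "singular_point k l D S p \<longleftrightarrow>
     (let J = {j \<in> {1..l}. p \<in> S j};
          M = {x \<in> Euclidean_space k closure_of D. {j \<in> {1..l}. x \<in> S j} = J}
      in (card J < k \<and> (\<forall>v \<in> tangent_space M p. v 0 = 0)) \<or> card J = k)"

definition Reeb_class :: "nat \<Rightarrow> (nat \<Rightarrow> real) set \<Rightarrow> (nat \<Rightarrow> real) \<Rightarrow> (nat \<Rightarrow> real) set" where
  "Reeb_class k D p =
     connected_component_of_set
       (subtopology (Euclidean_space k) {x \<in> Euclidean_space k closure_of D. x 0 = p 0}) p"

definition PR_space :: "nat \<Rightarrow> (nat \<Rightarrow> real) set \<Rightarrow> (nat \<Rightarrow> real) set topology" where
  "PR_space k D =
     quotient_topology (subtopology (Euclidean_space k) (Euclidean_space k closure_of D))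
       (Reeb_class k D)"

text \<open>The function induced by the first coordinate, which is constant on every class.\<close>

definition PR_fun :: "(nat \<Rightarrow> real) set \<Rightarrow> real" where
  "PR_fun c = the_elem ((\<lambda>x. x 0) ` c)"

definition PR_verts ::
  "nat \<Rightarrow> nat \<Rightarrow> (nat \<Rightarrow> real) set \<Rightarrow> (nat \<Rightarrow> (nat \<Rightarrow> real) set) \<Rightarrow> (nat \<Rightarrow> real) set set" where
  "PR_verts k l D S =
     Reeb_class k D ` {p \<in> Euclidean_space k closure_of D. singular_point k l D S p}"

definition PR_digraph ::
  "nat \<Rightarrow> nat \<Rightarrow> (nat \<Rightarrow> real) set \<Rightarrow> (nat \<Rightarrow> (nat \<Rightarrow> real) set) \<Rightarrow>
     (nat \<Rightarrow> real) set top_digraph" where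
  "PR_digraph k l D S =
     \<lparr>tspace = PR_space k D,
      cells = \<lparr>verts = PR_verts k l D S,
               arcs = open_edges (PR_space k D) (PR_verts k l D S),
               tail = (\<lambda>e. ARG_MIN PR_fun v. v \<in> PR_verts k l D S \<inter> (PR_space k D closure_of e)),
               head = (\<lambda>e. ARG_MAX PR_fun v. v \<in> PR_verts k l D S \<inter> (PR_space k D closure_of e))\<rparr>\<rparr>"

end

theory Submission
  imports Defs
begin

text \<open>
  The first coordinate \<open>x\<close> of the region runs through \<open>[t\<^sub>1, t\<^sub>n]\<close>, and every branching level gets a
  coordinate \<open>y\<close> of its own. In the \<open>(x, y)\<close>-plane, a stack of disks of radius \<open>R\<close> is removed from the
  region: the outermost two bound \<open>y\<close>, and the others touch the line \<open>x = t\<^sub>i\<close> from the right or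
  from the left, so that the interval of admissible \<open>y\<close> splits when \<open>x\<close> passes \<open>t\<^sub>i\<close>. As the slices of the
  region are products of unions of intervals, their components correspond to the vectors of
  branches chosen so far, which are the points of the tree at that height. Both trees branch at the
  root level, and two vertical tangents in different planes over the same \<open>x\<close> would violate
  transversality; hence the two stacks for the root share one plane. This saves two disks, which are
  spent on a plane without branching. Two cylinders to be stayed inside, in planes of their own, confine \<open>x\<close>.

  On the combinatorial side both trees are unions of monotone paths from the root to the leaves. Joining
  them at the root gives a continuous map from the compact closure of the region onto the
  Hausdorff space of the glued tree whose fibres are exactly the components of the slices, so it induces the
  required homeomorphism.
\<close>

section \<open>Balanced trees as unions of root-to-leaf paths\<close>

text \<open>The bound \<open>R > b - a\<close> is what makes one tangency split the slice for good.
  A disk touching \<open>x = t i\<close> has its centre beyond the end of \<open>[a, b]\<close> on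
  its own side, so its vertical chord grows strictly from the tangency to the end of the range, and
  the disk has no other vertical tangent there. The outermost disks are centred over
  \<open>a\<close> and have none at all over \<open>[a, b]\<close>. Two tangencies over the same
  \<open>x\<close> in different planes are not transversal because both tangent hyperplanes are
  \<open>v 0 = 0\<close>; within one plane the disks are disjoint, so no point lies on two of them.
  A branching into \<open>n\<close> parts costs \<open>n - 1\<close> inner and two outer disks,
  which explains the summands \<open>n + 1\<close> of \<open>l\<close>; the final \<open>2\<close>
  counts the cylinders that confine \<open>x\<close>. The trees come without a height function, so
  heights are imposed on their edges. The branch vector read off from a point jumps when the point
  passes the centre height of an inactive disk, but the tree point does not depend on the digit that
  jumps; continuity is therefore proved by pasting over closed boxes.\<close>

locale arborescence = fin_digraph +
  fixes r
  assumes root: "r \<in> verts G"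
    and reachable_from_root: "v \<in> verts G \<Longrightarrow> r \<rightarrow>\<^sup>*\<^bsub>G\<^esub> v"
    and head_neq_root: "e \<in> arcs G \<Longrightarrow> head G e \<noteq> r"
    and arc_eqI: "e \<in> arcs G \<Longrightarrow> e' \<in> arcs G \<Longrightarrow> head G e = head G e' \<Longrightarrow> e = e'"
begin

lemma awalk_snoc_iff:
  "awalk u (p @ [e]) v \<longleftrightarrow> awalk u p (tail G e) \<and> e \<in> arcs G \<and> head G e = v"
proof
  assume "awalk u (p @ [e]) v"
  then have 1: "awalk u p (awlast u p)" and 2: "awalk (awlast u p) [e] v" by auto
  from 2 have "e \<in> arcs G" "tail G e = awlast u p" "head G e = v"
    by (auto simp: awalk_simps)
  with 1 show "awalk u p (tail G e) \<and> e \<in> arcs G \<and> head G e = v" by simp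
next
  assume *: "awalk u p (tail G e) \<and> e \<in> arcs G \<and> head G e = v"
  then have "awlast u p = tail G e" by auto
  with * show "awalk u (p @ [e]) v" by (auto simp: awalk_simps)
qed

text \<open>Arcs are peeled off from the end: the last arc is forced because a vertex has at most
  one incoming arc, and a walk ending at the root is empty because the root has none.\<close>

lemma awalk_from_root_unique: "awalk r p v \<Longrightarrow> awalk r q v \<Longrightarrow> p = q"
proof (induction p arbitrary: v q rule: rev_induct)
  case Nil
  then have "v = r" by (auto simp: awalk_simps)
  show ?case
  proof (cases q rule: rev_cases)
    case (snoc q' e)
    then show ?thesis using Nil(2) \<open>v = r\<close> head_neq_root by (auto simp: awalk_snoc_iff simp del: awalk_append_iff)
  qed simp
next
  case (snoc e p)
  then have e: "awalk r p (tail G e)" "e \<in> arcs G" "head G e = v"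
    by (auto simp: awalk_snoc_iff simp del: awalk_append_iff)
  show ?case
  proof (cases q rule: rev_cases)
    case Nil
    then show ?thesis using snoc(3) e head_neq_root by (auto simp: awalk_simps)
  next
    case (snoc q' e')
    then have e': "awalk r q' (tail G e')" "e' \<in> arcs G" "head G e' = v"
      using \<open>awalk r q v\<close> by (auto simp: awalk_snoc_iff simp del: awalk_append_iff)
    then have "e' = e" using e arc_eqI by metis
    then show ?thesis using snoc snoc.IH[OF e(1)] e' by simp
  qed
qed

text \<open>Any walk from the root is the path in the definition of \<open>depth\<close>, so depths
  can be computed from walks without checking that their vertices are distinct.\<close>

lemma the_apath_from_root:
  assumes "awalk r p v"
  shows "(THE p. apath r p v) = p"
proof -
  have "v \<in> verts G" using assms by auto
  then obtain q where q: "apath r q v" using reachable_from_root reachable_apath by blast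
  then have "q = p" using awalk_from_root_unique[OF _ assms] awalkI_apath by blast
  then show ?thesis using q
    by (intro the_equality) (auto intro: awalk_from_root_unique awalkI_apath)
qed

lemma length_apath_root: "length (THE p. apath r p r) = 0"
  using the_apath_from_root[of "[]" r] root by (simp add: awalk_simps)

lemma length_apath_head:
  assumes "e \<in> arcs G"
  shows "length (THE p. apath r p (head G e)) = Suc (length (THE p. apath r p (tail G e)))"
proof -
  have "tail G e \<in> verts G" using assms by auto
  then obtain q where q: "awalk r q (tail G e)"
    using reachable_from_root reachable_awalk by blast
  then have "awalk r (q @ [e]) (head G e)" using assms by (simp add: awalk_snoc_iff del: awalk_append_iff)
  then show ?thesis using the_apath_from_root q by (metis length_append_singleton)
qed

end

section \<open>Addresses of vertices and edges by digit vectors\<close>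

locale balanced =
  fixes T :: "'a top_digraph" and v0 :: 'a and n :: "nat \<Rightarrow> nat" and d :: nat
  assumes bal: "balanced_tree T v0 n d" and d_pos: "d > 0"
    and n_gt: "i \<in> {1..d} \<Longrightarrow> n i > 1"
begin

text \<open>Digit \<open>i\<close> is the number of the child taken at a vertex of depth
  \<open>i - 1\<close>. Entries outside \<open>{1..d}\<close> are free, so a leaf has many
  addresses, and equalities are only ever characterised by the digits up to some level.\<close>

abbreviation "digits \<equiv> Pi {1..d} (\<lambda>i. {..<n i})"

lemma tdg: "is_top_digraph T"
  using bal by (simp add: balanced_tree_def rooted_tree_def)

lemma arborescence_cells: "arborescence (cells T) v0"
proof -
  have rt: "rooted_tree T v0" using bal by (simp add: balanced_tree_def)
  have fin: "fin_digraph (cells T)"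
    using tdg unfolding is_top_digraph_def by unfold_locales auto
  interpret fin_digraph "cells T" by (rule fin)
  show ?thesis
  proof
    show "v0 \<in> tverts T" using rt by (simp add: rooted_tree_def)
    show "v \<in> tverts T \<Longrightarrow> v0 \<rightarrow>\<^sup>*\<^bsub>cells T\<^esub> v" for v using rt by (simp add: rooted_tree_def)
    show ne: "head (cells T) e \<noteq> v0" if "e \<in> tarcs T" for e
    proof
      assume "head (cells T) e = v0"
      then have "e \<in> in_arcs (cells T) v0" using that by simp
      moreover have "in_degree (cells T) v0 = 0" using rt by (simp add: rooted_tree_def)
      ultimately show False using finite_in_arcs[of v0] by (metis card_0_eq empty_iff in_degree_def)
    qed
    show "e = e'" if "e \<in> tarcs T" "e' \<in> tarcs T" "head (cells T) e = head (cells T) e'" for e e'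
    proof -
      let ?v = "head (cells T) e"
      have "in_degree (cells T) ?v = 1"
        using rt that(1) ne[OF that(1)] by (simp add: rooted_tree_def)
      then obtain f where "in_arcs (cells T) ?v = {f}"
        unfolding in_degree_def by (rule card_1_singletonE)
      moreover have "e \<in> in_arcs (cells T) ?v" "e' \<in> in_arcs (cells T) ?v" using that by auto
      ultimately show ?thesis by auto
    qed
  qed
qed

sublocale arborescence "cells T" v0 by (rule arborescence_cells)

abbreviation "dep \<equiv> depth T v0"

lemma dep_root: "dep v0 = 0"
  by (simp add: depth_def length_apath_root)

lemma dep_head: "e \<in> tarcs T \<Longrightarrow> dep (head (cells T) e) = Suc (dep (tail (cells T) e))"
  by (simp add: depth_def length_apath_head)

lemma leaf_dep: "v \<in> tverts T \<Longrightarrow> out_degree (cells T) v = 0 \<Longrightarrow> dep v = d"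
  using bal by (simp add: balanced_tree_def)

lemma out_degree_eq: "v \<in> tverts T \<Longrightarrow> dep v < d \<Longrightarrow> out_degree (cells T) v = n (Suc (dep v))"
  using bal unfolding balanced_tree_def by (metis Suc_eq_plus1)

text \<open>A vertex of maximal depth has no outgoing arc, hence is a leaf, and leaves have depth
  \<open>d\<close>.\<close>

lemma dep_le: assumes "v \<in> tverts T" shows "dep v \<le> d"
proof -
  let ?M = "Max (dep ` tverts T)"
  have fin: "finite (dep ` tverts T)" by simp
  have "?M \<in> dep ` tverts T" using fin assms by (intro Max_in) auto
  then obtain w where w: "w \<in> tverts T" "dep w = ?M" by auto
  have "out_arcs (cells T) w = {}"
  proof (rule ccontr)
    assume "out_arcs (cells T) w \<noteq> {}"
    then obtain e where e: "e \<in> tarcs T" "tail (cells T) e = w"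
      by (meson all_not_in_conv in_out_arcs_conv)
    then have "dep (head (cells T) e) = Suc ?M" using dep_head w by simp
    moreover have "dep (head (cells T) e) \<le> ?M" using fin e by (intro Max_ge) auto
    ultimately show False by simp
  qed
  then have "dep w = d" using w by (intro leaf_dep) (auto simp: out_degree_def)
  then show ?thesis using w fin assms by (metis Max_ge imageI)
qed

lemma dep_tail_less: assumes "e \<in> tarcs T" shows "dep (tail (cells T) e) < d"
  using dep_le[of "head (cells T) e"] dep_head[OF assms] assms by simp

definition child :: "'a \<Rightarrow> nat \<Rightarrow> 'a set" where
  "child v = (SOME f. bij_betw f {..<out_degree (cells T) v} (out_arcs (cells T) v))"

lemma bij_child: "bij_betw (child v) {..<out_degree (cells T) v} (out_arcs (cells T) v)"
proof -
  have "\<exists>f. bij_betw f {..<out_degree (cells T) v} (out_arcs (cells T) v)"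
    unfolding out_degree_def lessThan_atLeast0 by (intro ex_bij_betw_nat_finite) auto
  then show ?thesis unfolding child_def by (rule someI_ex)
qed

primrec vert :: "(nat \<Rightarrow> nat) \<Rightarrow> nat \<Rightarrow> 'a" where
  "vert a 0 = v0"
| "vert a (Suc i) = head (cells T) (child (vert a i) (a (Suc i)))"

definition edge :: "(nat \<Rightarrow> nat) \<Rightarrow> nat \<Rightarrow> 'a set" where
  "edge a i = child (vert a i) (a (Suc i))"

lemma vert_edge:
  assumes a: "a \<in> digits"
  shows "i \<le> d \<Longrightarrow> vert a i \<in> tverts T \<and> dep (vert a i) = i"
    and "i < d \<Longrightarrow> edge a i \<in> tarcs T \<and> tail (cells T) (edge a i) = vert a i \<and>
                    head (cells T) (edge a i) = vert a (Suc i)"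
proof -
  \<comment> \<open>The claim on edges assumes the one on vertices: the depth of
    \<open>vert a i\<close> gives its number of children, which makes the next digit admissible. It
    then drives the induction on vertices.\<close>
  have *: "edge a i \<in> tarcs T \<and> tail (cells T) (edge a i) = vert a i \<and>
                    head (cells T) (edge a i) = vert a (Suc i)"
    if "i < d" "vert a i \<in> tverts T \<and> dep (vert a i) = i" for i
  proof -
    have "a (Suc i) \<in> {..<out_degree (cells T) (vert a i)}"
      using that a out_degree_eq[of "vert a i"] by auto
    then have "edge a i \<in> out_arcs (cells T) (vert a i)"
      unfolding edge_def using bij_child bij_betwE by metis
    then show ?thesis by (auto simp: edge_def)
  qed
  show **: "i \<le> d \<Longrightarrow> vert a i \<in> tverts T \<and> dep (vert a i) = i" for i
  proof (induction i)
    case 0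
    then show ?case using root dep_root by simp
  next
    case (Suc i)
    then have "edge a i \<in> tarcs T \<and> tail (cells T) (edge a i) = vert a i \<and>
                    head (cells T) (edge a i) = vert a (Suc i)" using *[of i] by simp
    then show ?case using Suc dep_head[of "edge a i"] head_in_verts[of "edge a i"] by simp
  qed
  show "i < d \<Longrightarrow> edge a i \<in> tarcs T \<and> tail (cells T) (edge a i) = vert a i \<and>
                    head (cells T) (edge a i) = vert a (Suc i)"
    using * ** by simp
qed

lemma vert_cong: "(\<And>m. m \<in> {1..i} \<Longrightarrow> a m = b m) \<Longrightarrow> vert a i = vert b i"
  by (induction i) auto

text \<open>The incoming arc of a vertex is unique, so equal vertices have equal last edges and
  equal predecessors; as the numbering of children is injective, the digits agree all the way back
  to the root.\<close>

lemma vert_eqD: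
  assumes a: "a \<in> digits" and b: "b \<in> digits"
  shows "i \<le> d \<Longrightarrow> vert a i = vert b i \<Longrightarrow> m \<in> {1..i} \<Longrightarrow> a m = b m"
proof (induction i)
  case (Suc i)
  have ea: "edge a i \<in> tarcs T" "tail (cells T) (edge a i) = vert a i"
    "head (cells T) (edge a i) = vert a (Suc i)" using vert_edge(2)[OF a, of i] Suc by auto
  have eb: "edge b i \<in> tarcs T" "tail (cells T) (edge b i) = vert b i"
    "head (cells T) (edge b i) = vert b (Suc i)" using vert_edge(2)[OF b, of i] Suc by auto
  have ee: "edge a i = edge b i" by (rule arc_eqI[OF ea(1) eb(1)]) (simp only: ea(3) eb(3) Suc.prems(2))
  then have v: "vert a i = vert b i" using ea(2) eb(2) ee by simp
  have "dep (vert a i) = i" "vert a i \<in> tverts T" using vert_edge(1)[OF a, of i] Suc by auto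
  then have od: "out_degree (cells T) (vert a i) = n (Suc i)" using out_degree_eq Suc by simp
  have "a (Suc i) \<in> {..<n (Suc i)}" "b (Suc i) \<in> {..<n (Suc i)}" using a b Suc by auto
  moreover have "child (vert a i) (a (Suc i)) = child (vert a i) (b (Suc i))"
    using ee v by (simp add: edge_def)
  ultimately have "a (Suc i) = b (Suc i)"
    using bij_child[of "vert a i"] od unfolding bij_betw_def inj_on_def by auto
  then show ?case using Suc v by (cases "m = Suc i") auto
qed simp

lemma vert_eq_iff:
  assumes a: "a \<in> digits" and b: "b \<in> digits" and "i \<le> d" "j \<le> d"
  shows "vert a i = vert b j \<longleftrightarrow> i = j \<and> (\<forall>m\<in>{1..i}. a m = b m)"
proof
  assume *: "vert a i = vert b j"
  then have "i = j" using vert_edge(1)[OF a] vert_edge(1)[OF b] assms by metis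
  then show "i = j \<and> (\<forall>m\<in>{1..i}. a m = b m)" using vert_eqD[OF a b] * assms by blast
qed (use vert_cong in blast)

lemma edge_eq_iff:
  assumes a: "a \<in> digits" and b: "b \<in> digits" and "i < d" "j < d"
  shows "edge a i = edge b j \<longleftrightarrow> i = j \<and> (\<forall>m\<in>{1..Suc i}. a m = b m)"
proof
  assume "edge a i = edge b j"
  then have "vert a (Suc i) = vert b (Suc j)"
    using vert_edge(2)[OF a, of i] vert_edge(2)[OF b, of j] assms by metis
  then show "i = j \<and> (\<forall>m\<in>{1..Suc i}. a m = b m)"
    using vert_eq_iff[OF a b, of "Suc i" "Suc j"] assms by auto
next
  assume *: "i = j \<and> (\<forall>m\<in>{1..Suc i}. a m = b m)"
  then have "vert a i = vert b i" by (intro vert_cong) auto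
  then show "edge a i = edge b j" using * by (simp add: edge_def)
qed

lemma digits_nonempty: "(\<lambda>_. 0) \<in> digits"
  using n_gt by fastforce

lemma edge_surj:
  assumes v: "a \<in> digits" "i \<le> d" and e: "e \<in> tarcs T" "tail (cells T) e = vert a i"
  shows "\<exists>b\<in>digits. i < d \<and> e = edge b i"
proof -
  have d: "dep (vert a i) = i" "vert a i \<in> tverts T" using vert_edge(1) v by auto
  then have "i < d" using dep_tail_less[OF e(1)] e by simp
  have "e \<in> out_arcs (cells T) (vert a i)" using e by simp
  then obtain c where c: "c < n (Suc i)" "child (vert a i) c = e"
    using bij_child[of "vert a i"] out_degree_eq[OF d(2)] d \<open>i < d\<close>
    unfolding bij_betw_def by (metis imageE lessThan_iff)
  \<comment> \<open>Only the digit chosen at depth \<open>i\<close> is changed, so the path up to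
    depth \<open>i\<close> is kept.\<close>
  have "vert (a(Suc i := c)) i = vert a i" by (rule vert_cong) auto
  then have "edge (a(Suc i := c)) i = e" using c by (simp add: edge_def)
  moreover have "a(Suc i := c) \<in> digits" using v c by auto
  ultimately show ?thesis using \<open>i < d\<close> by blast
qed

lemma vert_surj:
  assumes "v \<in> tverts T"
  shows "\<exists>a\<in>digits. \<exists>i\<le>d. v = vert a i"
  using reachable_from_root[OF assms]
proof (induction rule: reachable_induct)
  case base
  then show ?case using digits_nonempty by (metis vert.simps(1) zero_le)
next
  case (step u v)
  then obtain a i where u: "a \<in> digits" "i \<le> d" "u = vert a i" by blast
  from step(2) obtain e where e: "e \<in> tarcs T" "tail (cells T) e = u" "head (cells T) e = v"
    by (auto simp: arcs_ends_def arc_to_ends_def)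
  then obtain b where b: "b \<in> digits" "i < d" "e = edge b i" using edge_surj u by blast
  then have "v = vert b (Suc i)" using vert_edge(2)[of b i] e by simp
  then show ?case using b(1) Suc_leI[OF b(2)] by blast
qed

lemma arc_surj:
  assumes "e \<in> tarcs T"
  shows "\<exists>a\<in>digits. \<exists>i<d. e = edge a i"
proof -
  obtain a i where ai: "a \<in> digits" "i \<le> d" "tail (cells T) e = vert a i"
    using vert_surj[OF tail_in_verts[OF assms]] by blast
  show ?thesis using edge_surj[OF ai(1,2) assms ai(3)] by blast
qed

lemma arcs_disjoint:
  assumes "e \<in> tarcs T" "x \<in> e"
  shows "x \<notin> tverts T" and "e' \<in> tarcs T \<Longrightarrow> x \<in> e' \<Longrightarrow> e = e'"
proof -
  have *: "tarcs T = open_edges (tspace T) (tverts T)"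
    using tdg by (simp add: is_top_digraph_def)
  have "e \<subseteq> topspace (subtopology (tspace T) (topspace (tspace T) - tverts T))"
    using assms(1) unfolding * by (rule connected_components_of_subset)
  then show "x \<notin> tverts T" using assms by auto
  show "e' \<in> tarcs T \<Longrightarrow> x \<in> e' \<Longrightarrow> e = e'"
    using assms pairwise_disjoint_connected_components_of[of "subtopology (tspace T) (topspace (tspace T) - tverts T)"]
    unfolding * pairwise_def disjnt_def by blast
qed

lemma topspace_cells: "topspace (tspace T) = tverts T \<union> \<Union>(tarcs T)"
proof -
  have *: "tarcs T = open_edges (tspace T) (tverts T)" "tverts T \<subseteq> topspace (tspace T)"
    using tdg by (auto simp: is_top_digraph_def)
  have "\<Union>(tarcs T) = topspace (tspace T) - tverts T"
    unfolding * Union_connected_components_of by auto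
  then show ?thesis using * by auto
qed

section \<open>Characteristic maps of the edges\<close>

definition param :: "'a set \<Rightarrow> real \<Rightarrow> 'a" where
  "param e = (SOME \<phi>. homeomorphic_map (top_of_set {-1..1::real})
               (subtopology (tspace T) (tspace T closure_of e)) \<phi> \<and>
             \<phi> ` {-1<..<1} = e \<and> \<phi> (-1) = tail (cells T) e \<and> \<phi> 1 = head (cells T) e)"

lemma param:
  assumes "e \<in> tarcs T"
  shows "homeomorphic_map (top_of_set {-1..1::real})
               (subtopology (tspace T) (tspace T closure_of e)) (param e)"
    "param e ` {-1<..<1} = e" "param e (-1) = tail (cells T) e" "param e 1 = head (cells T) e"
proof -
  have "\<exists>\<phi>. homeomorphic_map (top_of_set {-1..1::real})
               (subtopology (tspace T) (tspace T closure_of e)) \<phi> \<and>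
             \<phi> ` {-1<..<1} = e \<and> \<phi> (-1) = tail (cells T) e \<and> \<phi> 1 = head (cells T) e"
    using tdg assms by (simp add: is_top_digraph_def)
  from someI_ex[OF this, folded param_def]
  show "homeomorphic_map (top_of_set {-1..1::real})
               (subtopology (tspace T) (tspace T closure_of e)) (param e)"
    "param e ` {-1<..<1} = e" "param e (-1) = tail (cells T) e" "param e 1 = head (cells T) e"
    by auto
qed

lemma param_continuous:
  assumes "e \<in> tarcs T"
  shows "continuous_map (top_of_set {-1..1::real}) (tspace T) (param e)"
  using homeomorphic_imp_continuous_map[OF param(1)[OF assms]]
  by (simp add: continuous_map_in_subtopology)

lemma param_inj:
  assumes "e \<in> tarcs T"
  shows "inj_on (param e) {-1..1}"
  using homeomorphic_imp_injective_map[OF param(1)[OF assms]] by simp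

end

section \<open>Root-to-leaf paths parametrised by prescribed heights\<close>

locale balanced_levels = balanced +
  fixes s :: "nat \<Rightarrow> real"
  assumes s_mono: "strict_mono_on {0..d} s"
begin

lemma s_less_iff: "i \<le> d \<Longrightarrow> j \<le> d \<Longrightarrow> s i < s j \<longleftrightarrow> i < j"
  using strict_mono_on_less[OF s_mono] by auto

lemma s_le_iff: "i \<le> d \<Longrightarrow> j \<le> d \<Longrightarrow> s i \<le> s j \<longleftrightarrow> i \<le> j"
  using strict_mono_on_less_eq[OF s_mono] by auto

lemma s_eq_iff: "i \<le> d \<Longrightarrow> j \<le> d \<Longrightarrow> s i = s j \<longleftrightarrow> i = j"
  using strict_mono_on_eq[OF s_mono] by auto

text \<open>The increasing affine map of \<open>{s i..s (Suc i)}\<close> onto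
  \<open>{-1..1}\<close>, the domain of the characteristic maps. It imposes the heights
  \<open>s\<close> on a tree whose edges carry no metric.\<close>

definition aff :: "nat \<Rightarrow> real \<Rightarrow> real" where
  "aff i x = 2 * (x - s i) / (s (Suc i) - s i) - 1"

lemma aff:
  assumes "i < d"
  shows "aff i (s i) = -1" "aff i (s (Suc i)) = 1"
    "aff i x \<in> {-1..1} \<longleftrightarrow> x \<in> {s i..s (Suc i)}"
    "aff i x \<in> {-1<..<1} \<longleftrightarrow> x \<in> {s i<..<s (Suc i)}"
    "aff i x = aff i y \<longleftrightarrow> x = y"
    "aff i ` {s i<..<s (Suc i)} = {-1<..<1}"
proof -
  have *: "s (Suc i) - s i > 0" using s_less_iff[of i "Suc i"] assms by simp
  show "aff i (s i) = -1" "aff i (s (Suc i)) = 1"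
    "aff i x \<in> {-1..1} \<longleftrightarrow> x \<in> {s i..s (Suc i)}"
    and 4: "aff i x \<in> {-1<..<1} \<longleftrightarrow> x \<in> {s i<..<s (Suc i)}" for x
    using * by (auto simp: aff_def field_simps)
  show "aff i x = aff i y \<longleftrightarrow> x = y" using * by (simp add: aff_def)
  have "z \<in> aff i ` {s i<..<s (Suc i)}" if z: "z \<in> {-1<..<1}" for z
  proof -
    define w where "w = s i + (z + 1) * (s (Suc i) - s i) / 2"
    have w: "aff i w = z" unfolding w_def using * by (simp add: aff_def field_simps)
    then have "w \<in> {s i<..<s (Suc i)}" using 4[of w] z by blast
    then show ?thesis using w by blast
  qed
  then show "aff i ` {s i<..<s (Suc i)} = {-1<..<1}" using 4 by blast
qed

definition path :: "(nat \<Rightarrow> nat) \<Rightarrow> real \<Rightarrow> 'a" where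
  "path a x = (let i = (LEAST i. x \<le> s (Suc i)) in param (edge a i) (aff i x))"

text \<open>The only conflict is at an inner level, where \<open>LEAST\<close> selects the edge that
  ends there; the next edge starts at the same vertex, so both formulas agree.\<close>

lemma path_eq:
  assumes a: "a \<in> digits" and i: "i < d" and x: "x \<in> {s i..s (Suc i)}"
  shows "path a x = param (edge a i) (aff i x)"
proof -
  let ?j = "LEAST i. x \<le> s (Suc i)"
  have "?j \<le> i" by (rule Least_le) (use x in auto)
  have jx: "x \<le> s (Suc ?j)" by (rule LeastI[of _ i]) (use x in auto)
  show ?thesis
  proof (cases "?j = i")
    case True
    then show ?thesis by (simp add: path_def)
  next
    case False
    then have "?j < i" using \<open>?j \<le> i\<close> by simp
    then have "s (Suc ?j) \<le> s i" using s_le_iff[of "Suc ?j" i] i by simp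
    then have eq: "x = s i" "s (Suc ?j) = s i" using x jx by auto
    then have j: "i = Suc ?j" using s_eq_iff[of "Suc ?j" i] \<open>?j < i\<close> i by simp
    have jd: "?j < d" using \<open>?j < i\<close> i by simp
    have "path a x = param (edge a ?j) 1" using aff(2)[OF jd] eq by (simp add: path_def)
    also have "\<dots> = vert a i" using param(4) vert_edge(2)[OF a jd] j by metis
    also have "\<dots> = param (edge a i) (-1)" using param(3) vert_edge(2)[OF a i] by metis
    also have "\<dots> = param (edge a i) (aff i x)" using aff(1)[OF i] eq by simp
    finally show ?thesis .
  qed
qed

lemma path_level:
  assumes a: "a \<in> digits" and i: "i \<le> d"
  shows "path a (s i) = vert a i"
proof (cases "i < d")
  case True
  then have "path a (s i) = param (edge a i) (aff i (s i))"
    using s_le_iff[of i "Suc i"] by (intro path_eq a) auto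
  then show ?thesis using True aff(1) param(3) vert_edge(2)[OF a True] by metis
next
  case False
  then obtain j where j: "i = Suc j" "j < d" using i d_pos by (cases i) auto
  then have "path a (s i) = param (edge a j) (aff j (s i))"
    using s_le_iff[of j "Suc j"] by (intro path_eq a) auto
  then show ?thesis using j aff(2) param(4) vert_edge(2)[OF a j(2)] by metis
qed

lemma path_in_edge:
  assumes a: "a \<in> digits" and i: "i < d" and x: "x \<in> {s i<..<s (Suc i)}"
  shows "path a x \<in> edge a i"
proof -
  have "path a x = param (edge a i) (aff i x)" using x by (intro path_eq a i) auto
  moreover have "aff i x \<in> {-1<..<1}" using aff(4)[OF i] x by simp
  ultimately show ?thesis using param(2) vert_edge(2)[OF a i] by blast
qed

lemma path_image_edge:
  assumes a: "a \<in> digits" and i: "i < d"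
  shows "path a ` {s i<..<s (Suc i)} = edge a i"
proof -
  have "path a ` {s i<..<s (Suc i)} = param (edge a i) ` aff i ` {s i<..<s (Suc i)}"
    unfolding image_image by (intro image_cong refl path_eq a i) auto
  then show ?thesis using aff(6)[OF i] param(2) vert_edge(2)[OF a i] by metis
qed

lemma level_cases:
  assumes "x \<in> {s 0..s d}"
  obtains i where "i \<le> d" "x = s i" | i where "i < d" "x \<in> {s i<..<s (Suc i)}"
proof -
  define i where "i = (LEAST i. x \<le> s i)"
  have "i \<le> d" unfolding i_def by (rule Least_le) (use assms in auto)
  have xi: "x \<le> s i" unfolding i_def by (rule LeastI[of _ d]) (use assms in auto)
  show thesis
  proof (cases "x = s i")
    case False
    then have "i \<noteq> 0" using xi assms by (cases i) auto
    then obtain j where j: "i = Suc j" by (cases i) auto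
    then have "\<not> x \<le> s j" using not_less_Least[of j "\<lambda>i. x \<le> s i"] unfolding i_def by auto
    then show thesis using that(2)[of j] j xi False \<open>i \<le> d\<close> by auto
  qed (use that \<open>i \<le> d\<close> in blast)
qed

text \<open>This is the tree in coordinates. Digit \<open>i\<close> is chosen at height
  \<open>s (i - 1)\<close> and matters strictly above it. Vertices and open edges are disjoint, so
  the levels and the open intervals between them can be treated separately.\<close>

lemma path_eq_iff:
  assumes a: "a \<in> digits" and b: "b \<in> digits" and x: "x \<in> {s 0..s d}" and y: "y \<in> {s 0..s d}"
  shows "path a x = path b y \<longleftrightarrow> x = y \<and> (\<forall>i\<in>{1..d}. s (i - 1) < x \<longrightarrow> a i = b i)"
  using x
proof (cases rule: level_cases)
  case (1 i)
  have pa: "path a x = vert a i" using 1 path_level[OF a] by simp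
  show ?thesis using y
  proof (cases rule: level_cases)
    case (1 j)
    have pb: "path b y = vert b j" using 1 path_level[OF b] by simp
    have "{m \<in> {1..d}. s (m - 1) < x} = {1..i}"
      using \<open>x = s i\<close> \<open>i \<le> d\<close> s_less_iff by fastforce
    then have "(\<forall>m\<in>{1..d}. s (m - 1) < x \<longrightarrow> a m = b m) \<longleftrightarrow> (\<forall>m\<in>{1..i}. a m = b m)" by blast
    moreover have "x = y \<longleftrightarrow> i = j" using 1 \<open>x = s i\<close> \<open>i \<le> d\<close> s_eq_iff by simp
    ultimately show ?thesis using vert_eq_iff[OF a b] pa pb 1 \<open>i \<le> d\<close> by simp
  next
    case (2 j)
    have "path b y \<notin> tverts T" using path_in_edge[OF b] 2 arcs_disjoint(1) vert_edge(2)[OF b] by blast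
    moreover have "vert a i \<in> tverts T" using vert_edge(1)[OF a] 1 by simp
    moreover have "x \<noteq> y" using 1 2 s_less_iff[of i j] s_less_iff[of j i] s_less_iff[of i "Suc j"] s_le_iff[of "Suc j" i] by auto
    ultimately show ?thesis using pa by auto
  qed
next
  case (2 i)
  have pa: "path a x \<in> edge a i" "edge a i \<in> tarcs T" using 2 path_in_edge[OF a] vert_edge(2)[OF a] by auto
  show ?thesis using y
  proof (cases rule: level_cases)
    case (1 j)
    have "path b y \<in> tverts T" using path_level[OF b] vert_edge(1)[OF b] 1 by simp
    moreover have "x \<noteq> y" using 1 2 s_less_iff[of j i] s_less_iff[of i j] s_less_iff[of j "Suc i"] s_le_iff[of "Suc i" j] by auto
    ultimately show ?thesis using pa arcs_disjoint(1) by metis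
  next
    case (2 j)
    have pb: "path b y \<in> edge b j" "edge b j \<in> tarcs T" using 2 path_in_edge[OF b] vert_edge(2)[OF b] by auto
    have set: "{m \<in> {1..d}. s (m - 1) < x} = {1..Suc i}"
    proof -
      have "s (m - 1) < x \<longleftrightarrow> m \<le> Suc i" if "m \<in> {1..d}" for m
      proof
        assume "s (m - 1) < x"
        then have "s (m - 1) < s (Suc i)" using \<open>x \<in> {s i<..<s (Suc i)}\<close> by auto
        then show "m \<le> Suc i" using s_less_iff[of "m - 1" "Suc i"] that \<open>i < d\<close> by (cases m) auto
      next
        assume "m \<le> Suc i"
        then have "s (m - 1) \<le> s i" using s_le_iff[of "m - 1" i] that \<open>i < d\<close> by (cases m) auto
        then show "s (m - 1) < x" using \<open>x \<in> {s i<..<s (Suc i)}\<close> by auto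
      qed
      then show ?thesis using \<open>i < d\<close> by auto
    qed
    then have *: "(\<forall>m\<in>{1..d}. s (m - 1) < x \<longrightarrow> a m = b m) \<longleftrightarrow> (\<forall>m\<in>{1..Suc i}. a m = b m)" by blast
    have ex: "path a x = param (edge a i) (aff i x)" using \<open>x \<in> {s i<..<s (Suc i)}\<close> by (intro path_eq a \<open>i < d\<close>) auto
    have ey: "path b y = param (edge b j) (aff j y)" using 2 by (intro path_eq b) auto
    show ?thesis
    proof
      assume eq: "path a x = path b y"
      then have e: "edge a i = edge b j" using pa pb arcs_disjoint(2) by metis
      then have ij: "i = j \<and> (\<forall>m\<in>{1..Suc i}. a m = b m)" using edge_eq_iff[OF a b] \<open>i < d\<close> 2 by blast
      have "aff i x \<in> {-1..1}" "aff i y \<in> {-1..1}" using aff(3)[OF \<open>i < d\<close>] \<open>x \<in> {s i<..<s (Suc i)}\<close> 2 ij by auto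
      then have "aff i x = aff i y" using eq ex ey e ij param_inj[OF pa(2)] by (auto dest: inj_onD)
      then show "x = y \<and> (\<forall>m\<in>{1..d}. s (m - 1) < x \<longrightarrow> a m = b m)" using aff(5)[OF \<open>i < d\<close>] ij * by simp
    next
      assume eq: "x = y \<and> (\<forall>m\<in>{1..d}. s (m - 1) < x \<longrightarrow> a m = b m)"
      have "s i < s (Suc j)" "s j < s (Suc i)" using eq 2 \<open>x \<in> {s i<..<s (Suc i)}\<close> by auto
      then have "i = j" using s_less_iff[of i "Suc j"] s_less_iff[of j "Suc i"] 2 \<open>i < d\<close> by auto
      moreover have "\<forall>m\<in>{1..Suc i}. a m = b m" using eq * by blast
      ultimately have "edge a i = edge b j" using edge_eq_iff[OF a b] 2 \<open>i < d\<close> by blast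
      then show "path a x = path b y" using ex ey eq \<open>i = j\<close> by simp
    qed
  qed
qed

lemma path_continuous:
  assumes a: "a \<in> digits"
  shows "continuous_map (top_of_set {s 0..s d}) (tspace T) (path a)"
proof (rule pasting_lemma_closed[where I = "{..<d}" and T = "\<lambda>i. {s i..s (Suc i)}" and f = "\<lambda>i. path a"])
  fix i assume i: "i \<in> {..<d}"
  then have sub: "{s i..s (Suc i)} \<subseteq> {s 0..s d}" using s_le_iff[of 0 i] s_le_iff[of "Suc i" d] by auto
  then show "closedin (top_of_set {s 0..s d}) {s i..s (Suc i)}" by (intro closed_subset) auto
  have "continuous_map (top_of_set {s i..s (Suc i)}) (top_of_set {-1..1}) (aff i)"
  proof -
    have "continuous_on {s i..s (Suc i)} (aff i)" unfolding aff_def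
      using s_eq_iff[of i "Suc i"] i by (intro continuous_intros) auto
    then show ?thesis using aff(3)[of i] i by auto
  qed
  then have "continuous_map (top_of_set {s i..s (Suc i)}) (tspace T) (param (edge a i) \<circ> aff i)"
    using param_continuous vert_edge(2)[OF a] i by (intro continuous_map_compose) auto
  then have "continuous_map (top_of_set {s i..s (Suc i)}) (tspace T) (path a)"
    by (rule continuous_map_eq) (use path_eq[OF a] i in auto)
  then show "continuous_map (subtopology (top_of_set {s 0..s d}) {s i..s (Suc i)}) (tspace T) (path a)"
    using sub by (simp add: subtopology_subtopology Int_absorb1 del: Int_atLeastAtMost)
next
  fix x assume "x \<in> topspace (top_of_set {s 0..s d})"
  then have "x \<in> {s 0..s d}" by simp
  then show "\<exists>j. j \<in> {..<d} \<and> x \<in> {s j..s (Suc j)} \<and> path a x = path a x"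
  proof (cases rule: level_cases)
    case (1 i)
    show ?thesis
    proof (cases "i < d")
      case True
      then show ?thesis using 1 s_le_iff[of i "Suc i"] by auto
    next
      case False
      then obtain j where j: "i = Suc j" "j < d" using 1 d_pos by (cases i) auto
      then have "x \<in> {s j..s (Suc j)}" using 1(2) s_le_iff[of j "Suc j"] by simp
      then show ?thesis using j by blast
    qed
  next
    case (2 i)
    then show ?thesis by (intro exI[of _ i]) auto
  qed
qed auto

lemma tverts_eq_levels: "tverts T = {path a (s i) | a i. a \<in> digits \<and> i \<le> d}"
proof (intro equalityI subsetI)
  fix v assume "v \<in> tverts T"
  then obtain a i where *: "a \<in> digits" "i \<le> d" "v = vert a i" using vert_surj by blast
  then have "v = path a (s i)" using path_level[OF *(1,2)] by (simp only:)
  then show "v \<in> {path a (s i) | a i. a \<in> digits \<and> i \<le> d}" using * by blast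
next
  fix v assume "v \<in> {path a (s i) | a i. a \<in> digits \<and> i \<le> d}"
  then obtain a i where *: "a \<in> digits" "i \<le> d" "v = path a (s i)" by blast
  show "v \<in> tverts T" using vert_edge(1)[OF *(1,2)] *(3) path_level[OF *(1,2)] by (simp only:)
qed

lemma tarcs_eq_paths: "tarcs T = {path a ` {s i<..<s (Suc i)} | a i. a \<in> digits \<and> i < d}"
proof (intro equalityI subsetI)
  fix e assume "e \<in> tarcs T"
  then obtain a i where *: "a \<in> digits" "i < d" "e = edge a i" using arc_surj by blast
  then have "e = path a ` {s i<..<s (Suc i)}" using path_image_edge[OF *(1,2)] by (simp only:)
  then show "e \<in> {path a ` {s i<..<s (Suc i)} | a i. a \<in> digits \<and> i < d}" using * by blast
next
  fix e assume "e \<in> {path a ` {s i<..<s (Suc i)} | a i. a \<in> digits \<and> i < d}"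
  then obtain a i where *: "a \<in> digits" "i < d" "e = path a ` {s i<..<s (Suc i)}" by blast
  show "e \<in> tarcs T" using vert_edge(2)[OF *(1,2)] *(3) path_image_edge[OF *(1,2)] by (simp only:)
qed

lemma topspace_eq_paths: "topspace (tspace T) = (\<Union>a\<in>digits. path a ` {s 0..s d})"
proof
  show "(\<Union>a\<in>digits. path a ` {s 0..s d}) \<subseteq> topspace (tspace T)"
    by (intro UN_least)
      (use continuous_map_image_subset_topspace[OF path_continuous] in simp)
  let ?U = "\<Union>a\<in>digits. path a ` {s 0..s d}"
  show "topspace (tspace T) \<subseteq> ?U"
  proof
    fix z assume "z \<in> topspace (tspace T)"
    then consider "z \<in> tverts T" | e where "e \<in> tarcs T" "z \<in> e" unfolding topspace_cells by blast
    then show "z \<in> ?U"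
    proof cases
      case 1
      then obtain a i where z: "a \<in> digits" "i \<le> d" "z = path a (s i)"
        unfolding tverts_eq_levels by blast
      then have m: "s i \<in> {s 0..s d}" using s_le_iff[of 0 i] s_le_iff[of i d] by simp
      show ?thesis unfolding z(3) by (rule UN_I[OF z(1)]) (rule imageI[OF m])
    next
      case 2
      then obtain a i where e: "a \<in> digits" "i < d" "e = path a ` {s i<..<s (Suc i)}"
        unfolding tarcs_eq_paths by blast
      then obtain x where x: "x \<in> {s i<..<s (Suc i)}" "z = path a x" using 2(2) by blast
      then have m: "x \<in> {s 0..s d}" using e(2) s_le_iff[of 0 i] s_le_iff[of "Suc i" d] by auto
      show ?thesis unfolding x(2) by (rule UN_I[OF e(1)]) (rule imageI[OF m])
    qed
  qed
qed

lemma path_ends: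
  assumes "a \<in> digits" "i < d"
  shows "tail (cells T) (path a ` {s i<..<s (Suc i)}) = path a (s i)"
    "head (cells T) (path a ` {s i<..<s (Suc i)}) = path a (s (Suc i))"
  unfolding path_image_edge[OF assms]
  using assms(2) vert_edge(2)[OF assms] path_level[OF assms(1)] by (simp_all del: vert.simps)

lemma path_root: "a \<in> digits \<Longrightarrow> path a (s 0) = v0"
  using path_level[of a 0] by simp

end

section \<open>Digraphs swept out by monotone paths\<close>

lemma arg_min_unique:
  assumes "{v. P v} = {a, b}" and "f a < (f b :: real)"
  shows "(ARG_MIN f v. P v) = a" and "(ARG_MAX f v. P v) = b"
proof -
  have P: "P v \<longleftrightarrow> v = a \<or> v = b" for v using assms(1) by blast
  show "(ARG_MIN f v. P v) = a"
    by (rule arg_minI[of P a]) (use P assms(2) in auto)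
  show "(ARG_MAX f v. P v) = b"
    by (rule arg_maxI[of P b]) (use P assms(2) in auto)
qed

lemma PR_fun_Reeb_class:
  assumes p: "p \<in> Euclidean_space k closure_of D"
  shows "PR_fun (Reeb_class k D p) = p 0"
proof -
  let ?L = "subtopology (Euclidean_space k) {x \<in> Euclidean_space k closure_of D. x 0 = p 0}"
  have "p \<in> topspace ?L" using p closure_of_subset_topspace[of "Euclidean_space k" D] by auto
  then have "p \<in> Reeb_class k D p" unfolding Reeb_class_def mem_Collect_eq connected_component_of_refl .
  moreover have "r 0 = p 0" if "r \<in> Reeb_class k D p" for r
  proof -
    have "r \<in> topspace ?L"
      using that connected_component_of_subset_topspace[of ?L p] unfolding Reeb_class_def by (rule subsetD[rotated])
    then show ?thesis by simp
  qed
  ultimately have "(\<lambda>x. x 0) ` Reeb_class k D p = {p 0}" by blast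
  then show ?thesis by (simp add: PR_fun_def)
qed

text \<open>All that the comparison with a Poincare-Reeb digraph needs to know about the glued tree.
  Distinct indices may give the same path; \<open>\<Gamma>_height\<close> makes the parameter a
  well-defined height, and \<open>\<Gamma>_merge\<close> lets paths part or meet only at the levels
  \<open>t i\<close>.\<close>

locale path_digraph =
  fixes G :: "'g top_digraph" and A :: "'u set" and \<Gamma> :: "'u \<Rightarrow> real \<Rightarrow> 'g"
    and t :: "nat \<Rightarrow> real" and n :: nat
  assumes Hausdorff: "Hausdorff_space (tspace G)"
    and finite_arcs: "finite (tarcs G)"
    and n_pos: "n \<ge> 1"
    and t_mono: "strict_mono_on {1..n} t"
    and \<Gamma>_continuous: "u \<in> A \<Longrightarrow> continuous_map (top_of_set {t 1..t n}) (tspace G) (\<Gamma> u)"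
    and \<Gamma>_height: "\<lbrakk>u \<in> A; v \<in> A; x \<in> {t 1..t n}; y \<in> {t 1..t n}; \<Gamma> u x = \<Gamma> v y\<rbrakk> \<Longrightarrow> x = y"
    and \<Gamma>_merge: "\<lbrakk>u \<in> A; v \<in> A; i \<in> {1..<n}; x \<in> {t i<..<t (Suc i)}; y \<in> {t i<..<t (Suc i)};
                   \<Gamma> u x = \<Gamma> v x\<rbrakk> \<Longrightarrow> \<Gamma> u y = \<Gamma> v y"
    and topspace_eq: "topspace (tspace G) = (\<Union>u\<in>A. \<Gamma> u ` {t 1..t n})"
    and tverts_eq: "tverts G = {\<Gamma> u (t i) | u i. u \<in> A \<and> i \<in> {1..n}}"
    and tarcs_eq: "tarcs G = {\<Gamma> u ` {t i<..<t (Suc i)} | u i. u \<in> A \<and> i \<in> {1..<n}}"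
    and tail_eq: "\<lbrakk>u \<in> A; i \<in> {1..<n}\<rbrakk> \<Longrightarrow> tail (cells G) (\<Gamma> u ` {t i<..<t (Suc i)}) = \<Gamma> u (t i)"
    and head_eq: "\<lbrakk>u \<in> A; i \<in> {1..<n}\<rbrakk> \<Longrightarrow> head (cells G) (\<Gamma> u ` {t i<..<t (Suc i)}) = \<Gamma> u (t (Suc i))"
begin

lemma t_less_iff: "i \<in> {1..n} \<Longrightarrow> j \<in> {1..n} \<Longrightarrow> t i < t j \<longleftrightarrow> i < j"
  using strict_mono_on_less[OF t_mono] by auto

lemma t_le_iff: "i \<in> {1..n} \<Longrightarrow> j \<in> {1..n} \<Longrightarrow> t i \<le> t j \<longleftrightarrow> i \<le> j"
  using strict_mono_on_less_eq[OF t_mono] by auto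

lemma t_eq_iff: "i \<in> {1..n} \<Longrightarrow> j \<in> {1..n} \<Longrightarrow> t i = t j \<longleftrightarrow> i = j"
  using strict_mono_on_eq[OF t_mono] by auto

lemma edge_interval:
  assumes "i \<in> {1..<n}"
  shows "{t i..t (Suc i)} \<subseteq> {t 1..t n}" "t i < t (Suc i)"
proof -
  have "t 1 \<le> t i" "t (Suc i) \<le> t n" "t i < t (Suc i)"
    using assms t_le_iff[of 1 i] t_le_iff[of "Suc i" n] t_less_iff[of i "Suc i"] by auto
  then show "{t i..t (Suc i)} \<subseteq> {t 1..t n}" "t i < t (Suc i)" by auto
qed

lemma level_in: "i \<in> {1..n} \<Longrightarrow> t i \<in> {t 1..t n}"
  using t_le_iff[of 1 i] t_le_iff[of i n] by auto

lemma level_in_edge: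
  assumes "i \<in> {1..<n}" "j \<in> {1..n}" "t j \<in> {t i..t (Suc i)}"
  shows "j = i \<or> j = Suc i"
  using assms t_le_iff[of i j] t_le_iff[of j "Suc i"] by auto

lemma vert_iff:
  assumes "u \<in> A" "x \<in> {t 1..t n}"
  shows "\<Gamma> u x \<in> tverts G \<longleftrightarrow> x \<in> t ` {1..n}"
proof
  assume "\<Gamma> u x \<in> tverts G"
  then obtain v i where "v \<in> A" "i \<in> {1..n}" "\<Gamma> u x = \<Gamma> v (t i)" unfolding tverts_eq by blast
  then have "x = t i" using \<Gamma>_height assms level_in by blast
  then show "x \<in> t ` {1..n}" using \<open>i \<in> {1..n}\<close> by blast
qed (use assms tverts_eq in blast)

lemma level_cases:
  assumes "x \<in> {t 1..t n}" "x \<notin> t ` {1..n}"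
  obtains i where "i \<in> {1..<n}" "x \<in> {t i<..<t (Suc i)}"
proof -
  note n = n_pos
  define i where "i = (LEAST i. x < t (Suc i))"
  have "x \<noteq> t n" using assms(2) n by auto
  moreover have "Suc (n - 1) = n" using n by simp
  ultimately have xn: "x < t (Suc (n - 1))" using assms(1) by auto
  then have "i \<le> n - 1" unfolding i_def by (rule Least_le)
  have xi: "x < t (Suc i)" using xn unfolding i_def by (rule LeastI)
  have "i \<noteq> 0" using xi assms(1) by (intro notI) auto
  then obtain j where j: "i = Suc j" by (cases i) auto
  then have "\<not> x < t (Suc j)" using not_less_Least[of j "\<lambda>i. x < t (Suc i)"] unfolding i_def by auto
  moreover have "x \<noteq> t i" using assms(2) \<open>i \<noteq> 0\<close> \<open>i \<le> n - 1\<close> by auto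
  ultimately have "x \<in> {t i<..<t (Suc i)}" using xi j by auto
  then show thesis using that[of i] \<open>i \<noteq> 0\<close> \<open>i \<le> n - 1\<close> by auto
qed

lemma compactin_path_segment:
  assumes "u \<in> A" "{x..y} \<subseteq> {t 1..t n}"
  shows "compactin (tspace G) (\<Gamma> u ` {x..y})"
proof -
  have "compactin (top_of_set {t 1..t n}) {x..y}"
    using assms(2) by (simp add: compactin_subtopology)
  then show ?thesis using \<Gamma>_continuous[OF assms(1)] by (rule image_compactin)
qed

lemma arc_Int_edge:
  assumes u: "u \<in> A" and i: "i \<in> {1..<n}"
  shows "\<Gamma> u ` {t i..t (Suc i)} - tverts G = \<Gamma> u ` {t i<..<t (Suc i)}"
    and "tverts G \<inter> \<Gamma> u ` {t i..t (Suc i)} = {\<Gamma> u (t i), \<Gamma> u (t (Suc i))}"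
proof -
  note I = edge_interval[OF i]
  have v: "\<Gamma> u x \<in> tverts G \<longleftrightarrow> x = t i \<or> x = t (Suc i)" if x: "x \<in> {t i..t (Suc i)}" for x
  proof -
    have "x \<in> {t 1..t n}" using x I by blast
    then have "\<Gamma> u x \<in> tverts G \<longleftrightarrow> x \<in> t ` {1..n}" by (rule vert_iff[OF u])
    also have "\<dots> \<longleftrightarrow> x = t i \<or> x = t (Suc i)"
    proof
      assume "x \<in> t ` {1..n}"
      then obtain j where "j \<in> {1..n}" "x = t j" by blast
      then show "x = t i \<or> x = t (Suc i)" using level_in_edge[OF i, of j] x by auto
    next
      show "x = t i \<or> x = t (Suc i) \<Longrightarrow> x \<in> t ` {1..n}" using i by auto
    qed
    finally show ?thesis .
  qed
  have *: "{x \<in> {t i..t (Suc i)}. \<not> (x = t i \<or> x = t (Suc i))} = {t i<..<t (Suc i)}" by auto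
  have "\<Gamma> u ` {t i..t (Suc i)} - tverts G = \<Gamma> u ` {x \<in> {t i..t (Suc i)}. \<Gamma> u x \<notin> tverts G}" by blast
  also have "\<dots> = \<Gamma> u ` {x \<in> {t i..t (Suc i)}. \<not> (x = t i \<or> x = t (Suc i))}"
    using v by (intro arg_cong[where f = "(`) (\<Gamma> u)"] Collect_cong) blast
  finally show "\<Gamma> u ` {t i..t (Suc i)} - tverts G = \<Gamma> u ` {t i<..<t (Suc i)}" unfolding * .
  have *: "{x \<in> {t i..t (Suc i)}. x = t i \<or> x = t (Suc i)} = {t i, t (Suc i)}" using I by auto
  have "tverts G \<inter> \<Gamma> u ` {t i..t (Suc i)} = \<Gamma> u ` {x \<in> {t i..t (Suc i)}. \<Gamma> u x \<in> tverts G}" by blast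
  also have "\<dots> = \<Gamma> u ` {x \<in> {t i..t (Suc i)}. x = t i \<or> x = t (Suc i)}"
    using v by (intro arg_cong[where f = "(`) (\<Gamma> u)"] Collect_cong) blast
  finally show "tverts G \<inter> \<Gamma> u ` {t i..t (Suc i)} = {\<Gamma> u (t i), \<Gamma> u (t (Suc i))}" unfolding * by simp
qed

lemma closure_of_arc:
  assumes u: "u \<in> A" and i: "i \<in> {1..<n}"
  shows "tspace G closure_of (\<Gamma> u ` {t i<..<t (Suc i)}) = \<Gamma> u ` {t i..t (Suc i)}"
proof
  note I = edge_interval[OF i]
  have "closedin (tspace G) (\<Gamma> u ` {t i..t (Suc i)})"
    using compactin_path_segment[OF u I(1)] Hausdorff by (rule compactin_imp_closedin[rotated])
  then show "tspace G closure_of (\<Gamma> u ` {t i<..<t (Suc i)}) \<subseteq> \<Gamma> u ` {t i..t (Suc i)}"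
    by (intro closure_of_minimal image_mono) auto
  have cl: "{t i..t (Suc i)} \<subseteq> top_of_set {t 1..t n} closure_of {t i<..<t (Suc i)}"
  proof -
    have "{t i..t (Suc i)} = closure {t i<..<t (Suc i)}" using I by simp
    then show ?thesis using I by (auto simp: closure_of_subtopology Int_absorb1 greaterThanLessThan_subseteq_atLeastAtMost_iff)
  qed
  show "\<Gamma> u ` {t i..t (Suc i)} \<subseteq> tspace G closure_of (\<Gamma> u ` {t i<..<t (Suc i)})"
    using cl continuous_map_image_closure_subset[OF \<Gamma>_continuous[OF u], of "{t i<..<t (Suc i)}"] by blast
qed

text \<open>Each arc is connected and, being a compact segment minus the vertices, closed in the
  complement of the vertices. The arcs are disjoint, finitely many and cover this complement, so
  each is also open; a connected clopen set is a component.\<close>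

lemma tarcs_eq_open_edges: "tarcs G = open_edges (tspace G) (tverts G)"
proof -
  let ?Y = "subtopology (tspace G) (topspace (tspace G) - tverts G)"
  have top: "topspace ?Y = topspace (tspace G) - tverts G" by auto
  have conn: "connectedin ?Y e" and closed: "closedin ?Y e" and ne: "e \<noteq> {}" if e: "e \<in> tarcs G" for e
  proof -
    obtain u i where ui: "u \<in> A" "i \<in> {1..<n}" "e = \<Gamma> u ` {t i<..<t (Suc i)}"
      using e unfolding tarcs_eq by blast
    note I = edge_interval[OF ui(2)]
    have sub: "e = \<Gamma> u ` {t i..t (Suc i)} - tverts G" using arc_Int_edge ui by simp
    have img: "\<Gamma> u ` {t i..t (Suc i)} \<subseteq> topspace (tspace G)"
      using compactin_path_segment[OF ui(1) I(1)] by (rule compactin_subset_topspace)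
    have "connectedin (top_of_set {t 1..t n}) {t i<..<t (Suc i)}"
      using I by (auto simp: connectedin_subtopology)
    then have "connectedin (tspace G) e"
      unfolding ui(3) using \<Gamma>_continuous[OF ui(1)] by (rule connectedin_continuous_map_image[rotated])
    then show "connectedin ?Y e" using sub img by (auto simp: connectedin_subtopology)
    have "closedin (tspace G) (\<Gamma> u ` {t i..t (Suc i)})"
      using compactin_path_segment[OF ui(1) I(1)] Hausdorff by (rule compactin_imp_closedin[rotated])
    then show "closedin ?Y e" unfolding closedin_subtopology using sub img by blast
    show "e \<noteq> {}" using ui I by simp
  qed
  have cover: "topspace ?Y \<subseteq> \<Union>(tarcs G)"
  proof
    fix z assume "z \<in> topspace ?Y"
    then obtain u x where z: "u \<in> A" "x \<in> {t 1..t n}" "z = \<Gamma> u x" "z \<notin> tverts G"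
      using top topspace_eq by blast
    then have "x \<notin> t ` {1..n}" using vert_iff by blast
    then obtain i where "i \<in> {1..<n}" "x \<in> {t i<..<t (Suc i)}" using level_cases z by blast
    then have "\<Gamma> u ` {t i<..<t (Suc i)} \<in> tarcs G" "z \<in> \<Gamma> u ` {t i<..<t (Suc i)}"
      unfolding tarcs_eq using z by blast+
    then show "z \<in> \<Union>(tarcs G)" by blast
  qed
  have disj: "e = e'" if ee: "e \<in> tarcs G" "e' \<in> tarcs G" "e \<inter> e' \<noteq> {}" for e e'
  proof -
    obtain u i where ui: "u \<in> A" "i \<in> {1..<n}" "e = \<Gamma> u ` {t i<..<t (Suc i)}"
      using ee unfolding tarcs_eq by blast
    obtain v j where vj: "v \<in> A" "j \<in> {1..<n}" "e' = \<Gamma> v ` {t j<..<t (Suc j)}"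
      using ee unfolding tarcs_eq by blast
    obtain x y where xy: "x \<in> {t i<..<t (Suc i)}" "y \<in> {t j<..<t (Suc j)}" "\<Gamma> u x = \<Gamma> v y"
      using ee(3) ui vj by blast
    have "x \<in> {t 1..t n}" "y \<in> {t 1..t n}" using xy edge_interval(1)[OF ui(2)] edge_interval(1)[OF vj(2)] by auto
    then have "x = y" using \<Gamma>_height xy ui vj by blast
    then have "t i < t (Suc j)" "t j < t (Suc i)" using xy by auto
    then have "i = j" using t_less_iff[of i "Suc j"] t_less_iff[of j "Suc i"] ui vj by auto
    then have "\<Gamma> u z = \<Gamma> v z" if "z \<in> {t i<..<t (Suc i)}" for z
      using \<Gamma>_merge[OF ui(1) vj(1) ui(2) xy(1) that] xy \<open>x = y\<close> by simp
    then show ?thesis unfolding ui(3) vj(3) using \<open>i = j\<close> by (intro image_cong) auto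
  qed
  have comp: "connected_component_of_set ?Y z = e" if e: "e \<in> tarcs G" "z \<in> e" for e z
  proof
    show "e \<subseteq> connected_component_of_set ?Y z" using conn[OF e(1)] e(2) by (rule connected_component_of_maximal)
    have "closedin ?Y (\<Union>(tarcs G - {e}))" using closed finite_arcs by (intro closedin_Union) auto
    moreover have "topspace ?Y - \<Union>(tarcs G - {e}) = e"
      using cover disj e closedin_subset[OF closed[OF e(1)]] by blast
    ultimately have "openin ?Y e" using openin_diff[OF openin_topspace[of ?Y]] by metis
    then show "connected_component_of_set ?Y z \<subseteq> e"
      using connectedin_clopen_cases[OF connectedin_connected_component_of[of ?Y z] closed[OF e(1)]] e(2)
        connected_component_of_refl[of ?Y z] closedin_subset[OF closed[OF e(1)]]
      by (auto simp: disjnt_def)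
  qed
  show ?thesis
  proof
    show "tarcs G \<subseteq> open_edges (tspace G) (tverts G)"
    proof
      fix e assume e: "e \<in> tarcs G"
      then obtain z where z: "z \<in> e" using ne by blast
      then have "z \<in> topspace ?Y" using closedin_subset[OF closed[OF e]] by blast
      then show "e \<in> connected_components_of ?Y"
        unfolding connected_components_of_def
        using imageI[of z "topspace ?Y" "connected_component_of_set ?Y"] comp[OF e z] by simp
    qed
    show "open_edges (tspace G) (tverts G) \<subseteq> tarcs G"
    proof
      fix e assume "e \<in> connected_components_of ?Y"
      then obtain z where z: "e = connected_component_of_set ?Y z" "z \<in> topspace ?Y"
        unfolding connected_components_of_def by (rule imageE)
      then obtain e' where "e' \<in> tarcs G" "z \<in> e'" using cover by blast
      then show "e \<in> tarcs G" using comp[of e' z] z(1) by simp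
    qed
  qed
qed

text \<open>The fibres of \<open>g\<close> are the Reeb classes, so \<open>g\<close> factors through
  the quotient by a continuous bijection from a compact space onto a Hausdorff space, which is a
  homeomorphism. Vertices are matched by height, edges as components of the complement of the
  vertices, and orientations by the heights of the two vertices in the closure of an edge.\<close>

lemma PR_digraph_iso:
  fixes k l :: nat and D :: "(nat \<Rightarrow> real) set" and S :: "nat \<Rightarrow> (nat \<Rightarrow> real) set"
    and g :: "(nat \<Rightarrow> real) \<Rightarrow> 'g"
  defines "C \<equiv> Euclidean_space k closure_of D"
  assumes compact: "compactin (Euclidean_space k) C"
    and g_cont: "continuous_map (subtopology (Euclidean_space k) C) (tspace G) g"
    and g_fibre: "\<And>p q. p \<in> C \<Longrightarrow> q \<in> C \<Longrightarrow> g p = g q \<longleftrightarrow> Reeb_class k D p = Reeb_class k D q"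
    and g_\<Gamma>: "\<And>p. p \<in> C \<Longrightarrow> p 0 \<in> {t 1..t n} \<and> (\<exists>u\<in>A. g p = \<Gamma> u (p 0))"
    and g_surj: "\<And>u x. u \<in> A \<Longrightarrow> x \<in> {t 1..t n} \<Longrightarrow> \<exists>p\<in>C. g p = \<Gamma> u x"
    and verts: "PR_verts k l D S = Reeb_class k D ` {p \<in> C. p 0 \<in> t ` {1..n}}"
  shows "top_digraph_iso (PR_digraph k l D S) G"
proof -
  let ?X = "subtopology (Euclidean_space k) C" and ?q = "Reeb_class k D" and ?P = "PR_space k D"
  let ?V = "PR_verts k l D S"
  have topX: "topspace ?X = C" using compact by (simp add: compactin_subset_topspace Int_absorb1)
  have q: "quotient_map ?X ?P ?q"
    unfolding PR_space_def C_def by (rule quotient_map_quotient_topology)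
  have topP: "topspace ?P = ?q ` C"
    using quotient_imp_surjective_map[OF q] topX by simp
  have fun_q: "PR_fun (?q p) = p 0" if "p \<in> C" for p
    using that unfolding C_def by (rule PR_fun_Reeb_class)
  have g_im: "g ` C = topspace (tspace G)"
  proof -
    have "g ` C \<subseteq> topspace (tspace G)" using g_cont topX by (auto simp: continuous_map_def)
    moreover have "topspace (tspace G) \<subseteq> g ` C" 
    proof
      fix z assume "z \<in> topspace (tspace G)"
      then obtain u x where ux: "u \<in> A" "x \<in> {t 1..t n}" "z = \<Gamma> u x" unfolding topspace_eq by blast
      then obtain p where "p \<in> C" "g p = \<Gamma> u x" using g_surj by blast
      then show "z \<in> g ` C" using ux by force
    qed
    ultimately show ?thesis by blast
  qed
  have fibre: "g x = g y" if "x \<in> topspace ?X" "y \<in> topspace ?X" "?q x = ?q y" for x y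
    using that g_fibre unfolding topX by blast
  obtain h where h: "continuous_map ?P (tspace G) h" "h ` topspace ?P = g ` topspace ?X"
      and hqX: "\<And>p. p \<in> topspace ?X \<Longrightarrow> h (?q p) = g p"
    using quotient_map_lift_exists[OF q g_cont fibre] by blast
  have hq: "h (?q p) = g p" if "p \<in> C" for p by (rule hqX) (use that topX in blast)
  have hom: "homeomorphic_map ?P (tspace G) h"
  proof (rule continuous_imp_homeomorphic_map[OF h(1) _ Hausdorff])
    have "compact_space ?X" using compact by (simp add: compact_space_subtopology)
    then have "compactin ?X (topspace ?X)" by (simp add: compact_space_def)
    then have "compactin ?P (?q ` topspace ?X)" by (rule image_compactin[OF _ quotient_imp_continuous_map[OF q]])
    then show "compact_space ?P" using topP topX by (simp add: compact_space_def)
    show "h ` topspace ?P = topspace (tspace G)" using h(2) g_im topX by simp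
    show "inj_on h (topspace ?P)" unfolding topP using hq g_fibre by (auto simp: inj_on_def)
  qed
  have inj: "inj_on h (topspace ?P)" using hom by (rule homeomorphic_imp_injective_map)
  have VP: "?V \<subseteq> topspace ?P" unfolding verts topP by blast
  have hV: "h ` ?V = tverts G"
  proof
    show "h ` ?V \<subseteq> tverts G"
    proof
      fix z assume "z \<in> h ` ?V"
      then obtain p where p: "p \<in> C" "p 0 \<in> t ` {1..n}" "z = g p" unfolding verts using hq by auto
      then show "z \<in> tverts G" using g_\<Gamma>[OF p(1)] vert_iff by auto
    qed
    show "tverts G \<subseteq> h ` ?V"
    proof
      fix z assume "z \<in> tverts G"
      then obtain u i where ui: "u \<in> A" "i \<in> {1..n}" "z = \<Gamma> u (t i)" unfolding tverts_eq by blast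
      then obtain p where p: "p \<in> C" "g p = z" using g_surj[OF ui(1) level_in[OF ui(2)]] by blast
      obtain v where v: "v \<in> A" "g p = \<Gamma> v (p 0)" "p 0 \<in> {t 1..t n}" using g_\<Gamma>[OF p(1)] by blast
      have "p 0 = t i" by (rule \<Gamma>_height[OF v(1) ui(1) v(3) level_in[OF ui(2)]]) (use p v ui in simp)
      then have "?q p \<in> ?V" unfolding verts using p ui by blast
      then have "h (?q p) \<in> h ` ?V" by (rule imageI)
      then show "z \<in> h ` ?V" using hq[OF p(1)] p(2) by simp
    qed
  qed
  have hom': "homeomorphic_map (subtopology ?P (topspace ?P - ?V)) (subtopology (tspace G) (topspace (tspace G) - tverts G)) h"
  proof (rule homeomorphic_map_subtopologies[OF hom])
    have "h ` (topspace ?P - ?V) = h ` topspace ?P - h ` ?V"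
      using inj_on_image_set_diff[OF inj _ VP] by simp
    then show "h ` (topspace ?P \<inter> (topspace ?P - ?V)) = topspace (tspace G) \<inter> (topspace (tspace G) - tverts G)"
      using hV homeomorphic_imp_surjective_map[OF hom] by (simp add: Int_Diff Int_absorb1)
  qed
  have harcs: "(`) h ` open_edges ?P ?V = tarcs G"
    unfolding tarcs_eq_open_edges using homeomorphic_map_connected_components_of[OF hom'] by simp
  have ends: "tail (cells G) (h ` e) = h (ARG_MIN PR_fun v. v \<in> ?V \<inter> (?P closure_of e))"
     "head (cells G) (h ` e) = h (ARG_MAX PR_fun v. v \<in> ?V \<inter> (?P closure_of e))"
    if e: "e \<in> open_edges ?P ?V" for e
  proof -
    have "h ` e \<in> tarcs G" using harcs e by blast
    then obtain u i where ui: "u \<in> A" "i \<in> {1..<n}" "h ` e = \<Gamma> u ` {t i<..<t (Suc i)}"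
      unfolding tarcs_eq by blast
    have eP: "e \<subseteq> topspace ?P" using connected_components_of_subset[OF e] by auto
    have "h ` (?V \<inter> (?P closure_of e)) = h ` ?V \<inter> h ` (?P closure_of e)"
      by (rule inj_on_image_Int[OF inj VP closure_of_subset_topspace])
    also have "\<dots> = tverts G \<inter> (tspace G closure_of (h ` e))"
      unfolding hV homeomorphic_map_closure_of[OF hom eP] by simp
    also have "\<dots> = {\<Gamma> u (t i), \<Gamma> u (t (Suc i))}"
      unfolding ui(3) closure_of_arc[OF ui(1,2)] using arc_Int_edge(2)[OF ui(1,2)] by simp
    finally have im: "h ` (?V \<inter> (?P closure_of e)) = {\<Gamma> u (t i), \<Gamma> u (t (Suc i))}" .
    \<comment> \<open>The height of a class can be recovered from its image in \<open>G\<close>, so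
      the end over \<open>t i\<close> is the minimum and the one over \<open>t (Suc i)\<close> the
      maximum of \<open>PR_fun\<close>.\<close>
    have ht: "PR_fun v = x" if v: "v \<in> ?V" "h v = \<Gamma> u x" "x \<in> {t 1..t n}" for v x
    proof -
      obtain p where p: "p \<in> C" "v = ?q p" using v(1) unfolding verts by blast
      obtain w where w: "w \<in> A" "g p = \<Gamma> w (p 0)" "p 0 \<in> {t 1..t n}" using g_\<Gamma>[OF p(1)] by blast
      have "\<Gamma> u x = \<Gamma> w (p 0)" using v(2) w p hq by simp
      then have "x = p 0" using \<Gamma>_height ui(1) w v(3) by blast
      then show ?thesis using fun_q p by simp
    qed
    have "\<Gamma> u (t i) \<in> h ` (?V \<inter> (?P closure_of e))" unfolding im by simp
    then obtain a where a: "\<Gamma> u (t i) = h a" "a \<in> ?V \<inter> (?P closure_of e)" by (rule imageE)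
    note a = a(2) a(1)[symmetric]
    have "\<Gamma> u (t (Suc i)) \<in> h ` (?V \<inter> (?P closure_of e))" unfolding im by simp
    then obtain b where b: "\<Gamma> u (t (Suc i)) = h b" "b \<in> ?V \<inter> (?P closure_of e)" by (rule imageE)
    note b = b(2) b(1)[symmetric]
    have "?V \<inter> (?P closure_of e) \<subseteq> {a, b}"
    proof
      fix v assume v: "v \<in> ?V \<inter> (?P closure_of e)"
      then have "h v \<in> h ` (?V \<inter> (?P closure_of e))" by (rule imageI)
      then have "h v = h a \<or> h v = h b" unfolding im a(2) b(2) by simp
      moreover have "v \<in> topspace ?P" "a \<in> topspace ?P" "b \<in> topspace ?P"
        using v a(1) b(1) VP by blast+
      ultimately have "v = a \<or> v = b" using inj_onD[OF inj, of v a] inj_onD[OF inj, of v b] by blast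
      then show "v \<in> {a, b}" by simp
    qed
    then have ab: "{v. v \<in> ?V \<inter> (?P closure_of e)} = {a, b}" using a b by auto
    have "t i \<in> {t 1..t n}" "t (Suc i) \<in> {t 1..t n}" using level_in ui(2) by auto
    then have "PR_fun a < PR_fun b" using ht[of a] ht[of b] a b edge_interval(2)[OF ui(2)] by simp
    from arg_min_unique[OF ab this]
    show "tail (cells G) (h ` e) = h (ARG_MIN PR_fun v. v \<in> ?V \<inter> (?P closure_of e))"
     "head (cells G) (h ` e) = h (ARG_MAX PR_fun v. v \<in> ?V \<inter> (?P closure_of e))"
      using a b tail_eq[OF ui(1,2)] head_eq[OF ui(1,2)] ui(3) by simp_all
  qed
  show "top_digraph_iso (PR_digraph k l D S) G"
    unfolding top_digraph_iso_def PR_digraph_def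
  proof (intro exI[of _ h] conjI ballI, unfold top_digraph.simps pre_digraph.simps)
    show "homeomorphic_map ?P (tspace G) h" by (rule hom)
    show "h ` ?V = tverts G" by (rule hV)
    show "(`) h ` open_edges ?P ?V = tarcs G" by (rule harcs)
  qed (rule ends; assumption)+
qed

end

section \<open>One-point unions\<close>

lemma tspace_wedge:
  "tspace (wedge_digraph G v H w) =
     quotient_topology (coproduct_topology (tspace G) (tspace H)) (identify_points v w)"
  by (simp add: wedge_digraph_def)

text \<open>The universal property of the disjoint union; applied to the identity it also yields the
  continuity of both injections.\<close>

lemma continuous_map_coproduct_iff:
  "continuous_map (coproduct_topology X Y) Z f \<longleftrightarrow>
     continuous_map X Z (f \<circ> Inl) \<and> continuous_map Y Z (f \<circ> Inr)"
proof -
  have *: "Inl -` {x \<in> topspace (coproduct_topology X Y). f x \<in> U} = {x \<in> topspace X. (f \<circ> Inl) x \<in> U}"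
    "Inr -` {x \<in> topspace (coproduct_topology X Y). f x \<in> U} = {x \<in> topspace Y. (f \<circ> Inr) x \<in> U}" for U
    by (auto simp: topspace_coproduct_topology)
  show ?thesis unfolding continuous_map openin_coproduct_topology *
    by (auto simp: topspace_coproduct_topology image_subset_iff)
qed

lemma continuous_map_Inl: "continuous_map X (coproduct_topology X Y) Inl"
  using continuous_map_coproduct_iff[of X Y "coproduct_topology X Y" "\<lambda>x. x"]
  by (simp add: comp_def)

lemma continuous_map_Inr: "continuous_map Y (coproduct_topology X Y) Inr"
  using continuous_map_coproduct_iff[of X Y "coproduct_topology X Y" "\<lambda>x. x"]
  by (simp add: comp_def)

lemma continuous_map_wedge_Inl:
  "continuous_map (tspace G) (tspace (wedge_digraph G v H w)) Inl"
proof -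
  have "continuous_map (tspace G) (tspace (wedge_digraph G v H w)) (identify_points v w \<circ> Inl)"
    unfolding tspace_wedge
    by (rule continuous_map_compose[OF continuous_map_Inl
          quotient_imp_continuous_map[OF quotient_map_quotient_topology]])
  then show ?thesis by (simp add: comp_def identify_points_def)
qed

lemma continuous_map_wedge_Inr:
  "continuous_map (tspace H) (tspace (wedge_digraph G v H w)) (\<lambda>y. identify_points v w (Inr y))"
proof -
  have "continuous_map (tspace H) (tspace (wedge_digraph G v H w)) (identify_points v w \<circ> Inr)"
    unfolding tspace_wedge
    by (rule continuous_map_compose[OF continuous_map_Inr
          quotient_imp_continuous_map[OF quotient_map_quotient_topology]])
  then show ?thesis by (simp add: comp_def)
qed

lemma topspace_wedge:
  "topspace (tspace (wedge_digraph G v H w)) =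
     Inl ` topspace (tspace G) \<union> (\<lambda>y. identify_points v w (Inr y)) ` topspace (tspace H)"
  unfolding tspace_wedge topspace_quotient_topology topspace_coproduct_topology
  by (auto simp: identify_points_def image_image image_Un)

text \<open>Collapsing either summand to the base point gives two maps that jointly separate points.\<close>

lemma Hausdorff_space_wedge:
  assumes "Hausdorff_space (tspace G)" "Hausdorff_space (tspace H)"
    and v: "v \<in> topspace (tspace G)" and w: "w \<in> topspace (tspace H)"
  shows "Hausdorff_space (tspace (wedge_digraph G v H w))"
proof -
  let ?W = "tspace (wedge_digraph G v H w)"
  let ?K = "coproduct_topology (tspace G) (tspace H)"
  define c where "c z = (case z of Inl x \<Rightarrow> (x, w) | Inr y \<Rightarrow> (v, y))" for z :: "'a + 'b"
  have ci: "c \<circ> identify_points v w = c"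
    by (auto simp: c_def identify_points_def fun_eq_iff split: sum.splits)
  have "continuous_map ?K (prod_topology (tspace G) (tspace H)) c"
    unfolding continuous_map_coproduct_iff
    by (auto simp: c_def comp_def continuous_map_pairwise v w)
  then have "continuous_map ?K (prod_topology (tspace G) (tspace H)) (c \<circ> identify_points v w)"
    unfolding ci .
  then have cont: "continuous_map ?W (prod_topology (tspace G) (tspace H)) c"
    unfolding tspace_wedge
    by (rule continuous_compose_quotient_map[OF quotient_map_quotient_topology])
  have "z \<noteq> Inr w" if "z \<in> topspace ?W" for z
    using that unfolding topspace_wedge identify_points_def by (auto split: if_splits)
  then have inj: "inj_on c (topspace ?W)"
  proof (intro inj_onI)
    fix z z' assume "\<And>z. z \<in> topspace ?W \<Longrightarrow> z \<noteq> Inr w" "z \<in> topspace ?W" "z' \<in> topspace ?W" "c z = c z'"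
    then have "z \<noteq> Inr w" "z' \<noteq> Inr w" "c z = c z'" by blast+
    then show "z = z'" by (cases z; cases z') (auto simp: c_def)
  qed
  have "Hausdorff_space (prod_topology (tspace G) (tspace H))"
    using assms by (simp add: Hausdorff_space_prod_topology)
  then show ?thesis by (rule Hausdorff_space_injective_preimage[OF _ cont inj])
qed

section \<open>Gluing two balanced trees\<close>

locale two_balanced_trees =
  fixes d1 d2 :: nat and t :: "nat \<Rightarrow> real" and n1 n2 :: "nat \<Rightarrow> nat"
    and T1 :: "'a top_digraph" and v1 :: 'a and T2 :: "'b top_digraph" and v2 :: 'b
  assumes d1: "d1 > 0" and d2: "d2 > 0"
    and t_mono: "strict_mono_on {1..d1 + d2 + 1} t"
    and n1: "\<And>i. i \<in> {1..d1} \<Longrightarrow> n1 i > 1" and n2: "\<And>i. i \<in> {1..d2} \<Longrightarrow> n2 i > 1"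
    and bal1: "balanced_tree T1 v1 n1 d1" and bal2: "balanced_tree T2 v2 n2 d2"
begin

text \<open>The levels of the reversed tree are reflected, so that both trees grow with the parameter.\<close>

sublocale L: balanced_levels T1 v1 n1 d1 "\<lambda>i. - t (d1 + 1 - i)"
proof
  show "strict_mono_on {0..d1} (\<lambda>i. - t (d1 + 1 - i))"
  proof (intro strict_mono_onI)
    fix i j assume "i \<in> {0..d1}" "j \<in> {0..d1}" "i < j"
    then show "- t (d1 + 1 - i) < - t (d1 + 1 - j)"
      using strict_mono_onD[OF t_mono, of "d1 + 1 - j" "d1 + 1 - i"] by auto
  qed
qed (use bal1 d1 n1 in auto)

sublocale R: balanced_levels T2 v2 n2 d2 "\<lambda>i. t (d1 + 1 + i)"
proof
  show "strict_mono_on {0..d2} (\<lambda>i. t (d1 + 1 + i))"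
  proof (intro strict_mono_onI)
    fix i j assume "i \<in> {0..d2}" "j \<in> {0..d2}" "i < j"
    then show "t (d1 + 1 + i) < t (d1 + 1 + j)"
      using strict_mono_onD[OF t_mono, of "d1 + 1 + i" "d1 + 1 + j"] by auto
  qed
qed (use bal2 d2 n2 in auto)

abbreviation "W \<equiv> wedge_digraph (reverse_digraph T1) v1 T2 v2"
abbreviation "r \<equiv> t (d1 + 1)"
abbreviation "a0 \<equiv> t 1"
abbreviation "b0 \<equiv> t (d1 + d2 + 1)"

text \<open>A path from a leaf of the reversed tree through the root to a leaf of the other tree.
  The parameter is negated on the left because the heights of that tree are \<open>- t\<close>. At
  \<open>r\<close> the formula for the right is used; by \<open>through_left\<close> the other one
  gives the same point.\<close>

definition through :: "(nat \<Rightarrow> nat) \<times> (nat \<Rightarrow> nat) \<Rightarrow> real \<Rightarrow> 'a + 'b" where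
  "through u x = (if r \<le> x then identify_points v1 v2 (Inr (R.path (snd u) x))
                  else Inl (L.path (fst u) (- x)))"

lemma t_less: "i \<in> {1..d1 + d2 + 1} \<Longrightarrow> j \<in> {1..d1 + d2 + 1} \<Longrightarrow> t i < t j \<longleftrightarrow> i < j"
  using strict_mono_on_less[OF t_mono] by auto

lemma t_le: "i \<in> {1..d1 + d2 + 1} \<Longrightarrow> j \<in> {1..d1 + d2 + 1} \<Longrightarrow> t i \<le> t j \<longleftrightarrow> i \<le> j"
  using strict_mono_on_less_eq[OF t_mono] by auto

lemma r_bounds: "a0 < r" "r < b0"
  using t_less[of 1 "d1 + 1"] t_less[of "d1 + 1" "d1 + d2 + 1"] d1 d2 by auto

lemma tspace_reverse: "tspace (reverse_digraph T1) = tspace T1"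
  by (simp add: reverse_digraph_def)

lemma root1: "v1 \<in> topspace (tspace T1)" and root2: "v2 \<in> topspace (tspace T2)"
proof -
  have "tverts T1 \<subseteq> topspace (tspace T1)" "tverts T2 \<subseteq> topspace (tspace T2)"
    using L.tdg R.tdg by (simp_all add: is_top_digraph_def)
  then show "v1 \<in> topspace (tspace T1)" "v2 \<in> topspace (tspace T2)"
    using L.root R.root by (simp_all add: subsetD)
qed

lemma Hausdorff_W: "Hausdorff_space (tspace W)"
  using L.tdg R.tdg root1 root2
  by (intro Hausdorff_space_wedge) (auto simp: is_top_digraph_def tspace_reverse)

lemma L_path_root: "a \<in> L.digits \<Longrightarrow> L.path a (- r) = v1"
  using L.path_root[of a] by simp

lemma R_path_root: "b \<in> R.digits \<Longrightarrow> R.path b r = v2"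
  using R.path_root[of b] by simp

lemma through_left:
  assumes "u \<in> L.digits \<times> R.digits" "x \<le> r"
  shows "through u x = Inl (L.path (fst u) (- x))"
  using assms L_path_root R_path_root by (auto simp: through_def identify_points_def)

lemma through_right: "r \<le> x \<Longrightarrow> through u x = identify_points v1 v2 (Inr (R.path (snd u) x))"
  by (simp add: through_def)

lemma through_continuous:
  assumes u: "u \<in> L.digits \<times> R.digits"
  shows "continuous_map (top_of_set {a0..b0}) (tspace W) (through u)"
  unfolding through_def
proof (rule continuous_map_cases_le)
  have *: "{x \<in> topspace (top_of_set {a0..b0}). r \<le> x} = {r..b0}"
    "{x \<in> topspace (top_of_set {a0..b0}). x \<le> r} = {a0..r}" using r_bounds by auto
  have "continuous_map (top_of_set {r..b0}) (tspace T2) (R.path (snd u))"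
    using R.path_continuous[of "snd u"] u by (auto simp: ac_simps)
  then have "continuous_map (top_of_set {r..b0}) (tspace W)
       ((\<lambda>y. identify_points v1 v2 (Inr y)) \<circ> R.path (snd u))"
    by (rule continuous_map_compose[OF _ continuous_map_wedge_Inr])
  then show "continuous_map (subtopology (top_of_set {a0..b0}) {x \<in> topspace (top_of_set {a0..b0}). r \<le> x})
     (tspace W) (\<lambda>x. identify_points v1 v2 (Inr (R.path (snd u) x)))"
    unfolding * using r_bounds
    by (simp add: subtopology_subtopology comp_def max_def min_def)
  have "continuous_map (top_of_set {-r..-a0}) (tspace T1) (L.path (fst u))"
    using L.path_continuous[of "fst u"] u by auto
  moreover have "continuous_map (top_of_set {a0..r}) (top_of_set {-r..-a0}) uminus"
    by (auto intro!: continuous_intros)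
  ultimately have "continuous_map (top_of_set {a0..r}) (tspace T1) (L.path (fst u) \<circ> uminus)"
    by (rule continuous_map_compose[rotated])
  then have "continuous_map (top_of_set {a0..r}) (tspace W) (Inl \<circ> (L.path (fst u) \<circ> uminus))"
    using continuous_map_wedge_Inl[of "reverse_digraph T1"] unfolding tspace_reverse
    by (rule continuous_map_compose)
  then show "continuous_map (subtopology (top_of_set {a0..b0}) {x \<in> topspace (top_of_set {a0..b0}). x \<le> r})
     (tspace W) (\<lambda>x. Inl (L.path (fst u) (- x)))"
    unfolding * using r_bounds
    by (simp add: subtopology_subtopology comp_def max_def min_def)
  show "identify_points v1 v2 (Inr (R.path (snd u) x)) = Inl (L.path (fst u) (- x))" if "r = x" for x
    using that through_left[OF u, of x] through_right[of x u] by simp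
qed (auto intro: continuous_map_into_fulltopology)

text \<open>Digit \<open>i\<close> of the reversed tree is chosen at \<open>t (d1 + 2 - i)\<close>
  and counts to the left of it, digit \<open>i\<close> of the other tree at
  \<open>t (d1 + i)\<close> and counts to the right. All these levels lie on their own side of
  \<open>r\<close>, so on either side the conditions for the other tree are vacuous.\<close>

lemma through_eq_iff:
  assumes u: "u \<in> L.digits \<times> R.digits" and v: "v \<in> L.digits \<times> R.digits"
    and x: "x \<in> {a0..b0}" and y: "y \<in> {a0..b0}"
  shows "through u x = through v y \<longleftrightarrow> x = y \<and>
     (\<forall>i\<in>{1..d1}. x < t (d1 + 2 - i) \<longrightarrow> fst u i = fst v i) \<and>
     (\<forall>i\<in>{1..d2}. t (d1 + i) < x \<longrightarrow> snd u i = snd v i)"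
proof -
  have lo: "t (d1 + 2 - i) \<le> r" if "i \<in> {1..d1}" for i
    by (rule iffD2[OF t_le]) (use that in auto)
  have hi: "r \<le> t (d1 + i)" if "i \<in> {1..d2}" for i
    by (rule iffD2[OF t_le]) (use that in auto)
  have left: "Inl (L.path (fst u) (- x)) = Inl (L.path (fst v) (- y)) \<longleftrightarrow> x = y \<and>
     (\<forall>i\<in>{1..d1}. x < t (d1 + 2 - i) \<longrightarrow> fst u i = fst v i)" if "x \<le> r" "y \<le> r"
  proof -
    have "L.path (fst u) (- x) = L.path (fst v) (- y) \<longleftrightarrow>
        - x = - y \<and> (\<forall>i\<in>{1..d1}. - t (d1 + 1 - (i - 1)) < - x \<longrightarrow> fst u i = fst v i)"
      by (rule L.path_eq_iff) (use u v x y that in auto)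
    moreover have "d1 + 1 - (i - 1) = d1 + 2 - i" if "i \<in> {1..d1}" for i using that by auto
    ultimately show ?thesis by simp
  qed
  have right: "R.path (snd u) x = R.path (snd v) y \<longleftrightarrow> x = y \<and>
     (\<forall>i\<in>{1..d2}. t (d1 + i) < x \<longrightarrow> snd u i = snd v i)" if "r \<le> x" "r \<le> y"
  proof -
    have "R.path (snd u) x = R.path (snd v) y \<longleftrightarrow>
        x = y \<and> (\<forall>i\<in>{1..d2}. t (d1 + 1 + (i - 1)) < x \<longrightarrow> snd u i = snd v i)"
      by (rule R.path_eq_iff) (use u v x y that in \<open>auto simp: ac_simps\<close>)
    moreover have "d1 + 1 + (i - 1) = d1 + i" if "i \<in> {1..d2}" for i using that by auto
    ultimately show ?thesis by simp
  qed
  \<comment> \<open>Only the root \<open>v2\<close> is moved by \<open>identify_points\<close>, so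
    points of the right half over \<open>x > r\<close> are never confused with points of the left
    half.\<close>
  have rootx: "R.path (snd u) x = v2 \<longleftrightarrow> x = r" if "r \<le> x" "x \<le> b0" "u \<in> L.digits \<times> R.digits" for u x
  proof -
    have "R.path (snd u) x = R.path (snd u) r \<longleftrightarrow> x = r \<and>
        (\<forall>i\<in>{1..d2}. t (d1 + 1 + (i - 1)) < x \<longrightarrow> snd u i = snd u i)"
      by (rule R.path_eq_iff) (use that r_bounds in \<open>auto simp: ac_simps\<close>)
    then have "R.path (snd u) x = R.path (snd u) r \<longleftrightarrow> x = r" by blast
    then show ?thesis using R_path_root that by auto
  qed
  consider "x \<le> r" "y \<le> r" | "r \<le> x" "r \<le> y" "r < x \<or> r < y" | "x < r" "r < y" | "r < x" "y < r" by linarith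
  then show ?thesis
  proof cases
    case 1
    have "\<not> t (d1 + i) < x" if "i \<in> {1..d2}" for i using hi[OF that] 1 by simp
    then show ?thesis using 1 left through_left u v by auto
  next
    case 2
    have "\<not> x < t (d1 + 2 - i)" if "i \<in> {1..d1}" for i using lo[OF that] 2 by simp
    moreover have "through u x = through v y \<longleftrightarrow> R.path (snd u) x = R.path (snd v) y"
      using through_right 2 rootx[OF 2(1) _ u] rootx[OF 2(2) _ v] x y
      by (auto simp: identify_points_def)
    ultimately show ?thesis using right 2 by auto
  next
    case 3
    then show ?thesis using through_left[OF u, of x] through_right[of y v] rootx[of y v] y v
      by (auto simp: identify_points_def)
  next
    case 4
    then show ?thesis using through_left[OF v, of y] through_right[of x u] rootx[of x u] x u
      by (auto simp: identify_points_def)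
  qed
qed

section \<open>Vertices, arcs and ends of the glued digraph\<close>

lemma tverts_W: "tverts W = Inl ` tverts T1 \<union> (\<lambda>y. identify_points v1 v2 (Inr y)) ` tverts T2"
  by (auto simp: wedge_digraph_def reverse_digraph_def identify_points_def)

lemma tarcs_W: "tarcs W = (`) Inl ` tarcs T1 \<union> (`) Inr ` tarcs T2"
  by (simp add: wedge_digraph_def reverse_digraph_def)

lemma finite_tarcs_W: "finite (tarcs W)"
proof -
  have "finite (tarcs T1)" "finite (tarcs T2)"
    using L.tdg R.tdg unfolding is_top_digraph_def by blast+
  then show ?thesis unfolding tarcs_W by simp
qed

text \<open>Depth counts downwards from the root level \<open>d1 + 1\<close>: the edge leaving depth
  \<open>i\<close> spans the levels \<open>d1 - i\<close> and \<open>d1 + 1 - i\<close>, and the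
  reflection exchanges its ends.\<close>

lemma through_arc_left:
  assumes u: "u \<in> L.digits \<times> R.digits" and i: "i < d1"
  shows "through u ` {t (d1 - i)<..<t (Suc (d1 - i))} =
     Inl ` (L.path (fst u) ` {- t (d1 + 1 - i)<..<- t (d1 + 1 - Suc i)})"
proof -
  have e: "Suc (d1 - i) = d1 + 1 - i" "d1 + 1 - Suc i = d1 - i" using i by auto
  have le: "t (d1 + 1 - i) \<le> r" by (rule iffD2[OF t_le]) (use i in auto)
  have "through u ` {t (d1 - i)<..<t (d1 + 1 - i)} =
      (\<lambda>x. Inl (L.path (fst u) (- x))) ` {t (d1 - i)<..<t (d1 + 1 - i)}"
    by (intro image_cong refl through_left[OF u]) (use le in auto)
  also have "\<dots> = (\<lambda>x. Inl (L.path (fst u) x)) ` uminus ` {t (d1 - i)<..<t (d1 + 1 - i)}"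
    by (simp only: image_image)
  also have "uminus ` {t (d1 - i)<..<t (d1 + 1 - i)} = {- t (d1 + 1 - i)<..<- t (d1 - i)}" by simp
  finally show ?thesis unfolding e by (simp only: image_image)
qed

text \<open>An open edge avoids the root, so the identification leaves it a plain \<open>Inr\<close>
  copy.\<close>

lemma through_arc_right:
  assumes u: "u \<in> L.digits \<times> R.digits" and i: "i < d2"
  shows "through u ` {t (d1 + 1 + i)<..<t (d1 + 1 + Suc i)} =
     Inr ` (R.path (snd u) ` {t (d1 + 1 + i)<..<t (d1 + 1 + Suc i)})"
proof -
  have lo: "r \<le> t (d1 + 1 + i)" by (rule iffD2[OF t_le]) (use i in auto)
  have "R.path (snd u) x \<noteq> v2" if x: "x \<in> {t (d1 + 1 + i)<..<t (d1 + 1 + Suc i)}" for x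
  proof -
    have s: "snd u \<in> R.digits" using u by auto
    have "R.path (snd u) x \<in> R.edge (snd u) i" using R.path_in_edge[OF s i] x by simp
    then have "R.path (snd u) x \<notin> tverts T2" using R.arcs_disjoint(1) R.vert_edge(2)[OF s i] by blast
    then show ?thesis using R.root by auto
  qed
  then have "through u ` {t (d1 + 1 + i)<..<t (d1 + 1 + Suc i)} =
      (\<lambda>x. Inr (R.path (snd u) x)) ` {t (d1 + 1 + i)<..<t (d1 + 1 + Suc i)}"
    by (intro image_cong refl) (use lo in \<open>auto simp: through_right identify_points_def\<close>)
  then show ?thesis by (simp add: image_image)
qed

lemma wedge_end_Inl: "e \<in> E \<Longrightarrow> wedge_end f g E v w (Inl ` e) = Inl (f e)"
  by (simp add: wedge_end_def inj_vimage_image_eq)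

text \<open>Nonemptiness is what tells an \<open>Inr\<close> copy from an \<open>Inl\<close> copy:
  the empty set is the image of itself under both injections.\<close>

lemma wedge_end_Inr:
  assumes "e \<noteq> {}"
  shows "wedge_end f g E v w (Inr ` e) = identify_points v w (Inr (g e))"
proof -
  have "Inr ` e \<notin> (`) Inl ` E" using assms by auto
  then show ?thesis by (simp add: wedge_end_def inj_vimage_image_eq)
qed

lemma arc_cases:
  assumes "i \<in> {1..<d1 + d2 + 1}"
  obtains j where "j < d1" "i = d1 - j" | j where "j < d2" "i = d1 + 1 + j"
proof (cases "i \<le> d1")
  case True
  then show thesis using that(1)[of "d1 - i"] assms by auto
next
  case False
  then show thesis using that(2)[of "i - d1 - 1"] assms by auto
qed

lemma through_ends:
  assumes u: "u \<in> L.digits \<times> R.digits" and i: "i \<in> {1..<d1 + d2 + 1}"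
  shows "tail (cells W) (through u ` {t i<..<t (Suc i)}) = through u (t i)"
    and "head (cells W) (through u ` {t i<..<t (Suc i)}) = through u (t (Suc i))"
proof -
  have fu: "fst u \<in> L.digits" "snd u \<in> R.digits" using u by auto
  \<comment> \<open>Reversal exchanges \<open>head\<close> and \<open>tail\<close> on the first
    summand only.\<close>
  have ends: "tail (cells W) = wedge_end (head (cells T1)) (tail (cells T2)) (tarcs T1) v1 v2"
    "head (cells W) = wedge_end (tail (cells T1)) (head (cells T2)) (tarcs T1) v1 v2"
    by (simp_all add: wedge_digraph_def reverse_digraph_def)
  have "tail (cells W) (through u ` {t i<..<t (Suc i)}) = through u (t i) \<and>
    head (cells W) (through u ` {t i<..<t (Suc i)}) = through u (t (Suc i))"
    using i
  proof (cases rule: arc_cases)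
    case (1 j)
    let ?e = "L.path (fst u) ` {- t (d1 + 1 - j)<..<- t (d1 + 1 - Suc j)}"
    have e: "?e \<in> tarcs T1" unfolding L.tarcs_eq_paths using fu 1 by blast
    have le: "t (d1 - j) \<le> r" "t (Suc (d1 - j)) \<le> r"
      by (rule iffD2[OF t_le]; use 1 in force)+
    have eq: "d1 + 1 - Suc j = d1 - j" "d1 + 1 - j = Suc (d1 - j)" using 1 by auto
    show ?thesis unfolding 1(2) through_arc_left[OF u 1(1)] ends wedge_end_Inl[OF e]
        L.path_ends[OF fu(1) 1(1)] through_left[OF u le(1)] through_left[OF u le(2)]
      by (simp only: eq simp_thms)
  next
    case (2 j)
    let ?e = "R.path (snd u) ` {t (d1 + 1 + j)<..<t (d1 + 1 + Suc j)}"
    have "?e = R.edge (snd u) j" using R.path_image_edge[OF fu(2) 2(1)] .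
    have "t (d1 + 1 + j) < t (d1 + 1 + Suc j)" using t_less[of "d1 + 1 + j" "d1 + 1 + Suc j"] 2 by auto
    then have ne: "?e \<noteq> {}" by simp
    have le: "r \<le> t (d1 + 1 + j)" "r \<le> t (d1 + 1 + Suc j)"
      using 2 t_le[of "d1 + 1" "d1 + 1 + j"] t_le[of "d1 + 1" "d1 + 1 + Suc j"] by auto
    have eq: "Suc (d1 + 1 + j) = d1 + 1 + Suc j" by simp
    show ?thesis unfolding 2(2) eq through_arc_right[OF u 2(1)] ends wedge_end_Inr[OF ne]
        R.path_ends[OF fu(2) 2(1)] through_right[OF le(1)] through_right[OF le(2)]
      by simp
  qed
  then show "tail (cells W) (through u ` {t i<..<t (Suc i)}) = through u (t i)"
    and "head (cells W) (through u ` {t i<..<t (Suc i)}) = through u (t (Suc i))" by auto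
qed

lemma through_arcs:
  "tarcs W = {through u ` {t i<..<t (Suc i)} | u i. u \<in> L.digits \<times> R.digits \<and> i \<in> {1..<d1 + d2 + 1}}"
    (is "_ = ?A")
proof (intro equalityI subsetI)
  fix e assume "e \<in> tarcs W"
  then consider e' where "e' \<in> tarcs T1" "e = Inl ` e'" | e' where "e' \<in> tarcs T2" "e = Inr ` e'"
    unfolding tarcs_W by blast
  then show "e \<in> ?A"
  proof cases
    case 1
    then obtain a j where a: "a \<in> L.digits" "j < d1" "e' = L.path a ` {- t (d1 + 1 - j)<..<- t (d1 + 1 - Suc j)}"
      unfolding L.tarcs_eq_paths by blast
    \<comment> \<open>Left of the root the second vector has no influence on the path; zero is just
      an admissible filler.\<close>
    have u: "(a, \<lambda>_. 0) \<in> L.digits \<times> R.digits" using a R.digits_nonempty by blast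
    have "e = through (a, \<lambda>_. 0) ` {t (d1 - j)<..<t (Suc (d1 - j))}"
      unfolding through_arc_left[OF u a(2)] 1 a(3) by simp
    moreover have "d1 - j \<in> {1..<d1 + d2 + 1}" using a(2) by auto
    ultimately show ?thesis using u by blast
  next
    case 2
    then obtain b j where b: "b \<in> R.digits" "j < d2" "e' = R.path b ` {t (d1 + 1 + j)<..<t (d1 + 1 + Suc j)}"
      unfolding R.tarcs_eq_paths by blast
    have u: "(\<lambda>_. 0, b) \<in> L.digits \<times> R.digits" using b L.digits_nonempty by blast
    have "e = through (\<lambda>_. 0, b) ` {t (d1 + 1 + j)<..<t (d1 + 1 + Suc j)}"
      unfolding through_arc_right[OF u b(2)] 2 b(3) by simp
    then have "e = through (\<lambda>_. 0, b) ` {t (d1 + 1 + j)<..<t (Suc (d1 + 1 + j))}" by simp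
    moreover have "d1 + 1 + j \<in> {1..<d1 + d2 + 1}" using b(2) by auto
    ultimately show ?thesis using u by blast
  qed
next
  fix e assume "e \<in> ?A"
  then obtain u i where u: "u \<in> L.digits \<times> R.digits" and i: "i \<in> {1..<d1 + d2 + 1}"
    and e: "e = through u ` {t i<..<t (Suc i)}" by blast
  have fu: "fst u \<in> L.digits" "snd u \<in> R.digits" using u by auto
  show "e \<in> tarcs W" using i
  proof (cases rule: arc_cases)
    case (1 j)
    have "L.path (fst u) ` {- t (d1 + 1 - j)<..<- t (d1 + 1 - Suc j)} \<in> tarcs T1"
      unfolding L.tarcs_eq_paths using fu 1 by blast
    then show ?thesis unfolding e 1(2) through_arc_left[OF u 1(1)] tarcs_W by blast
  next
    case (2 j)
    have "R.path (snd u) ` {t (d1 + 1 + j)<..<t (d1 + 1 + Suc j)} \<in> tarcs T2"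
      unfolding R.tarcs_eq_paths using fu 2 by blast
    moreover have "Suc (d1 + 1 + j) = d1 + 1 + Suc j" by simp
    ultimately show ?thesis unfolding e 2(2) tarcs_W using through_arc_right[OF u 2(1)] by auto
  qed
qed

lemma through_verts:
  "tverts W = {through u (t i) | u i. u \<in> L.digits \<times> R.digits \<and> i \<in> {1..d1 + d2 + 1}}"
    (is "_ = ?A")
proof (intro equalityI subsetI)
  fix z assume "z \<in> tverts W"
  then consider x where "x \<in> tverts T1" "z = Inl x" | y where "y \<in> tverts T2" "z = identify_points v1 v2 (Inr y)"
    unfolding tverts_W by blast
  then show "z \<in> ?A"
  proof cases
    case 1
    then obtain a j where a: "a \<in> L.digits" "j \<le> d1" "x = L.path a (- t (d1 + 1 - j))"
      unfolding L.tverts_eq_levels by blast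
    have u: "(a, \<lambda>_. 0) \<in> L.digits \<times> R.digits" using a R.digits_nonempty by blast
    have le: "t (d1 + 1 - j) \<le> r" by (rule iffD2[OF t_le]) (use a in auto)
    have "z = through (a, \<lambda>_. 0) (t (d1 + 1 - j))" unfolding through_left[OF u le] 1 a(3) by simp
    moreover have "d1 + 1 - j \<in> {1..d1 + d2 + 1}" using a(2) by auto
    ultimately show ?thesis using u by blast
  next
    case 2
    then obtain b j where b: "b \<in> R.digits" "j \<le> d2" "y = R.path b (t (d1 + 1 + j))"
      unfolding R.tverts_eq_levels by blast
    have u: "(\<lambda>_. 0, b) \<in> L.digits \<times> R.digits" using b L.digits_nonempty by blast
    have le: "r \<le> t (d1 + 1 + j)" by (rule iffD2[OF t_le]) (use b in auto)
    have "z = through (\<lambda>_. 0, b) (t (d1 + 1 + j))" unfolding through_right[OF le] 2 b(3) by simp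
    moreover have "d1 + 1 + j \<in> {1..d1 + d2 + 1}" using b(2) by auto
    ultimately show ?thesis using u by blast
  qed
next
  fix z assume "z \<in> ?A"
  then obtain u i where u: "u \<in> L.digits \<times> R.digits" and i: "i \<in> {1..d1 + d2 + 1}"
    and z: "z = through u (t i)" by blast
  have fu: "fst u \<in> L.digits" "snd u \<in> R.digits" using u by auto
  show "z \<in> tverts W"
  proof (cases "i \<le> d1 + 1")
    case True
    then have le: "t i \<le> r" by (intro iffD2[OF t_le]) (use i in auto)
    define j where "j = d1 + 1 - i"
    have j: "d1 + 1 - j = i" "j \<le> d1" using True i by (auto simp: j_def)
    have "L.path (fst u) (- t (d1 + 1 - j)) \<in> tverts T1"
      unfolding L.tverts_eq_levels using fu j(2) by blast
    then show ?thesis unfolding z through_left[OF u le] tverts_W j(1) by blast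
  next
    case False
    then have le: "r \<le> t i" by (intro iffD2[OF t_le]) (use i in auto)
    define j where "j = i - (d1 + 1)"
    have j: "d1 + 1 + j = i" "j \<le> d2" using False i by (auto simp: j_def)
    have "R.path (snd u) (t (d1 + 1 + j)) \<in> tverts T2"
      unfolding R.tverts_eq_levels using fu j(2) by blast
    then show ?thesis unfolding z through_right[OF le] tverts_W j(1) by blast
  qed
qed

lemma through_topspace:
  "topspace (tspace W) = (\<Union>u\<in>L.digits \<times> R.digits. through u ` {a0..b0})"
proof (intro equalityI subsetI)
  fix z assume "z \<in> topspace (tspace W)"
  then consider x where "x \<in> topspace (tspace T1)" "z = Inl x"
    | y where "y \<in> topspace (tspace T2)" "z = identify_points v1 v2 (Inr y)"
    unfolding topspace_wedge tspace_reverse by blast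
  then show "z \<in> (\<Union>u\<in>L.digits \<times> R.digits. through u ` {a0..b0})"
  proof cases
    case 1
    then obtain a x' where a: "a \<in> L.digits" "x' \<in> {- t (d1 + 1 - 0)..- t (d1 + 1 - d1)}" "x = L.path a x'"
      unfolding L.topspace_eq_paths by blast
    have u: "(a, \<lambda>_. 0) \<in> L.digits \<times> R.digits" using a R.digits_nonempty by blast
    have le: "- x' \<le> r" using a(2) by simp
    have "z = through (a, \<lambda>_. 0) (- x')" unfolding through_left[OF u le] 1 a(3) by simp
    moreover have "- x' \<in> {a0..b0}" using a(2) r_bounds by simp
    ultimately show ?thesis using u by blast
  next
    case 2
    then obtain b x' where b: "b \<in> R.digits" "x' \<in> {t (d1 + 1 + 0)..t (d1 + 1 + d2)}" "y = R.path b x'"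
      unfolding R.topspace_eq_paths by blast
    have u: "(\<lambda>_. 0, b) \<in> L.digits \<times> R.digits" using b L.digits_nonempty by blast
    have le: "r \<le> x'" using b(2) by simp
    have "z = through (\<lambda>_. 0, b) x'" unfolding through_right[OF le] 2 b(3) by simp
    moreover have "x' \<in> {a0..b0}" using b(2) r_bounds by (simp add: ac_simps)
    ultimately show ?thesis using u by blast
  qed
next
  fix z assume "z \<in> (\<Union>u\<in>L.digits \<times> R.digits. through u ` {a0..b0})"
  then obtain u x where u: "u \<in> L.digits \<times> R.digits" and x: "x \<in> {a0..b0}" "z = through u x" by blast
  show "z \<in> topspace (tspace W)"
    using continuous_map_image_subset_topspace[OF through_continuous[OF u]] x by auto
qed

sublocale path_digraph W "L.digits \<times> R.digits" through t "d1 + d2 + 1"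
proof
  show "Hausdorff_space (tspace W)" by (rule Hausdorff_W)
  show "finite (tarcs W)" by (rule finite_tarcs_W)
  show "strict_mono_on {1..d1 + d2 + 1} t" by (rule t_mono)
  show "continuous_map (top_of_set {a0..b0}) (tspace W) (through u)" if "u \<in> L.digits \<times> R.digits" for u
    by (rule through_continuous[OF that])
  show "x = y" if "u \<in> L.digits \<times> R.digits" "v \<in> L.digits \<times> R.digits" "x \<in> {a0..b0}" "y \<in> {a0..b0}"
    "through u x = through v y" for u v x y
    using that(5) unfolding through_eq_iff[OF that(1-4)] by (rule conjunct1)
  show "through u y = through v y" if u: "u \<in> L.digits \<times> R.digits" and v: "v \<in> L.digits \<times> R.digits"
    and i: "i \<in> {1..<d1 + d2 + 1}" and x: "x \<in> {t i<..<t (Suc i)}" and y: "y \<in> {t i<..<t (Suc i)}"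
    and eq: "through u x = through v x" for u v i x y
  proof -
    have "a0 \<le> t i" "t (Suc i) \<le> b0" using i t_le[of 1 i] t_le[of "Suc i" "d1 + d2 + 1"] by auto
    then have xy: "x \<in> {a0..b0}" "y \<in> {a0..b0}" using x y by auto
    \<comment> \<open>No level lies strictly inside \<open>{t i<..<t (Suc i)}\<close>, so exactly
      the same digits count over \<open>x\<close> and over \<open>y\<close>.\<close>
    have lt: "(x < t j \<longleftrightarrow> y < t j) \<and> (t j < x \<longleftrightarrow> t j < y)" if j: "j \<in> {1..d1 + d2 + 1}" for j
    proof (cases "j \<le> i")
      case True
      then have "t j \<le> t i" using t_le[OF j, of i] i by auto
      then show ?thesis using x y by auto
    next
      case False
      then have "t (Suc i) \<le> t j" using t_le[OF _ j, of "Suc i"] i by auto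
      then show ?thesis using x y by auto
    qed
    have 1: "y < t (d1 + 2 - m) \<Longrightarrow> x < t (d1 + 2 - m)" if "m \<in> {1..d1}" for m
    proof -
      have "d1 + 2 - m \<in> {1..d1 + d2 + 1}" using that by auto
      then show "y < t (d1 + 2 - m) \<Longrightarrow> x < t (d1 + 2 - m)" using lt by blast
    qed
    have 2: "t (d1 + m) < y \<Longrightarrow> t (d1 + m) < x" if "m \<in> {1..d2}" for m
    proof -
      have "d1 + m \<in> {1..d1 + d2 + 1}" using that by auto
      then show "t (d1 + m) < y \<Longrightarrow> t (d1 + m) < x" using lt by blast
    qed
    note E = eq[unfolded through_eq_iff[OF u v xy(1) xy(1)], THEN conjunct2]
    show ?thesis unfolding through_eq_iff[OF u v xy(2) xy(2)]
    proof (intro conjI refl ballI impI)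
      show "fst u m = fst v m" if "m \<in> {1..d1}" "y < t (d1 + 2 - m)" for m
        by (rule E[THEN conjunct1, THEN bspec, OF that(1), THEN mp, OF 1[OF that]])
      show "snd u m = snd v m" if "m \<in> {1..d2}" "t (d1 + m) < y" for m
        by (rule E[THEN conjunct2, THEN bspec, OF that(1), THEN mp, OF 2[OF that]])
    qed
  qed
  show "1 \<le> d1 + d2 + 1" by simp
  show "topspace (tspace W) = (\<Union>u\<in>L.digits \<times> R.digits. through u ` {a0..b0})"
    by (rule through_topspace)
  show "tverts W = {through u (t i) | u i. u \<in> L.digits \<times> R.digits \<and> i \<in> {1..d1 + d2 + 1}}"
    by (rule through_verts)
  show "tarcs W = {through u ` {t i<..<t (Suc i)} | u i. u \<in> L.digits \<times> R.digits \<and> i \<in> {1..<d1 + d2 + 1}}"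
    by (rule through_arcs)
  show "tail (cells W) (through u ` {t i<..<t (Suc i)}) = through u (t i)"
    "head (cells W) (through u ` {t i<..<t (Suc i)}) = through u (t (Suc i))"
    if "u \<in> L.digits \<times> R.digits" "i \<in> {1..<d1 + d2 + 1}" for u i
    using through_ends[OF that] by this
qed

end

section \<open>Cylinders over circles in coordinate planes\<close>

lemma Euclidean_space_top_of_set: "Euclidean_space k = top_of_set {x. \<forall>i\<ge>k. x i = 0}"
  unfolding Euclidean_space_def euclidean_product_topology by (rule refl)

definition cyl_fun :: "nat \<Rightarrow> real \<Rightarrow> real \<Rightarrow> real \<Rightarrow> (nat \<Rightarrow> real) \<Rightarrow> real" where
  "cyl_fun m c b R p = (p 0 - c)\<^sup>2 + (p m - b)\<^sup>2 - R\<^sup>2"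

definition cyl :: "nat \<Rightarrow> nat \<Rightarrow> real \<Rightarrow> real \<Rightarrow> real \<Rightarrow> (nat \<Rightarrow> real) set" where
  "cyl k m c b R = {p \<in> topspace (Euclidean_space k). cyl_fun m c b R p = 0}"

lemma continuous_on_coord: "continuous_on A (\<lambda>p :: nat \<Rightarrow> real. p i)"
  by (rule continuous_on_subset[OF continuous_on_product_coordinates]) simp

lemma continuous_on_cyl_fun: "continuous_on A (cyl_fun m c b R)"
  unfolding cyl_fun_def by (intro continuous_intros continuous_on_coord)

lemma polynomial_on_cyl_fun:
  assumes "0 < k" "m < k"
  shows "polynomial_on k (\<lambda>p. \<sigma> * cyl_fun m c b R p)"
proof -
  have "polynomial_on k (\<lambda>p. \<sigma> * ((p 0 + - c) * (p 0 + - c) + (p m + - b) * (p m + - b) + - R\<^sup>2))"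
    using assms by (intro polynomial_on.intros)
  moreover have "(\<lambda>p. \<sigma> * ((p 0 + - c) * (p 0 + - c) + (p m + - b) * (p m + - b) + - R\<^sup>2)) =
      (\<lambda>p. \<sigma> * cyl_fun m c b R p)"
    by (simp add: cyl_fun_def power2_eq_square)
  ultimately show ?thesis by simp
qed

lemma partial_deriv_cyl_fun:
  assumes "m \<noteq> 0"
  shows "partial_deriv 0 (\<lambda>p. \<sigma> * cyl_fun m c b R p) p = \<sigma> * (2 * (p 0 - c))"
    and "partial_deriv m (\<lambda>p. \<sigma> * cyl_fun m c b R p) p = \<sigma> * (2 * (p m - b))"
proof -
  have "((\<lambda>s. \<sigma> * cyl_fun m c b R (p(0 := s))) has_real_derivative \<sigma> * (2 * (p 0 - c))) (at (p 0))"
    using assms unfolding cyl_fun_def by (auto intro!: derivative_eq_intros)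
  then show "partial_deriv 0 (\<lambda>p. \<sigma> * cyl_fun m c b R p) p = \<sigma> * (2 * (p 0 - c))"
    unfolding partial_deriv_def by (rule DERIV_imp_deriv)
  have "((\<lambda>s. \<sigma> * cyl_fun m c b R (p(m := s))) has_real_derivative \<sigma> * (2 * (p m - b))) (at (p m))"
    using assms unfolding cyl_fun_def by (auto intro!: derivative_eq_intros)
  then show "partial_deriv m (\<lambda>p. \<sigma> * cyl_fun m c b R p) p = \<sigma> * (2 * (p m - b))"
    unfolding partial_deriv_def by (rule DERIV_imp_deriv)
qed

text \<open>The gradient vanishes only on the axis, which misses the cylinder as
  \<open>R > 0\<close>. The factor \<open>\<sigma>\<close> chooses the side on which the polynomial
  is positive and leaves the zero set alone.\<close>

lemma nonsingular_hypersurface_cyl: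
  assumes "0 < m" "m < k" "R > 0" "\<sigma> \<noteq> 0"
  shows "nonsingular_hypersurface k (\<lambda>p. \<sigma> * cyl_fun m c b R p) (cyl k m c b R)"
  unfolding nonsingular_hypersurface_def
proof (intro conjI ballI)
  show "polynomial_on k (\<lambda>p. \<sigma> * cyl_fun m c b R p)" using assms by (intro polynomial_on_cyl_fun) auto
  let ?X = "subtopology (Euclidean_space k)
             {x \<in> topspace (Euclidean_space k). \<sigma> * cyl_fun m c b R x = 0}"
  have "\<Union>(connected_components_of ?X) = cyl k m c b R"
    unfolding Union_connected_components_of using assms by (auto simp: cyl_def)
  then show "\<exists>\<C>\<subseteq>connected_components_of ?X. cyl k m c b R = \<Union>\<C>" by blast
  fix p assume "p \<in> cyl k m c b R"
  then have "(p 0 - c)\<^sup>2 + (p m - b)\<^sup>2 = R\<^sup>2" by (simp add: cyl_def cyl_fun_def)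
  then have "p 0 - c \<noteq> 0 \<or> p m - b \<noteq> 0" using assms by auto
  then show "\<exists>i<k. partial_deriv i (\<lambda>p. \<sigma> * cyl_fun m c b R p) p \<noteq> 0"
  proof
    assume "p 0 - c \<noteq> 0"
    then show ?thesis using assms partial_deriv_cyl_fun(1)[of m \<sigma> c b R p] by (intro exI[of _ 0]) auto
  next
    assume "p m - b \<noteq> 0"
    then show ?thesis using assms partial_deriv_cyl_fun(2)[of m \<sigma> c b R p] by (intro exI[of _ m]) auto
  qed
qed

lemma circle_eq: "R > 0 \<Longrightarrow> circle R = {x \<in> topspace (Euclidean_space 2). (x 0)\<^sup>2 + (x 1)\<^sup>2 = R\<^sup>2}"
proof -
  assume "R > 0"
  have "{..<2} = {0, 1::nat}" by auto
  then have L2: "L2_set x {..<2} = sqrt ((x 0)\<^sup>2 + (x 1)\<^sup>2)" for x :: "nat \<Rightarrow> real"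
    by (simp add: L2_set_def)
  have "sqrt y = R \<longleftrightarrow> y = R\<^sup>2" if "y \<ge> 0" for y
    using real_sqrt_pow2[OF that] real_sqrt_unique[of R y] \<open>R > 0\<close> by (metis less_imp_le)
  then have "L2_set x {..<2} = R \<longleftrightarrow> (x 0)\<^sup>2 + (x 1)\<^sup>2 = R\<^sup>2" for x :: "nat \<Rightarrow> real"
    unfolding L2 by (metis sum_power2_ge_zero)
  then show ?thesis by (simp add: circle_def)
qed

text \<open>The isometry exchanges the coordinates \<open>1\<close> and \<open>m\<close> and then
  moves the axis to \<open>(c, b)\<close> by a translation.\<close>

lemma is_cylinder_cyl:
  assumes "0 < m" "m < k" "R > 0"
  shows "is_cylinder k (circle R) (cyl k m c b R)"
proof -
  define \<tau> where "\<tau> = Transposition.transpose 1 m"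
  define w where "w = (\<lambda>i. if i = 0 then c else if i = m then b else 0 :: real)"
  define \<phi> where "\<phi> = (\<lambda>(x :: nat \<Rightarrow> real) i. x (\<tau> i) + w i)"
  define \<psi> where "\<psi> = (\<lambda>(x :: nat \<Rightarrow> real) i. x (\<tau> i) - w (\<tau> i))"
  have \<tau>\<tau>: "\<tau> (\<tau> i) = i" for i by (simp add: \<tau>_def)
  have \<tau>k: "\<tau> i < k \<longleftrightarrow> i < k" for i using assms by (auto simp: \<tau>_def Transposition.transpose_def)
  then have \<tau>k': "k \<le> \<tau> i \<longleftrightarrow> k \<le> i" for i by (meson not_less)
  have \<tau>0: "\<tau> 0 = 0" "\<tau> m = 1" using assms by (auto simp: \<tau>_def Transposition.transpose_def)
  have w0: "w i = 0" if "k \<le> i" for i using assms that by (auto simp: w_def)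
  have bij: "bij_betw \<tau> {..<k} {..<k}"
    by (rule bij_betwI[of _ _ _ \<tau>]) (auto simp: \<tau>k \<tau>\<tau>)
  have mem: "\<phi> x \<in> topspace (Euclidean_space k)" "\<psi> x \<in> topspace (Euclidean_space k)"
    if "x \<in> topspace (Euclidean_space k)" for x
    using that by (auto simp: \<phi>_def \<psi>_def topspace_Euclidean_space \<tau>k' w0)
  have inv: "\<phi> (\<psi> x) = x" "\<psi> (\<phi> x) = x" for x
    by (auto simp: \<phi>_def \<psi>_def \<tau>\<tau>)
  have "euclidean_isometry k \<phi>"
    unfolding euclidean_isometry_def
  proof (intro conjI ballI)
    show "\<phi> ` topspace (Euclidean_space k) = topspace (Euclidean_space k)"
    proof (intro equalityI subsetI)
      fix x assume x: "x \<in> topspace (Euclidean_space k)"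
      have "\<phi> (\<psi> x) \<in> \<phi> ` topspace (Euclidean_space k)" using mem(2)[OF x] by (rule imageI)
      then show "x \<in> \<phi> ` topspace (Euclidean_space k)" unfolding inv .
    qed (use mem in blast)
    fix x y :: "nat \<Rightarrow> real"
    have "(\<Sum>i<k. (\<phi> x i - \<phi> y i)\<^sup>2) = (\<Sum>i<k. (x (\<tau> i) - y (\<tau> i))\<^sup>2)" by (simp add: \<phi>_def)
    also have "\<dots> = (\<Sum>i<k. (x i - y i)\<^sup>2)"
      by (rule sum.reindex_bij_betw[OF bij, of "\<lambda>i. (x i - y i)\<^sup>2"])
    finally show "L2_set (\<lambda>i. \<phi> x i - \<phi> y i) {..<k} = L2_set (\<lambda>i. x i - y i) {..<k}"
      by (simp add: L2_set_def)
  qed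
  moreover have "cyl k m c b R =
      \<phi> ` {x \<in> topspace (Euclidean_space k). (\<lambda>i. if i < 2 then x i else 0) \<in> circle R}"
  proof -
    have circ: "(\<lambda>i. if i < 2 then x i else 0) \<in> circle R \<longleftrightarrow> (x 0)\<^sup>2 + (x 1)\<^sup>2 = R\<^sup>2" for x :: "nat \<Rightarrow> real"
      using assms by (simp add: circle_eq topspace_Euclidean_space)
    have val: "cyl_fun m c b R (\<phi> x) = (x 0)\<^sup>2 + (x 1)\<^sup>2 - R\<^sup>2" for x
      using assms by (simp add: cyl_fun_def \<phi>_def \<tau>0 w_def)
    show ?thesis
    proof (intro equalityI subsetI)
      fix p assume p: "p \<in> cyl k m c b R"
      then have "cyl_fun m c b R (\<phi> (\<psi> p)) = 0" by (simp add: cyl_def inv)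
      then have "\<psi> p \<in> {x \<in> topspace (Euclidean_space k). (\<lambda>i. if i < 2 then x i else 0) \<in> circle R}"
        using p mem(2)[of p] unfolding val circ cyl_def by simp
      then have "\<phi> (\<psi> p) \<in> \<phi> ` {x \<in> topspace (Euclidean_space k). (\<lambda>i. if i < 2 then x i else 0) \<in> circle R}"
        by (rule imageI)
      then show "p \<in> \<phi> ` {x \<in> topspace (Euclidean_space k). (\<lambda>i. if i < 2 then x i else 0) \<in> circle R}"
        unfolding inv .
    next
      fix p assume "p \<in> \<phi> ` {x \<in> topspace (Euclidean_space k). (\<lambda>i. if i < 2 then x i else 0) \<in> circle R}"
      then obtain x where "p = \<phi> x" "x \<in> topspace (Euclidean_space k)" "(x 0)\<^sup>2 + (x 1)\<^sup>2 = R\<^sup>2"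
        unfolding circ by blast
      then show "p \<in> cyl k m c b R" using mem(1)[of x] val[of x] by (simp add: cyl_def)
    qed
  qed
  ultimately show ?thesis unfolding is_cylinder_def by blast
qed

lemma cyl_fun_curve_derivative:
  assumes "((\<lambda>s. \<gamma> s 0) has_real_derivative v 0) (at 0)" "((\<lambda>s. \<gamma> s m) has_real_derivative v m) (at 0)"
  shows "((\<lambda>s. cyl_fun m c b R (\<gamma> s)) has_real_derivative
           2 * (\<gamma> 0 0 - c) * v 0 + 2 * (\<gamma> 0 m - b) * v m) (at 0)"
  unfolding cyl_fun_def using assms by (auto intro!: derivative_eq_intros) (simp add: algebra_simps)

text \<open>The defining equation is differentiated along a curve. Allowing any subset
  \<open>M\<close> of the cylinder makes this apply to the strata in the definition of singular
  points, whose tangent spaces are not computed.\<close>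

lemma tangent_space_cyl_subset:
  assumes "M \<subseteq> cyl k m c b R" "v \<in> tangent_space M p"
  shows "(p 0 - c) * v 0 + (p m - b) * v m = 0" and "\<forall>i\<ge>k. v i = 0"
proof -
  obtain \<gamma> \<epsilon> where g: "\<epsilon> > 0" "\<gamma> 0 = p" "\<And>s. s \<in> {-\<epsilon><..<\<epsilon>} \<Longrightarrow> \<gamma> s \<in> M"
    "\<And>i. ((\<lambda>s. \<gamma> s i) has_real_derivative v i) (at 0)"
    using assms(2) unfolding tangent_space_def by blast
  have ev: "eventually (\<lambda>s. s \<in> {-\<epsilon><..<\<epsilon>}) (nhds 0)"
    using g(1) by (intro eventually_nhds_in_open) auto
  have zero: "d = 0" if "(h has_real_derivative d) (at 0)" "\<And>s. s \<in> {-\<epsilon><..<\<epsilon>} \<Longrightarrow> h s = 0" for h d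
  proof -
    have "((\<lambda>_. 0) has_real_derivative d) (at (0::real))"
      using that(1) by (rule DERIV_cong_ev[THEN iffD1, rotated -1])
        (use that(2) g(1) in \<open>auto intro: eventually_mono[OF ev]\<close>)
    then show ?thesis using DERIV_unique DERIV_const by blast
  qed
  have in_cyl: "\<gamma> s \<in> cyl k m c b R" if "s \<in> {-\<epsilon><..<\<epsilon>}" for s using g(3)[OF that] assms(1) by blast
  have "2 * (\<gamma> 0 0 - c) * v 0 + 2 * (\<gamma> 0 m - b) * v m = 0"
    by (rule zero[OF cyl_fun_curve_derivative[OF g(4) g(4)]]) (use in_cyl in \<open>auto simp: cyl_def\<close>)
  then have "2 * ((p 0 - c) * v 0 + (p m - b) * v m) = 0" using g(2) by (simp add: algebra_simps)
  then show "(p 0 - c) * v 0 + (p m - b) * v m = 0" by (simp only: mult_eq_0_iff) simp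
  show "\<forall>i\<ge>k. v i = 0"
  proof (intro allI impI)
    fix i assume "k \<le> i"
    then show "v i = 0"
      by (intro zero[OF g(4)[of i]]) (use in_cyl in \<open>auto simp: cyl_def topspace_Euclidean_space\<close>)
  qed
qed

lemma C1_differentiable_onI:
  assumes "\<And>x. x \<in> S \<Longrightarrow> (f has_real_derivative f' x) (at x)" "continuous_on S f'"
  shows "f C1_differentiable_on S"
  unfolding C1_differentiable_on_def
  using assms by (auto simp: has_real_derivative_iff_has_vector_derivative)

lemma tangent_spaceI:
  assumes "\<epsilon> > 0" "\<gamma> 0 = p" "\<And>s. s \<in> {-\<epsilon><..<\<epsilon>} \<Longrightarrow> \<gamma> s \<in> M"
    "\<And>i. (\<lambda>s. \<gamma> s i) C1_differentiable_on {-\<epsilon><..<\<epsilon>}"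
    "\<And>i. ((\<lambda>s. \<gamma> s i) has_real_derivative v i) (at 0)"
  shows "v \<in> tangent_space M p"
  unfolding tangent_space_def using assms by blast

text \<open>Tangent vectors are realised by rotating about the axis of the cylinder.\<close>

lemma tangent_space_cyl:
  assumes m: "0 < m" "m < k" and R: "R > 0" and p: "p \<in> cyl k m c b R"
  shows "tangent_space (cyl k m c b R) p =
     {v. (\<forall>i\<ge>k. v i = 0) \<and> (p 0 - c) * v 0 + (p m - b) * v m = 0}"
proof (intro equalityI subsetI)
  fix v assume "v \<in> tangent_space (cyl k m c b R) p"
  then show "v \<in> {v. (\<forall>i\<ge>k. v i = 0) \<and> (p 0 - c) * v 0 + (p m - b) * v m = 0}"
    using tangent_space_cyl_subset[OF order.refl] by blast
next
  fix v assume v: "v \<in> {v. (\<forall>i\<ge>k. v i = 0) \<and> (p 0 - c) * v 0 + (p m - b) * v m = 0}"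
  define x y where "x = p 0 - c" and "y = p m - b"
  have xy: "x\<^sup>2 + y\<^sup>2 = R\<^sup>2" and pk: "\<forall>i\<ge>k. p i = 0"
    using p by (auto simp: cyl_def cyl_fun_def x_def y_def topspace_Euclidean_space)
  have vxy: "x * v 0 + y * v m = 0" and vk: "\<forall>i\<ge>k. v i = 0" using v by (auto simp: x_def y_def)
  \<comment> \<open>The angular velocity: a planar vector orthogonal to the radius
    \<open>(x, y)\<close> of length \<open>R\<close> is \<open>\<omega>\<close> times the radius
    turned by a right angle.\<close>
  define \<omega> where "\<omega> = (x * v m - y * v 0) / R\<^sup>2"
  have "R\<^sup>2 * v 0 = x * (x * v 0 + y * v m) - y * (x * v m - y * v 0)"
    unfolding xy[symmetric] by (simp add: algebra_simps power2_eq_square)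
  then have v0: "v 0 = - \<omega> * y" using R vxy by (simp add: \<omega>_def field_simps)
  have "R\<^sup>2 * v m = y * (x * v 0 + y * v m) + x * (x * v m - y * v 0)"
    unfolding xy[symmetric] by (simp add: algebra_simps power2_eq_square)
  then have vm: "v m = \<omega> * x" using R vxy by (simp add: \<omega>_def field_simps)
  define \<gamma> where "\<gamma> = (\<lambda>s i. if i = 0 then c + x * cos (\<omega> * s) - y * sin (\<omega> * s)
      else if i = m then b + x * sin (\<omega> * s) + y * cos (\<omega> * s) else p i + s * v i)"
  define \<gamma>' where "\<gamma>' = (\<lambda>s i. if i = 0 then - \<omega> * x * sin (\<omega> * s) - \<omega> * y * cos (\<omega> * s)
      else if i = m then \<omega> * x * cos (\<omega> * s) - \<omega> * y * sin (\<omega> * s) else v i)"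
  have d: "((\<lambda>s. \<gamma> s i) has_real_derivative \<gamma>' s i) (at s)" for s i
    unfolding \<gamma>_def \<gamma>'_def by (auto intro!: derivative_eq_intros)
  have cont: "continuous_on UNIV (\<lambda>s. \<gamma>' s i)" for i
    unfolding \<gamma>'_def by (cases "i = 0"; cases "i = m"; simp; intro continuous_intros)
  have \<gamma>v: "\<gamma>' 0 = v" using v0 vm by (auto simp: \<gamma>'_def)
  have \<gamma>0: "\<gamma> 0 = p" using m by (auto simp: \<gamma>_def x_def y_def)
  have rot: "(x * C - y * S)\<^sup>2 + (x * S + y * C)\<^sup>2 = (x\<^sup>2 + y\<^sup>2) * (S\<^sup>2 + C\<^sup>2)" for C S :: real
    by (simp add: algebra_simps power2_eq_square)
  have "\<gamma> s \<in> cyl k m c b R" for s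
  proof -
    have "cyl_fun m c b R (\<gamma> s) = (x * cos (\<omega> * s) - y * sin (\<omega> * s))\<^sup>2 + (x * sin (\<omega> * s) + y * cos (\<omega> * s))\<^sup>2 - R\<^sup>2"
      using m by (simp add: cyl_fun_def \<gamma>_def add.assoc)
    also have "\<dots> = (x\<^sup>2 + y\<^sup>2) * ((sin (\<omega> * s))\<^sup>2 + (cos (\<omega> * s))\<^sup>2) - R\<^sup>2"
      unfolding rot ..
    finally have "cyl_fun m c b R (\<gamma> s) = 0" using xy by simp
    moreover have "\<gamma> s i = 0" if "i \<ge> k" for i using that m pk vk by (auto simp: \<gamma>_def)
    ultimately show ?thesis by (simp add: cyl_def topspace_Euclidean_space)
  qed
  then show "v \<in> tangent_space (cyl k m c b R) p"
  proof (rule tangent_spaceI[where \<gamma> = \<gamma> and \<epsilon> = 1, rotated 2])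
    show "(\<lambda>s. \<gamma> s i) C1_differentiable_on {-1<..<1}" for i
      by (rule C1_differentiable_onI[OF d continuous_on_subset[OF cont]]) simp
    show "((\<lambda>s. \<gamma> s i) has_real_derivative v i) (at 0)" for i
      using d[of i 0] unfolding \<gamma>v .
  qed (use \<gamma>0 in simp_all)
qed

text \<open>A solution space in solved form with pivot coordinates \<open>P\<close>. The two shapes
  cover the two cases of transversality: if no active cylinder has a vertical tangent, the pivots
  are multiples of \<open>v 0\<close>; otherwise \<open>0\<close> is itself a pivot and all pivots
  vanish.\<close>

lemma fun_dim_pivot:
  fixes P :: "nat set" and \<mu> :: "nat \<Rightarrow> real"
  assumes P: "P \<subseteq> {..<k}"
  shows "fun_dim {v. (\<forall>i\<ge>k. v i = 0) \<and> (\<forall>i\<in>P. v i = (if 0 \<in> P then 0 else \<mu> i * v 0))} = k - card P"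
    (is "fun_dim ?W = _")
proof -
  interpret vector_space fun_scale by (rule vector_space_fun_scale)
  \<comment> \<open>The basis vector of the free coordinate \<open>q\<close>; if \<open>0\<close> is
    free, its vector carries the pivots along with the factors \<open>\<mu>\<close>.\<close>
  define e where "e = (\<lambda>q i. if i = q then 1 else if q = 0 \<and> i \<in> P then \<mu> i else 0 :: real)"
  let ?Q = "{..<k} - P"
  have fin: "finite ?Q" by simp
  have sum_eval: "(\<Sum>q\<in>A. fun_scale (u q) (e q)) i = (\<Sum>q\<in>A. u q * e q i)" for u i and A :: "nat set"
    by (induction A rule: infinite_finite_induct) (auto simp: fun_scale_def)
  have eQ: "e q i = (if i = q then 1 else 0)" if "i \<in> ?Q" for q i
    using that by (auto simp: e_def)
  have inj: "inj_on e ?Q"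
  proof (rule inj_onI)
    fix q q' assume "q \<in> ?Q" "q' \<in> ?Q" "e q = e q'"
    then show "q = q'" using eQ[of q q] eQ[of q q'] by (metis zero_neq_one)
  qed
  have W: "e ` ?Q \<subseteq> ?W"
    using P by (auto simp: e_def)
  have span: "?W \<subseteq> span (e ` ?Q)"
  proof
    fix v assume v: "v \<in> ?W"
    have "v = (\<Sum>q\<in>?Q. fun_scale (v q) (e q))"
    proof
      fix i
      consider "i \<ge> k" | "i \<in> ?Q" | "i \<in> P" by force
      then show "v i = (\<Sum>q\<in>?Q. fun_scale (v q) (e q)) i"
      proof cases
        case 1
        then have "e q i = 0" if "q \<in> ?Q" for q using that P by (auto simp: e_def)
        then show ?thesis using v 1 unfolding sum_eval by simp
      next
        case 2
        have "(\<Sum>q\<in>?Q. v q * e q i) = (\<Sum>q\<in>?Q. if i = q then v q else 0)"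
          by (rule sum.cong) (auto simp: eQ[OF 2])
        then show ?thesis unfolding sum_eval using 2 by (simp add: sum.delta'[OF fin])
      next
        case 3
        have "v q * e q i = (if q = 0 then \<mu> i * v 0 else 0)" if "q \<in> ?Q" for q
          using that 3 by (auto simp: e_def)
        then have "(\<Sum>q\<in>?Q. v q * e q i) = (\<Sum>q\<in>?Q. if q = 0 then \<mu> i * v 0 else 0)" by (rule sum.cong[OF refl])
        also have "\<dots> = (if 0 \<in> ?Q then \<mu> i * v 0 else 0)" using fin by simp
        also have "\<dots> = v i" using v 3 P by auto
        finally show ?thesis unfolding sum_eval by simp
      qed
    qed
    then show "v \<in> span (e ` ?Q)"
      by (metis (no_types, lifting) span_sum span_scale span_base imageI)
  qed
  have indep: "independent (e ` ?Q)"
  proof (rule independent_if_scalars_zero)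
    show "finite (e ` ?Q)" using fin by simp
    fix f x assume z: "(\<Sum>x\<in>e ` ?Q. fun_scale (f x) x) = 0" and x: "x \<in> e ` ?Q"
    then obtain q where q: "q \<in> ?Q" "x = e q" by blast
    have "(\<Sum>q\<in>?Q. fun_scale (f (e q)) (e q)) = 0" using z unfolding sum.reindex[OF inj] comp_def .
    then have "(\<Sum>q\<in>?Q. fun_scale (f (e q)) (e q)) q = 0 q" by (rule fun_cong)
    then have "(\<Sum>q'\<in>?Q. f (e q') * e q' q) = 0" unfolding sum_eval zero_fun_apply .
    moreover have "(\<Sum>q'\<in>?Q. f (e q') * e q' q) = (\<Sum>q'\<in>?Q. if q = q' then f (e q') else 0)"
      by (rule sum.cong) (auto simp: eQ[OF q(1)])
    ultimately show "f x = 0" using q by (simp add: sum.delta'[OF fin])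
  qed
  have "card (e ` ?Q) = k - card P"
    using card_image[OF inj] P by (simp add: card_Diff_subset finite_subset)
  then show ?thesis by (rule dim_unique[OF W span indep])
qed

section \<open>The arrangement of cylinders\<close>

text \<open>
  The plane of the coordinates \<open>0\<close> and \<open>m \<in> {1..e}\<close> carries a stack of \<open>N m + 1\<close> disjoint disks
  to be avoided. The lowest and the highest one bound the coordinate \<open>m\<close>; the other ones touch the line
  \<open>x 0 = s m\<close> and lie to its right or to its left, which makes the slice split into several parts when
  \<open>x 0\<close> passes \<open>s m\<close>. The disks in the last two planes are to be stayed in, and confine \<open>x 0\<close>
  to \<open>[a, b]\<close>.
\<close>

locale arrangement =
  fixes e :: nat and N :: "nat \<Rightarrow> nat" and right :: "nat \<Rightarrow> nat \<Rightarrow> bool" and s :: "nat \<Rightarrow> real"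
    and a b R :: real
  assumes ab: "a < b" and R_gt: "b - a < R"
    and N_pos: "m \<in> {1..e} \<Longrightarrow> N m \<ge> 1"
    and N_end: "N (e + 1) = 0" "N (e + 2) = 0"
    and s_in: "m \<in> {1..e} \<Longrightarrow> N m \<ge> 2 \<Longrightarrow> a < s m \<and> s m < b"
    and s_inj: "m \<in> {1..e} \<Longrightarrow> m' \<in> {1..e} \<Longrightarrow> N m \<ge> 2 \<Longrightarrow> N m' \<ge> 2 \<Longrightarrow> s m = s m' \<Longrightarrow> m = m'"
begin

abbreviation "k \<equiv> e + 3"

text \<open>The distance between neighbouring centres of a stack. Being more than
  \<open>2 * R\<close>, it keeps the disks disjoint and leaves a gap; the height half-way between
  two centres has distance \<open>3/2 * R\<close> from both.\<close>

definition H :: real where "H = 3 * R"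

text \<open>The confining disks touch \<open>x = a\<close> and \<open>x = b\<close> from inside.
  Outer disks of a stack are centred over \<open>a\<close>, so that every slice over
  \<open>[a, b]\<close> cuts them properly. An inner disk touches \<open>x = s m\<close> with its
  leftmost or its rightmost point.\<close>

definition cx :: "nat \<Rightarrow> nat \<Rightarrow> real" where
  "cx m i = (if m = e + 1 then a + R else if m = e + 2 then b - R
     else if i = 0 \<or> i = N m then a else if right m i then s m + R else s m - R)"

text \<open>The sign that makes \<open>f\<close> positive outside the disks of the stacks and inside
  the two confining ones.\<close>

definition \<sigma> :: "nat \<Rightarrow> real" where "\<sigma> m = (if m \<le> e then 1 else -1)"

definition f :: "nat \<times> nat \<Rightarrow> (nat \<Rightarrow> real) \<Rightarrow> real" where
  "f j p = \<sigma> (fst j) * cyl_fun (fst j) (cx (fst j) (snd j)) (real (snd j) * H) R p"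

definition S :: "nat \<times> nat \<Rightarrow> (nat \<Rightarrow> real) set" where
  "S j = cyl k (fst j) (cx (fst j) (snd j)) (real (snd j) * H) R"

definition Q :: "(nat \<times> nat) set" where "Q = (SIGMA m:{1..e+2}. {0..N m})"

definition E :: "(nat \<Rightarrow> real) set" where "E = {p. \<forall>i\<ge>k. p i = 0}"

text \<open>The neighbourhood that an RA-region asks for. Keeping the coordinate \<open>m\<close>
  between the centres of the outer disks cuts off the parts of \<open>f > 0\<close> below and above
  the stack.\<close>

definition U :: "(nat \<Rightarrow> real) set" where
  "U = {p \<in> E. \<forall>m\<in>{1..e}. 0 < p m \<and> p m < real (N m) * H}"

definition D :: "(nat \<Rightarrow> real) set" where
  "D = U \<inter> {p. \<forall>j\<in>Q. f j p > 0}"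

text \<open>An explicit candidate for the closure of \<open>D\<close>; that it is the closure is
  \<open>closure_D\<close>.\<close>

definition C :: "(nat \<Rightarrow> real) set" where
  "C = {p \<in> E. (\<forall>m\<in>{1..e}. 0 \<le> p m \<and> p m \<le> real (N m) * H) \<and> (\<forall>j\<in>Q. f j p \<ge> 0)}"

lemma R_pos: "R > 0" using ab R_gt by simp

lemma H_pos: "H > 0" using R_pos by (simp add: H_def)

lemma E_eq: "topspace (Euclidean_space k) = E"
  by (simp add: E_def topspace_Euclidean_space)

lemma Euclidean_E: "Euclidean_space k = top_of_set E"
  by (simp add: E_def Euclidean_space_top_of_set)

lemma finite_Q: "finite Q" by (simp add: Q_def)

lemma Q_iff: "(m, i) \<in> Q \<longleftrightarrow> m \<in> {1..e+2} \<and> i \<le> N m" by (auto simp: Q_def)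

lemma Q_cases:
  assumes "(m, i) \<in> Q"
  obtains "m \<in> {1..e}" "i \<le> N m" | "m = e + 1" "i = 0" | "m = e + 2" "i = 0"
proof -
  have "m \<in> {1..e} \<or> m = e + 1 \<or> m = e + 2" and "i \<le> N m" using assms unfolding Q_iff by auto
  then show thesis using that N_end by (elim disjE) auto
qed

lemma f_le: "m \<le> e \<Longrightarrow> f (m, i) p = (p 0 - cx m i)\<^sup>2 + (p m - real i * H)\<^sup>2 - R\<^sup>2"
  by (simp add: f_def \<sigma>_def cyl_fun_def)

lemma f_end1: "f (e + 1, 0) p = R\<^sup>2 - (p 0 - a - R)\<^sup>2 - (p (e + 1))\<^sup>2"
  by (simp add: f_def \<sigma>_def cyl_fun_def cx_def algebra_simps)

lemma f_end2: "f (e + 2, 0) p = R\<^sup>2 - (p 0 - b + R)\<^sup>2 - (p (e + 2))\<^sup>2"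
  by (simp add: f_def \<sigma>_def cyl_fun_def cx_def algebra_simps)

lemma \<sigma>_square: "\<sigma> m * \<sigma> m = 1" by (simp add: \<sigma>_def)

lemma f_zero_iff: "f j p = 0 \<longleftrightarrow> cyl_fun (fst j) (cx (fst j) (snd j)) (real (snd j) * H) R p = 0"
  by (simp add: f_def \<sigma>_def)

lemma S_iff: "p \<in> S j \<longleftrightarrow> p \<in> E \<and> f j p = 0"
  by (simp add: S_def cyl_def f_zero_iff E_eq)

lemma f_zeroD: "f (m, i) p = 0 \<Longrightarrow> (p 0 - cx m i)\<^sup>2 + (p m - real i * H)\<^sup>2 = R\<^sup>2"
  by (simp add: f_zero_iff cyl_fun_def)

lemma square_diff_bounds:
  fixes x c r :: real
  assumes "(x - c)\<^sup>2 \<le> r\<^sup>2" "r > 0"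
  shows "c - r \<le> x" "x \<le> c + r"
  using assms abs_le_square_iff[of "x - c" r] by auto

lemma in_C_x:
  assumes p: "p \<in> C"
  shows "a \<le> p 0" "p 0 \<le> b"
proof -
  have "(e + 1, 0) \<in> Q" "(e + 2, 0) \<in> Q" by (auto simp: Q_iff)
  then have 1: "f (e + 1, 0) p \<ge> 0" "f (e + 2, 0) p \<ge> 0" using p by (auto simp: C_def)
  have "(p 0 - (a + R))\<^sup>2 \<le> R\<^sup>2" using 1(1) zero_le_power2[of "p (e + 1)"]
    unfolding f_end1 diff_diff_eq by linarith
  then show "a \<le> p 0" using square_diff_bounds(1)[of "p 0" "a + R" R] R_pos by simp
  have eq: "p 0 - (b - R) = p 0 - b + R" by simp
  have "(p 0 - (b - R))\<^sup>2 \<le> R\<^sup>2" using 1(2) zero_le_power2[of "p (e + 2)"]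
    unfolding f_end2 eq by linarith
  then show "p 0 \<le> b" using square_diff_bounds(2)[of "p 0" "b - R" R] R_pos by simp
qed

lemma abs_less_square_iff: "\<bar>x\<bar> < \<bar>y\<bar> \<longleftrightarrow> x\<^sup>2 < y\<^sup>2" for x y :: real
  using abs_le_square_iff[of y x] by linarith

lemma small_square: "\<bar>x\<bar> < R \<Longrightarrow> x\<^sup>2 < R\<^sup>2"
  using R_pos abs_less_square_iff[of x R] by simp

lemma in_C_edge_disk:
  assumes p: "p \<in> C" and m: "m \<in> {1..e}" and i: "i = 0 \<or> i = N m"
  shows "(p 0 - cx m i)\<^sup>2 < R\<^sup>2" "p m \<noteq> real i * H"
proof -
  have "cx m i = a" using m i by (auto simp: cx_def)
  then show 1: "(p 0 - cx m i)\<^sup>2 < R\<^sup>2"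
    using in_C_x[OF p] R_gt by (intro small_square) auto
  have "(m, i) \<in> Q" using m i by (auto simp: Q_iff)
  then have "f (m, i) p \<ge> 0" using p by (auto simp: C_def)
  then show "p m \<noteq> real i * H" using 1 m by (auto simp: f_le)
qed

text \<open>Over \<open>[a, b]\<close> the centre heights of the outer disks lie inside these disks,
  so a point of \<open>C\<close> never reaches the bounds of its coordinates.\<close>

lemma C_subset_U: "C \<subseteq> U"
proof
  fix p assume p: "p \<in> C"
  have "0 < p m \<and> p m < real (N m) * H" if m: "m \<in> {1..e}" for m
    using in_C_edge_disk(2)[OF p m, of 0] in_C_edge_disk(2)[OF p m, of "N m"] p m
    by (auto simp: C_def less_le)
  then show "p \<in> U" using p by (auto simp: U_def C_def)
qed

lemma D_subset_C: "D \<subseteq> C"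
  by (auto simp: D_def U_def C_def less_imp_le)

text \<open>Distinct centres are at least \<open>3 * R\<close> apart, too far for a common point of
  two circles of radius \<open>R\<close>. Thus a point meets at most one cylinder per plane.\<close>

lemma disk_unique:
  assumes "f (m, i) p = 0" "f (m, j) p = 0"
  shows "i = j"
proof (rule ccontr)
  assume "i \<noteq> j"
  have "\<bar>p m - real i * H\<bar> \<le> R" if "f (m, i) p = 0" for i
  proof -
    have "(p m - real i * H)\<^sup>2 \<le> R\<^sup>2"
      using f_zeroD[OF that] zero_le_power2[of "p 0 - cx m i"] by linarith
    then show ?thesis using abs_le_square_iff[of "p m - real i * H" R] R_pos by simp
  qed
  then have "\<bar>real i * H - real j * H\<bar> \<le> 2 * R" using assms by (smt (verit))
  moreover have "1 \<le> \<bar>real i - real j\<bar>" using \<open>i \<noteq> j\<close> by linarith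
  then have "H \<le> \<bar>real i - real j\<bar> * H" using H_pos by simp
  moreover have "\<bar>real i * H - real j * H\<bar> = \<bar>real i - real j\<bar> * H"
    using H_pos by (simp add: abs_mult flip: left_diff_distrib)
  ultimately show False using R_pos by (simp add: H_def)
qed

section \<open>Vertical tangents over the range of the first coordinate\<close>

definition level :: "nat \<Rightarrow> real" where
  "level m = (if m = e + 1 then a else if m = e + 2 then b else s m)"

definition levels :: "real set" where
  "levels = {a, b} \<union> s ` {m \<in> {1..e}. N m \<ge> 2}"

text \<open>A vertical tangent occurs at distance \<open>R\<close> to the left or right of the
  centre. Outer disks are excluded by \<open>in_C_edge_disk\<close>; for any other disk one of the
  two places is the intended level, and the other is \<open>2 * R\<close> away from it, out of
  \<open>[a, b]\<close>.\<close>

lemma critical_level: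
  assumes p: "p \<in> C" and j: "(m, i) \<in> Q" and f0: "f (m, i) p = 0" and y: "p m = real i * H"
  shows "p 0 = level m" "level m \<in> levels" "m \<in> {1..e} \<Longrightarrow> N m \<ge> 2" "p 0 \<noteq> cx m i"
proof -
  have "(p 0 - cx m i)\<^sup>2 = R\<^sup>2" using f_zeroD[OF f0] y by simp
  then have *: "p 0 = cx m i + R \<or> p 0 = cx m i - R" by (auto simp: power2_eq_iff)
  then show "p 0 \<noteq> cx m i" using R_pos by auto
  note x = in_C_x[OF p]
  have "p 0 = level m \<and> level m \<in> levels \<and> (m \<in> {1..e} \<longrightarrow> N m \<ge> 2)"
    using j
  proof (cases rule: Q_cases)
    case 1
    have "i \<noteq> 0" using in_C_edge_disk(2)[OF p 1(1), of i, OF disjI1] y by auto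
    have "i \<noteq> N m" using in_C_edge_disk(2)[OF p 1(1), of i, OF disjI2] y by auto
    then have N: "N m \<ge> 2" using 1 \<open>i \<noteq> 0\<close> by auto
    have c: "cx m i = (if right m i then s m + R else s m - R)"
      using 1 \<open>i \<noteq> 0\<close> \<open>i \<noteq> N m\<close> by (auto simp: cx_def)
    have "p 0 = s m" using * c s_in[OF 1(1) N] x R_gt by (auto split: if_splits)
    then show ?thesis using 1 N by (auto simp: level_def levels_def)
  next
    case 2
    then show ?thesis using * x R_gt R_pos ab by (auto simp: level_def levels_def cx_def)
  next
    case 3
    then show ?thesis using * x R_gt R_pos ab by (auto simp: level_def levels_def cx_def)
  qed
  then show "p 0 = level m" "level m \<in> levels" "m \<in> {1..e} \<Longrightarrow> N m \<ge> 2" by auto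
qed

text \<open>Planes with inner disks have pairwise different levels strictly between \<open>a\<close>
  and \<open>b\<close>, so the level determines the plane; within a plane \<open>disk_unique\<close>
  applies. This is what both transversality and the inward direction rest on.\<close>

lemma critical_unique:
  assumes p: "p \<in> C" and "(m, i) \<in> Q" "f (m, i) p = 0" "p m = real i * H"
    and "(m', i') \<in> Q" "f (m', i') p = 0" "p m' = real i' * H"
  shows "(m, i) = (m', i')"
proof -
  note c = critical_level[OF p assms(2-4)] and c' = critical_level[OF p assms(5-7)]
  have eq: "level m = level m'" using c(1) c'(1) by simp
  have "m = m'"
    using assms(2)
  proof (cases rule: Q_cases)
    case 1
    note s1 = s_in[OF 1(1) c(3)[OF 1(1)]]
    show ?thesis using assms(5)
    proof (cases rule: Q_cases)
      case 1
      then show ?thesis using eq s_inj[of m m'] c(3) c'(3) \<open>m \<in> {1..e}\<close> by (auto simp: level_def)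
    qed (use eq s1 \<open>m \<in> {1..e}\<close> in \<open>auto simp: level_def\<close>)
  next
    case 2
    show ?thesis using assms(5)
    proof (cases rule: Q_cases)
      case 1
      then show ?thesis using eq s_in[OF 1(1) c'(3)[OF 1(1)]] 2 by (auto simp: level_def)
    qed (use eq ab 2 in \<open>auto simp: level_def\<close>)
  next
    case 3
    show ?thesis using assms(5)
    proof (cases rule: Q_cases)
      case 1
      then show ?thesis using eq s_in[OF 1(1) c'(3)[OF 1(1)]] 3 by (auto simp: level_def)
    qed (use eq ab 3 in \<open>auto simp: level_def\<close>)
  qed
  then show ?thesis using disk_unique assms(3,6) by blast
qed

lemma continuous_on_f: "continuous_on A (f j)"
  unfolding f_def by (intro continuous_intros continuous_on_cyl_fun)

lemma open_f_pos: "open {p. f j p > 0}"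
  using open_Collect_less[OF continuous_on_const continuous_on_f] .

lemma closed_f_nonneg: "closed {p. f j p \<ge> 0}"
  using closed_Collect_le[OF continuous_on_const continuous_on_f] .

lemma open_coord: "open {p :: nat \<Rightarrow> real. x < p i \<and> p i < y}"
  by (intro open_Collect_conj open_Collect_less continuous_on_const continuous_on_coord)

lemma closed_coord: "closed {p :: nat \<Rightarrow> real. x \<le> p i \<and> p i \<le> y}"
  by (intro closed_Collect_conj closed_Collect_le continuous_on_const continuous_on_coord)

lemma openin_U: "openin (Euclidean_space k) U"
proof -
  have "U = E \<inter> (\<Inter>m\<in>{1..e}. {p. 0 < p m \<and> p m < real (N m) * H})" by (auto simp: U_def)
  moreover have "open (\<Inter>m\<in>{1..e}. {p :: nat \<Rightarrow> real. 0 < p m \<and> p m < real (N m) * H})"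
    by (intro open_INT ballI open_coord) auto
  ultimately show ?thesis unfolding Euclidean_E by (auto simp: openin_open)
qed

lemma openin_D: "openin (Euclidean_space k) D"
proof -
  have "D = U \<inter> (\<Inter>j\<in>Q. {p. f j p > 0})" by (auto simp: D_def)
  moreover have "open (\<Inter>j\<in>Q. {p. f j p > 0})"
    by (intro open_INT ballI open_f_pos finite_Q)
  ultimately show ?thesis
    using openin_U unfolding Euclidean_E by (metis openin_Int_open)
qed

lemma closed_E: "closed E"
proof -
  have "E = (\<Inter>i\<in>{k..}. {p. p i = 0})" by (auto simp: E_def)
  then show ?thesis by (simp only:) (intro closed_INT ballI closed_Collect_eq continuous_on_const continuous_on_coord)
qed

lemma closed_C: "closed C"
proof -
  have "C = E \<inter> (\<Inter>m\<in>{1..e}. {p. 0 \<le> p m \<and> p m \<le> real (N m) * H}) \<inter> (\<Inter>j\<in>Q. {p. f j p \<ge> 0})"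
    by (auto simp: C_def)
  then show ?thesis
    by (simp only:) (intro closed_Int closed_E closed_INT ballI closed_coord closed_f_nonneg)
qed

lemma compact_C: "compact C"
proof -
  define K where "K = (\<lambda>i. if i = 0 then {a..b} else if i \<le> e then {0..real (N i) * H}
      else if i < k then {-R..R} else {0 :: real})"
  have "compactin (product_topology (\<lambda>i. euclideanreal) UNIV) (Pi\<^sub>E UNIV K)"
    unfolding compactin_PiE by (auto simp: K_def)
  then have "compact (Pi\<^sub>E UNIV K)" by (simp add: euclidean_product_topology)
  moreover have "C \<subseteq> Pi\<^sub>E UNIV K"
  proof
    fix p assume p: "p \<in> C"
    have "p i \<in> K i" for i
    proof -
      consider "i = 0" | "i \<in> {1..e}" | "i = e + 1" | "i = e + 2" | "i \<ge> k" by force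
      then show ?thesis
      proof cases
        case 3
        have "f (e + 1, 0) p \<ge> 0" using p by (auto simp: C_def Q_iff)
        then have "(p (e + 1))\<^sup>2 \<le> R\<^sup>2" using zero_le_power2[of "p 0 - a - R"] unfolding f_end1 by linarith
        then show ?thesis using square_diff_bounds[of "p (e + 1)" 0 R] R_pos 3 by (simp add: K_def)
      next
        case 4
        have "f (e + 2, 0) p \<ge> 0" using p by (auto simp: C_def Q_iff)
        then have "(p (e + 2))\<^sup>2 \<le> R\<^sup>2" using zero_le_power2[of "p 0 - b + R"] unfolding f_end2 by linarith
        then show ?thesis using square_diff_bounds[of "p (e + 2)" 0 R] R_pos 4 by (simp add: K_def)
      qed (use p in_C_x[OF p] in \<open>auto simp: K_def C_def E_def\<close>)
    qed
    then show "p \<in> Pi\<^sub>E UNIV K" by auto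
  qed
  ultimately show ?thesis using closed_C by (metis compact_Int_closed inf.absorb_iff2)
qed

text \<open>A direction pointing into \<open>D\<close> exists because at most one active disk has a vertical tangent line;
  that disk fixes the sign of the first coordinate, and the other coordinates compensate.\<close>

lemma inward_vector:
  assumes p: "p \<in> C"
  obtains v where "\<forall>i\<ge>k. v i = 0"
    "\<And>m i. (m, i) \<in> Q \<Longrightarrow> f (m, i) p = 0 \<Longrightarrow>
       \<sigma> m * ((p 0 - cx m i) * v 0 + (p m - real i * H) * v m) > 0"
proof -
  define crit where "crit = (\<lambda>m i. (m, i) \<in> Q \<and> f (m, i) p = 0 \<and> p m = real i * H)"
  obtain v0 where v0: "\<And>m i. crit m i \<Longrightarrow> \<sigma> m * ((p 0 - cx m i) * v0) > 0"
  proof (cases "\<exists>m i. crit m i")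
    case True
    then obtain m i where mi: "crit m i" by blast
    have "\<sigma> m' * ((p 0 - cx m' i') * (\<sigma> m * (p 0 - cx m i))) > 0" if "crit m' i'" for m' i'
    proof -
      have "(m', i') = (m, i)" using critical_unique[OF p] that mi unfolding crit_def by blast
      moreover have "p 0 - cx m i \<noteq> 0" using critical_level(4)[OF p] mi unfolding crit_def by auto
      then have "0 < (\<sigma> m * \<sigma> m) * (p 0 - cx m i)\<^sup>2" unfolding \<sigma>_square by simp
      ultimately show ?thesis by (simp add: power2_eq_square mult_ac)
    qed
    then show thesis using that by blast
  qed (use that in blast)
  define \<iota> where "\<iota> = (\<lambda>m. SOME i. (m, i) \<in> Q \<and> f (m, i) p = 0)"
  \<comment> \<open>The coordinate \<open>m\<close> is chosen so that its contribution is
    \<open>1\<close> plus the absolute value of that of coordinate \<open>0\<close>; so it wins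
    whatever sign \<open>v0\<close> has.\<close>
  define v where "v = (\<lambda>m. if m = 0 then v0 else if m < k \<and> p m \<noteq> real (\<iota> m) * H then
      \<sigma> m * (1 + \<bar>(p 0 - cx m (\<iota> m)) * v0\<bar>) / (p m - real (\<iota> m) * H) else 0)"
  have pos: "0 < \<sigma> m * A + 1 * (1 + \<bar>A\<bar>)" for m A by (auto simp: \<sigma>_def)
  show thesis
  proof (rule that[of v])
    show "\<forall>i\<ge>k. v i = 0" by (simp add: v_def)
    fix m i assume mi: "(m, i) \<in> Q" "f (m, i) p = 0"
    have m: "m \<noteq> 0" "m < k" using mi(1) by (auto simp: Q_iff)
    have "(m, \<iota> m) \<in> Q \<and> f (m, \<iota> m) p = 0"
      unfolding \<iota>_def by (rule someI[of "\<lambda>i. (m, i) \<in> Q \<and> f (m, i) p = 0" i]) (use mi in simp)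
    then have \<iota>: "\<iota> m = i" using disk_unique[of m "\<iota> m" p i] mi(2) by simp
    show "\<sigma> m * ((p 0 - cx m i) * v 0 + (p m - real i * H) * v m) > 0"
    proof (cases "p m = real i * H")
      case True
      then have "crit m i" using mi by (simp add: crit_def)
      then show ?thesis using v0 True by (simp add: v_def)
    next
      case False
      let ?A = "(p 0 - cx m i) * v0"
      have "(p m - real i * H) * v m = \<sigma> m * (1 + \<bar>?A\<bar>)" using False m \<iota> by (simp add: v_def)
      then have "\<sigma> m * ((p 0 - cx m i) * v 0 + (p m - real i * H) * v m) = \<sigma> m * ?A + (\<sigma> m * \<sigma> m) * (1 + \<bar>?A\<bar>)"
        by (simp add: v_def distrib_left mult.assoc)
      also have "\<dots> > 0" unfolding \<sigma>_square by (rule pos)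
      finally show ?thesis .
    qed
  qed
qed

text \<open>From a point of \<open>C\<close>, a small step along \<open>inward_vector\<close> makes
  the vanishing \<open>f j\<close> positive by their derivative, while the other ones stay positive
  by continuity.\<close>

lemma closure_D: "Euclidean_space k closure_of D = C"
proof
  have "closedin (Euclidean_space k) C"
    unfolding Euclidean_E using closed_C by (intro closed_subset) (auto simp: C_def)
  then show "Euclidean_space k closure_of D \<subseteq> C" using D_subset_C by (intro closure_of_minimal)
  show "C \<subseteq> Euclidean_space k closure_of D"
  proof
    fix p assume p: "p \<in> C"
    then obtain v where v: "\<forall>i\<ge>k. v i = 0" "\<And>m i. (m, i) \<in> Q \<Longrightarrow> f (m, i) p = 0 \<Longrightarrow>
       \<sigma> m * ((p 0 - cx m i) * v 0 + (p m - real i * H) * v m) > 0" using inward_vector by blast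
    define \<gamma> where "\<gamma> = (\<lambda>u i. p i + u * v i)"
    have cont: "continuous_on UNIV \<gamma>"
      unfolding \<gamma>_def by (intro continuous_on_coordinatewise_then_product continuous_intros)
    then have "isCont \<gamma> 0" by (simp add: continuous_on_eq_continuous_at)
    then have "(\<gamma> \<longlongrightarrow> \<gamma> 0) (at 0)" by (simp add: isCont_def)
    then have "(\<gamma> \<longlongrightarrow> \<gamma> 0) (at_right 0)" by (rule tendsto_mono[rotated]) (rule at_le, simp)
    moreover have "\<gamma> 0 = p" by (simp add: \<gamma>_def)
    ultimately have lim: "(\<gamma> \<longlongrightarrow> p) (at_right 0)" by simp
    have E: "\<gamma> u \<in> E" for u using p v(1) by (auto simp: \<gamma>_def E_def C_def)
    have fpos: "eventually (\<lambda>u. f j (\<gamma> u) > 0) (at_right 0)" if j: "j \<in> Q" for j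
    proof (cases "f j p = 0")
      case False
      then have "f j p > 0" using p j by (auto simp: C_def less_le)
      moreover have "((\<lambda>u. f j (\<gamma> u)) \<longlongrightarrow> f j p) (at_right 0)"
      proof (rule isCont_tendsto_compose[OF _ lim])
        show "isCont (f j) p" using continuous_on_f[of UNIV j] by (simp add: continuous_on_eq_continuous_at)
      qed
      ultimately show ?thesis by (rule order_tendstoD(1)[rotated])
    next
      case True
      obtain m i where mi: "j = (m, i)" by (cases j)
      let ?g = "\<sigma> m * (2 * (p 0 - cx m i) * v 0 + 2 * (p m - real i * H) * v m)"
      have "((\<lambda>u. cyl_fun m (cx m i) (real i * H) R (\<gamma> u)) has_real_derivative
           2 * (\<gamma> 0 0 - cx m i) * v 0 + 2 * (\<gamma> 0 m - real i * H) * v m) (at 0)"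
        by (rule cyl_fun_curve_derivative) (auto simp: \<gamma>_def intro!: derivative_eq_intros)
      then have "((\<lambda>u. f j (\<gamma> u)) has_real_derivative ?g) (at 0)"
        unfolding f_def mi by (auto simp: \<gamma>_def intro!: derivative_eq_intros)
      moreover have "?g > 0" using v(2)[of m i] True j mi by (simp add: algebra_simps)
      ultimately obtain d where d: "d > 0" "\<And>h. 0 < h \<Longrightarrow> h < d \<Longrightarrow> f j (\<gamma> 0) < f j (\<gamma> (0 + h))"
        using DERIV_pos_inc_right by blast
      have "\<gamma> 0 = p" by (simp add: \<gamma>_def)
      then have "f j (\<gamma> h) > 0" if "h \<in> {0<..<d}" for h using d(2)[of h] that True by simp
      then show ?thesis using d(1) by (auto simp: eventually_at_right_field)
    qed
    have "eventually (\<lambda>u. \<forall>j\<in>Q. f j (\<gamma> u) > 0) (at_right 0)"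
      using fpos by (simp add: eventually_ball_finite_distrib finite_Q)
    moreover have "eventually (\<lambda>u. \<gamma> u \<in> U) (at_right 0)"
    proof -
      obtain T where T: "open T" "U = E \<inter> T" using openin_U unfolding Euclidean_E openin_open by blast
      then have "eventually (\<lambda>u. \<gamma> u \<in> T) (at_right 0)"
        using lim p C_subset_U by (intro topological_tendstoD[OF lim]) auto
      then show ?thesis by (rule eventually_mono) (use T E in auto)
    qed
    ultimately have ev: "eventually (\<lambda>u. \<gamma> u \<in> closure D) (at_right 0)"
      by (rule eventually_elim2) (rule subsetD[OF closure_subset], simp add: D_def)
    have "p \<in> closure D" by (rule Lim_in_closed_set[OF closed_closure ev _ lim]) simp
    then show "p \<in> Euclidean_space k closure_of D"
      unfolding Euclidean_E using p D_subset_C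
      by (auto simp: closure_of_subtopology C_def Int_absorb1 D_def U_def Collect_restrict inf.absorb2 subset_iff)
  qed
qed

section \<open>Components of the slices\<close>

definition line :: "(nat \<Rightarrow> real) \<Rightarrow> (nat \<Rightarrow> real) \<Rightarrow> real \<Rightarrow> nat \<Rightarrow> real" where
  "line p q u = (\<lambda>i. (1 - u) * p i + u * q i)"

lemma line_connected_component:
  assumes "\<And>u. u \<in> {0..1} \<Longrightarrow> line p q u \<in> A"
  shows "connected_component A p q"
proof -
  have "continuous_on {0..1} (line p q)"
    unfolding line_def by (intro continuous_on_coordinatewise_then_product continuous_intros)
  then have "topological_space_class.connected (line p q ` {0..1})" by (intro connected_continuous_image) auto
  moreover have "line p q 0 = p" "line p q 1 = q" by (auto simp: line_def)
  then have "p \<in> line p q ` {0..1}" "q \<in> line p q ` {0..1}" by (metis atLeastAtMost_iff imageI order.refl zero_le_one)+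
  ultimately show ?thesis unfolding connected_component_def using assms by blast
qed

text \<open>Moving between two points on the same side of a height \<open>z\<close> does not bring us closer to \<open>z\<close>
  than the nearer of the two.\<close>

lemma same_side_square:
  fixes x y z :: real
  assumes u: "u \<in> {0..1}" and side: "(z \<le> x \<and> z \<le> y) \<or> (x \<le> z \<and> y \<le> z)"
    and le: "A \<le> (x - z)\<^sup>2" "A \<le> (y - z)\<^sup>2"
  shows "A \<le> ((1 - u) * x + u * y - z)\<^sup>2"
proof -
  have *: "A \<le> ((1 - u) * x + u * y)\<^sup>2" if "0 \<le> x" "0 \<le> y" "A \<le> x\<^sup>2" "A \<le> y\<^sup>2" for x y :: real
  proof -
    have "min x y = (1 - u) * min x y + u * min x y" by (simp add: algebra_simps)
    also have "\<dots> \<le> (1 - u) * x + u * y"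
      using u by (intro add_mono mult_left_mono) auto
    finally have "(min x y)\<^sup>2 \<le> ((1 - u) * x + u * y)\<^sup>2" using that by (intro power_mono) auto
    moreover have "A \<le> (min x y)\<^sup>2" using that by (auto simp: min_def)
    ultimately show ?thesis by linarith
  qed
  from side show ?thesis
  proof
    assume "z \<le> x \<and> z \<le> y"
    then have "A \<le> ((1 - u) * (x - z) + u * (y - z))\<^sup>2" using le by (intro *) auto
    moreover have "(1 - u) * (x - z) + u * (y - z) = (1 - u) * x + u * y - z" by (simp add: algebra_simps)
    ultimately show ?thesis by simp
  next
    assume "x \<le> z \<and> y \<le> z"
    then have "A \<le> ((1 - u) * (z - x) + u * (z - y))\<^sup>2" using le by (intro *) (auto simp: power2_commute)
    moreover have "(1 - u) * (z - x) + u * (z - y) = - ((1 - u) * x + u * y - z)" by (simp add: algebra_simps)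
    ultimately show ?thesis by (simp only: power2_minus)
  qed
qed

lemma convex_square:
  fixes x y :: real
  assumes u: "u \<in> {0..1}" and le: "x\<^sup>2 \<le> A" "y\<^sup>2 \<le> A"
  shows "((1 - u) * x + u * y)\<^sup>2 \<le> A"
proof -
  have "\<bar>(1 - u) * x + u * y\<bar> \<le> (1 - u) * \<bar>x\<bar> + u * \<bar>y\<bar>"
    using u abs_triangle_ineq[of "(1 - u) * x" "u * y"] by (simp add: abs_mult)
  also have "\<dots> \<le> (1 - u) * max \<bar>x\<bar> \<bar>y\<bar> + u * max \<bar>x\<bar> \<bar>y\<bar>"
    using u by (intro add_mono mult_left_mono) auto
  also have "\<dots> = max \<bar>x\<bar> \<bar>y\<bar>" by (simp add: algebra_simps)
  finally have "\<bar>(1 - u) * x + u * y\<bar>\<^sup>2 \<le> (max \<bar>x\<bar> \<bar>y\<bar>)\<^sup>2" by (intro power_mono) auto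
  moreover have "(max \<bar>x\<bar> \<bar>y\<bar>)\<^sup>2 \<le> A" using le by (auto simp: max_def)
  ultimately show ?thesis by simp
qed

lemma line_const: "p i = q i \<Longrightarrow> line p q u i = p i"
  by (simp add: line_def algebra_simps)

lemma line_E: "p \<in> E \<Longrightarrow> q \<in> E \<Longrightarrow> line p q u \<in> E"
  by (auto simp: E_def line_def)

lemma line_between:
  assumes "u \<in> {0..1}" "x \<le> p i" "x \<le> q i"
  shows "x \<le> line p q u i"
proof -
  have "x = (1 - u) * x + u * x" by (simp add: algebra_simps)
  also have "\<dots> \<le> line p q u i" unfolding line_def using assms by (intro add_mono mult_left_mono) auto
  finally show ?thesis .
qed

lemma line_between':
  assumes "u \<in> {0..1}" "p i \<le> x" "q i \<le> x"
  shows "line p q u i \<le> x"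
proof -
  have "line p q u i \<le> (1 - u) * x + u * x" unfolding line_def using assms by (intro add_mono mult_left_mono) auto
  also have "\<dots> = x" by (simp add: algebra_simps)
  finally show ?thesis .
qed

text \<open>Over a fixed first coordinate, a disk to be avoided removes an interval around its
  centre height or nothing at all, while a confining disk leaves an interval. Only the first case
  constrains the segment: its ends must be on the same side of the centre.\<close>

lemma line_f_nonneg:
  assumes p: "p \<in> C" and q: "q \<in> C" and x: "p 0 = q 0" and u: "u \<in> {0..1}" and j: "(m, i) \<in> Q"
    and side: "m \<in> {1..e} \<Longrightarrow> (p 0 - cx m i)\<^sup>2 < R\<^sup>2 \<Longrightarrow>
        (real i * H \<le> p m \<and> real i * H \<le> q m) \<or> (p m \<le> real i * H \<and> q m \<le> real i * H)"
  shows "f (m, i) (line p q u) \<ge> 0"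
proof -
  have x': "line p q u 0 = p 0" using x by (rule line_const)
  have fp: "f (m, i) p \<ge> 0" "f (m, i) q \<ge> 0" using p q j by (auto simp: C_def)
  show ?thesis using j
  proof (cases rule: Q_cases)
    case 1
    have m: "m \<le> e" using 1 by simp
    show ?thesis
    proof (cases "(p 0 - cx m i)\<^sup>2 < R\<^sup>2")
      case True
      have "R\<^sup>2 - (p 0 - cx m i)\<^sup>2 \<le> ((1 - u) * p m + u * q m - real i * H)\<^sup>2"
        using fp x side[OF 1(1) True] by (intro same_side_square[OF u]) (auto simp: f_le[OF m])
      then show ?thesis unfolding f_le[OF m] x' by (simp add: line_def)
    next
      case False
      then show ?thesis unfolding f_le[OF m] x' using zero_le_power2[of "line p q u m - real i * H"] by linarith
    qed
  next
    case 2
    have "((1 - u) * p (e + 1) + u * q (e + 1))\<^sup>2 \<le> R\<^sup>2 - (p 0 - a - R)\<^sup>2"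
      using fp x unfolding 2 f_end1 by (intro convex_square[OF u]) auto
    then show ?thesis unfolding 2 f_end1 x' by (simp add: line_def)
  next
    case 3
    have "((1 - u) * p (e + 2) + u * q (e + 2))\<^sup>2 \<le> R\<^sup>2 - (p 0 - b + R)\<^sup>2"
      using fp x unfolding 3 f_end2 by (intro convex_square[OF u]) auto
    then show ?thesis unfolding 3 f_end2 x' by (simp add: line_def)
  qed
qed

text \<open>Whether the inner disk \<open>i\<close> of plane \<open>m\<close> removes an open
  interval from the slice over \<open>x\<close>, phrased by the order of \<open>x\<close> and
  \<open>s m\<close> so that it can be compared with the digits that count over \<open>x\<close>. At
  \<open>x = s m\<close> itself no disk of the plane is active.\<close>

definition active :: "nat \<Rightarrow> nat \<Rightarrow> real \<Rightarrow> bool" where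
  "active m i x \<longleftrightarrow> 0 < i \<and> i < N m \<and> (if right m i then s m < x else x < s m)"

definition same_side :: "(nat \<Rightarrow> real) \<Rightarrow> (nat \<Rightarrow> real) \<Rightarrow> bool" where
  "same_side p q \<longleftrightarrow> (\<forall>m\<in>{1..e}. \<forall>i. active m i (p 0) \<longrightarrow> (real i * H < p m \<longleftrightarrow> real i * H < q m))"

lemma inner_cx:
  assumes "m \<in> {1..e}" "0 < i" "i < N m"
  shows "cx m i = (if right m i then s m + R else s m - R)"
  using assms by (auto simp: cx_def)

text \<open>The open disk covers the \<open>x\<close> within \<open>2 * R\<close> of
  \<open>s m\<close> on its own side, and all of \<open>[a, b]\<close> on that side is nearer than
  that.\<close>

lemma active_iff:
  assumes "m \<in> {1..e}" "0 < i" "i < N m" "a \<le> x" "x \<le> b"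
  shows "active m i x \<longleftrightarrow> (x - cx m i)\<^sup>2 < R\<^sup>2"
proof -
  have "N m \<ge> 2" using assms by auto
  then have s: "a < s m" "s m < b" using s_in assms(1) by auto
  have "(x - cx m i)\<^sup>2 < R\<^sup>2 \<longleftrightarrow> \<bar>x - cx m i\<bar> < R"
    using R_pos abs_less_square_iff[of "x - cx m i" R] by simp
  also have "\<dots> \<longleftrightarrow> active m i x"
    unfolding inner_cx[OF assms(1-3)] active_def using assms s R_gt by (auto simp: abs_less_iff)
  finally show ?thesis by simp
qed

lemma active_neq:
  assumes p: "p \<in> C" and m: "m \<in> {1..e}" and act: "active m i (p 0)"
  shows "p m \<noteq> real i * H"
proof
  assume eq: "p m = real i * H"
  have i: "0 < i" "i < N m" using act by (auto simp: active_def)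
  have "(p 0 - cx m i)\<^sup>2 < R\<^sup>2" using active_iff[OF m i in_C_x[OF p]] act by simp
  moreover have "f (m, i) p \<ge> 0" using p m i by (auto simp: C_def Q_iff)
  ultimately show False using m eq by (simp add: f_le)
qed

lemma line_in_C:
  assumes p: "p \<in> C" and q: "q \<in> C" and x: "p 0 = q 0" and ss: "same_side p q" and u: "u \<in> {0..1}"
  shows "line p q u \<in> C"
proof -
  have "f (m, i) (line p q u) \<ge> 0" if j: "(m, i) \<in> Q" for m i
  proof (rule line_f_nonneg[OF p q x u j])
    assume m: "m \<in> {1..e}" and lt: "(p 0 - cx m i)\<^sup>2 < R\<^sup>2"
    have iN: "i \<le> N m" using j by (simp add: Q_iff)
    have U: "0 < p m" "0 < q m" "p m < real (N m) * H" "q m < real (N m) * H"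
      using p q C_subset_U m by (auto simp: U_def)
    consider "i = 0" | "i = N m" | "0 < i" "i < N m" using iN by linarith
    then show "(real i * H \<le> p m \<and> real i * H \<le> q m) \<or> (p m \<le> real i * H \<and> q m \<le> real i * H)"
    proof cases
      case 3
      then have "active m i (p 0)" using active_iff[OF m 3 in_C_x[OF p]] lt by simp
      then have "real i * H < p m \<longleftrightarrow> real i * H < q m" using ss m by (auto simp: same_side_def)
      then show ?thesis by linarith
    qed (use U in auto)
  qed
  moreover have "0 \<le> line p q u m \<and> line p q u m \<le> real (N m) * H" if "m \<in> {1..e}" for m
    using that p q u by (intro conjI line_between line_between') (auto simp: C_def)
  moreover have "line p q u \<in> E" using p q by (intro line_E) (auto simp: C_def)
  ultimately show ?thesis unfolding C_def by auto
qed

text \<open>By the intermediate value theorem a connected subset of the slice cannot cross the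
  centre height of an active disk; conversely the segment between two points on the same side of all
  active disks stays in the slice.\<close>

lemma Reeb_class_eq:
  assumes p: "p \<in> C"
  shows "Reeb_class k D p = {q \<in> C. q 0 = p 0 \<and> same_side p q}"
proof -
  let ?L = "{x \<in> C. x 0 = p 0}"
  have L: "subtopology (Euclidean_space k) ?L = top_of_set ?L"
  proof -
    have "E \<inter> ?L = ?L" by (auto simp: C_def)
    then show ?thesis unfolding Euclidean_E subtopology_subtopology by simp
  qed
  have "Reeb_class k D p = connected_component_set ?L p"
    unfolding Reeb_class_def closure_D L
  proof (intro equalityI subsetI)
    fix q
    show "q \<in> connected_component_of_set (top_of_set ?L) p \<Longrightarrow> q \<in> connected_component_set ?L p"
      unfolding mem_Collect_eq connected_component_of_def connected_component_def
        connectedin_subtopology connectedin_iff_connected by blast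
    show "q \<in> connected_component_set ?L p \<Longrightarrow> q \<in> connected_component_of_set (top_of_set ?L) p"
      unfolding mem_Collect_eq connected_component_of_def connected_component_def
        connectedin_subtopology connectedin_iff_connected by blast
  qed
  also have "\<dots> = {q \<in> C. q 0 = p 0 \<and> same_side p q}"
  proof (intro equalityI subsetI)
    fix q assume "q \<in> connected_component_set ?L p"
    then obtain T where T: "topological_space_class.connected T" "T \<subseteq> ?L" "p \<in> T" "q \<in> T"
      unfolding connected_component_def by blast
    have "real i * H < p m \<longleftrightarrow> real i * H < q m" if m: "m \<in> {1..e}" and act: "active m i (p 0)" for m i
    proof (rule ccontr)
      assume neq: "\<not> (real i * H < p m \<longleftrightarrow> real i * H < q m)"
      have "topological_space_class.connected ((\<lambda>r. r m) ` T)" using T(1) by (intro connected_continuous_image continuous_on_coord)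
      moreover have "p m \<in> (\<lambda>r. r m) ` T" "q m \<in> (\<lambda>r. r m) ` T" using T by auto
      moreover have "(p m \<le> real i * H \<and> real i * H \<le> q m) \<or> (q m \<le> real i * H \<and> real i * H \<le> p m)"
        using neq by auto
      ultimately have "real i * H \<in> (\<lambda>r. r m) ` T" unfolding connected_iff_interval by blast
      then obtain r where "r \<in> T" "r m = real i * H" by auto
      then show False using active_neq[of r m i] m act T(2) by auto
    qed
    then show "q \<in> {q \<in> C. q 0 = p 0 \<and> same_side p q}" using T by (auto simp: same_side_def)
  next
    fix q assume q: "q \<in> {q \<in> C. q 0 = p 0 \<and> same_side p q}"
    have "connected_component ?L p q"
    proof (rule line_connected_component)
      fix u :: real assume u: "u \<in> {0..1}"
      have "line p q u \<in> C" using q by (intro line_in_C p u) auto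
      moreover have "line p q u 0 = p 0" using q by (intro line_const) auto
      ultimately show "line p q u \<in> ?L" by simp
    qed
    then show "q \<in> connected_component_set ?L p" by simp
  qed
  finally show ?thesis .
qed

section \<open>Midpoints of the parts of a stack and connectedness of the region\<close>

definition ctr :: "(nat \<Rightarrow> nat) \<Rightarrow> real \<Rightarrow> nat \<Rightarrow> real" where
  "ctr w x = (\<lambda>i. if i = 0 then x else if i \<in> {1..e} then (real (w i) + 1/2) * H else 0)"

definition cells_ok :: "(nat \<Rightarrow> nat) \<Rightarrow> bool" where
  "cells_ok w \<longleftrightarrow> (\<forall>m\<in>{1..e}. w m < N m)"

text \<open>The distance is at least \<open>H / 2 = 3/2 * R\<close>. For \<open>y = w + 1/2\<close>
  this keeps the points \<open>ctr\<close> clear of all disks over every \<open>x\<close>; letting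
  \<open>y\<close> move away from the disk serves the crossing in \<open>ctr_step\<close>.\<close>

lemma half_far:
  fixes w i :: nat
  assumes "real w + 1/2 \<le> y \<and> i \<le> w \<or> y \<le> real w + 1/2 \<and> w < i"
  shows "R\<^sup>2 < (y * H - real i * H)\<^sup>2"
proof -
  have "1/2 \<le> \<bar>y - real i\<bar>" using assms by auto
  then have "1/2 * H \<le> \<bar>y - real i\<bar> * H" using H_pos by (intro mult_right_mono) auto
  also have "\<dots> = \<bar>y * H - real i * H\<bar>" using H_pos by (simp add: abs_mult flip: left_diff_distrib)
  finally have "\<bar>R\<bar> < \<bar>y * H - real i * H\<bar>" using R_pos by (simp add: H_def)
  then show ?thesis by (simp only: abs_less_square_iff)
qed

lemma ctr_E: "ctr w x \<in> E" by (auto simp: ctr_def E_def)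

lemma end_disk_pos:
  assumes "a < x" "x < b"
  shows "(x - a - R)\<^sup>2 < R\<^sup>2" "(x - b + R)\<^sup>2 < R\<^sup>2"
proof -
  have "\<bar>x - a - R\<bar> < R" "\<bar>x - b + R\<bar> < R" using assms R_gt by auto
  then show "(x - a - R)\<^sup>2 < R\<^sup>2" "(x - b + R)\<^sup>2 < R\<^sup>2" by (blast intro: small_square)+
qed

lemma ctr_bounds:
  assumes "cells_ok w" "m \<in> {1..e}"
  shows "0 < ctr w x m" "ctr w x m < real (N m) * H"
proof -
  have "m \<noteq> 0" "w m < N m" using assms by (auto simp: cells_ok_def)
  then have w: "real (w m) + 1/2 < real (N m)" by linarith
  have c: "ctr w x m = (real (w m) + 1/2) * H" using assms(2) by (simp add: ctr_def)
  show "0 < ctr w x m" unfolding c using H_pos by simp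
  show "ctr w x m < real (N m) * H" unfolding c using H_pos w by (rule mult_strict_right_mono[rotated])
qed

lemma f_ctr:
  assumes "m \<in> {1..e}"
  shows "0 < f (m, i) (ctr w x)"
proof -
  have "R\<^sup>2 < ((real (w m) + 1/2) * H - real i * H)\<^sup>2" by (rule half_far[of "w m"]) auto
  then have "R\<^sup>2 < (ctr w x m - real i * H)\<^sup>2" using assms by (simp add: ctr_def)
  moreover have "m \<le> e" using assms by simp
  ultimately show ?thesis using zero_le_power2[of "ctr w x 0 - cx m i"] by (simp only: f_le)
qed

lemma ctr_in_D:
  assumes w: "cells_ok w" and x: "a < x" "x < b"
  shows "ctr w x \<in> D"
proof -
  have "0 < f (m, i) (ctr w x)" if "(m, i) \<in> Q" for m i
    using that
  proof (cases rule: Q_cases)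
    case 1
    then show ?thesis by (intro f_ctr)
  next
    case 2
    then show ?thesis unfolding 2 f_end1 using end_disk_pos(1)[OF x] by (simp add: ctr_def)
  next
    case 3
    then show ?thesis unfolding 3 f_end2 using end_disk_pos(2)[OF x] by (simp add: ctr_def)
  qed
  then show ?thesis using ctr_bounds[OF w] ctr_E by (auto simp: D_def U_def)
qed

lemma ctr_in_C:
  assumes w: "cells_ok w" and x: "a \<le> x" "x \<le> b"
  shows "ctr w x \<in> C"
proof -
  have "0 \<le> f (m, i) (ctr w x)" if "(m, i) \<in> Q" for m i
    using that
  proof (cases rule: Q_cases)
    case 1
    then show ?thesis by (intro less_imp_le f_ctr)
  next
    case 2
    have "\<bar>x - a - R\<bar> \<le> \<bar>R\<bar>" using x R_gt ab by auto
    then have "(x - a - R)\<^sup>2 \<le> R\<^sup>2" by (simp only: abs_le_square_iff)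
    then show ?thesis unfolding 2 f_end1 by (simp add: ctr_def)
  next
    case 3
    have "\<bar>x - b + R\<bar> \<le> \<bar>R\<bar>" using x R_gt ab by auto
    then have "(x - b + R)\<^sup>2 \<le> R\<^sup>2" by (simp only: abs_le_square_iff)
    then show ?thesis unfolding 3 f_end2 by (simp add: ctr_def)
  qed
  then show ?thesis using ctr_bounds[OF w] ctr_E by (auto simp: C_def less_imp_le)
qed

definition cell :: "(nat \<Rightarrow> real) \<Rightarrow> nat \<Rightarrow> nat" where
  "cell p m = nat \<lfloor>p m / H\<rfloor>"

lemma cell:
  assumes p: "p \<in> U" and m: "m \<in> {1..e}"
  shows "real (cell p m) * H \<le> p m" "p m < (real (cell p m) + 1) * H" "cell p m < N m"
proof -
  have pm: "0 < p m" "p m < real (N m) * H" using p m by (auto simp: U_def)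
  have 0: "0 \<le> p m / H" using pm H_pos by simp
  then have r: "real (cell p m) = of_int \<lfloor>p m / H\<rfloor>" by (simp add: cell_def)
  have "real (cell p m) \<le> p m / H" "p m / H < real (cell p m) + 1" unfolding r by linarith+
  then show 1: "real (cell p m) * H \<le> p m" "p m < (real (cell p m) + 1) * H"
    using H_pos by (auto simp: field_simps)
  have "real (cell p m) * H < real (N m) * H" using 1(1) pm(2) by linarith
  then show "cell p m < N m" using H_pos by simp
qed

text \<open>The strict counterpart of \<open>line_in_C\<close>: a point and the midpoint of its part
  lie on the same side of every centre of the stack, whether the disk is active or not.\<close>

lemma D_to_ctr:
  assumes p: "p \<in> D"
  shows "connected_component D p (ctr (cell p) (p 0))"
proof (rule line_connected_component)
  fix u :: real assume u: "u \<in> {0..1}"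
  have pU: "p \<in> U" and pC: "p \<in> C" using p D_subset_C by (auto simp: D_def)
  have w: "cells_ok (cell p)" using cell(3)[OF pU] by (auto simp: cells_ok_def)
  let ?q = "ctr (cell p) (p 0)"
  have x: "line p ?q u 0 = p 0" by (rule line_const) (simp add: ctr_def)
  have "0 < f (m, i) (line p ?q u)" if j: "(m, i) \<in> Q" for m i
    using j
  proof (cases rule: Q_cases)
    case 1
    have m: "m \<le> e" "m \<noteq> 0" using 1 by auto
    have fp: "0 < f (m, i) p" using p j by (auto simp: D_def)
    define A where "A = min ((p m - real i * H)\<^sup>2) ((?q m - real i * H)\<^sup>2)"
    have qm: "?q m = (real (cell p m) + 1/2) * H" using 1 by (simp add: ctr_def)
    have qf: "R\<^sup>2 < (?q m - real i * H)\<^sup>2" unfolding qm by (rule half_far[of "cell p m"]) auto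
    have side: "(real i * H \<le> p m \<and> real i * H \<le> ?q m) \<or> (p m \<le> real i * H \<and> ?q m \<le> real i * H)"
    proof (cases "i \<le> cell p m")
      case True
      then have h: "real i * H \<le> real (cell p m) * H" using H_pos by simp
      have "real i * H \<le> p m" using h cell(1)[OF pU 1(1)] by linarith
      moreover have "real i * H \<le> ?q m" unfolding qm distrib_right using h H_pos by linarith
      ultimately show ?thesis by blast
    next
      case False
      then have "real (cell p m) + 1 \<le> real i" by linarith
      then have h: "(real (cell p m) + 1) * H \<le> real i * H" using H_pos by simp
      have "p m \<le> real i * H" using h cell(2)[OF pU 1(1)] by linarith
      moreover have "?q m \<le> real i * H" using h H_pos unfolding qm distrib_right by linarith
      ultimately show ?thesis by blast
    qed
    have "A \<le> ((1 - u) * p m + u * ?q m - real i * H)\<^sup>2"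
      by (rule same_side_square[OF u side]) (auto simp: A_def)
    moreover have "R\<^sup>2 - (p 0 - cx m i)\<^sup>2 < (p m - real i * H)\<^sup>2"
      using fp unfolding f_le[OF m(1)] by linarith
    moreover have "R\<^sup>2 - (p 0 - cx m i)\<^sup>2 < (?q m - real i * H)\<^sup>2"
      using qf zero_le_power2[of "p 0 - cx m i"] by linarith
    ultimately have "R\<^sup>2 - (p 0 - cx m i)\<^sup>2 < ((1 - u) * p m + u * ?q m - real i * H)\<^sup>2"
      unfolding A_def by linarith
    moreover have "line p ?q u m = (1 - u) * p m + u * ?q m" by (simp add: line_def)
    ultimately show ?thesis unfolding f_le[OF m(1)] x by simp
  next
    case 2
    have fp: "0 < f (e + 1, 0) p" using p j 2 by (auto simp: D_def)
    have "((1 - u) * p (e + 1) + u * ?q (e + 1))\<^sup>2 \<le> (p (e + 1))\<^sup>2"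
      by (rule convex_square[OF u]) (auto simp: ctr_def)
    then show ?thesis using fp unfolding 2 f_end1 x by (simp add: line_def)
  next
    case 3
    have fp: "0 < f (e + 2, 0) p" using p j 3 by (auto simp: D_def)
    have "((1 - u) * p (e + 2) + u * ?q (e + 2))\<^sup>2 \<le> (p (e + 2))\<^sup>2"
      by (rule convex_square[OF u]) (auto simp: ctr_def)
    then show ?thesis using fp unfolding 3 f_end2 x by (simp add: line_def)
  qed
  moreover have "0 < line p ?q u m \<and> line p ?q u m < real (N m) * H" if m: "m \<in> {1..e}" for m
  proof -
    have pm: "0 < p m" "p m < real (N m) * H" using pU m by (auto simp: U_def)
    note qm = ctr_bounds[OF w m, of "p 0"]
    have "min (p m) (?q m) \<le> line p ?q u m" by (rule line_between[OF u]) auto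
    moreover have "line p ?q u m \<le> max (p m) (?q m)" by (rule line_between'[OF u]) auto
    ultimately show ?thesis using pm qm by linarith
  qed
  moreover have "line p ?q u \<in> E" using pC ctr_E by (intro line_E) (auto simp: C_def)
  ultimately show "line p ?q u \<in> D" unfolding D_def U_def by auto
qed

lemma ctr_shift:
  assumes w: "cells_ok w" and x: "a < x" "x < b" and y: "a < y" "y < b"
  shows "connected_component D (ctr w x) (ctr w y)"
proof (rule line_connected_component)
  fix u :: real assume u: "u \<in> {0..1}"
  have eq: "line (ctr w x) (ctr w y) u = ctr w ((1 - u) * x + u * y)"
    by (auto simp: line_def ctr_def algebra_simps)
  have "min x y \<le> (1 - u) * x + u * y" "(1 - u) * x + u * y \<le> max x y"
    using line_between[OF u, of "min x y" "\<lambda>_. x" 0 "\<lambda>_. y"]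
      line_between'[OF u, of "\<lambda>_. x" 0 "max x y" "\<lambda>_. y"] by (auto simp: line_def)
  then show "line (ctr w x) (ctr w y) u \<in> D"
    unfolding eq using x y by (intro ctr_in_D[OF w]) auto
qed

text \<open>Every inner disk leaves one side of its level free, and there the two neighbouring parts
  of the stack communicate.\<close>

lemma ctr_step:
  assumes w: "cells_ok w" and m: "m \<in> {1..e}" and Sw: "Suc (w m) < N m"
  shows "\<exists>x. a < x \<and> x < b \<and> connected_component D (ctr w x) (ctr (w(m := Suc (w m))) x)"
proof -
  let ?w = "w(m := Suc (w m))" and ?i = "Suc (w m)"
  have s: "a < s m" "s m < b" using s_in[OF m] Sw by auto
  \<comment> \<open>Half-way between \<open>s m\<close> and the end of the range on the side away
    from the disk to be crossed; strictly off the level, because the segment has to stay in the open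
    region.\<close>
  define x where "x = (if right m ?i then (a + s m) / 2 else (s m + b) / 2)"
  have x: "a < x" "x < b" using s by (auto simp: x_def)
  have w': "cells_ok ?w" using w Sw by (auto simp: cells_ok_def)
  have "\<not> active m ?i x" using s by (auto simp: active_def x_def)
  then have na: "R\<^sup>2 \<le> (x - cx m ?i)\<^sup>2" using active_iff[OF m, of ?i x] Sw x by auto
  have strict: "R\<^sup>2 < (x - cx m ?i)\<^sup>2"
  proof -
    have "R < \<bar>x - cx m ?i\<bar>"
    proof (cases "right m ?i")
      case True
      then have "x < s m" "cx m ?i = s m + R" using inner_cx[OF m, of ?i] Sw s by (auto simp: x_def)
      then show ?thesis by linarith
    next
      case False
      then have "s m < x" "cx m ?i = s m - R" using inner_cx[OF m, of ?i] Sw s by (auto simp: x_def)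
      then show ?thesis by linarith
    qed
    then show ?thesis using R_pos abs_less_square_iff[of R "x - cx m ?i"] by simp
  qed
  have "connected_component D (ctr w x) (ctr ?w x)"
  proof (rule line_connected_component)
    fix u :: real assume u: "u \<in> {0..1}"
    let ?l = "line (ctr w x) (ctr ?w x) u"
    have other: "?l i = ctr w x i" if "i \<noteq> m" for i by (rule line_const) (use that in \<open>auto simp: ctr_def\<close>)
    have lm: "?l m = (real (w m) + 1/2 + u) * H" using m by (simp add: line_def ctr_def algebra_simps)
    have l0: "?l 0 = x" using m other[of 0] by (auto simp: ctr_def)
    have "0 < f (m', i) ?l" if j: "(m', i) \<in> Q" for m' i
    proof (cases "m' = m")
      case True
      have me: "m \<le> e" using m by simp
      show ?thesis
      proof (cases "i = ?i")
        case True
        then show ?thesis using strict zero_le_power2[of "?l m - real i * H"]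
          unfolding \<open>m' = m\<close> f_le[OF me] l0 True by linarith
      next
        case False
        \<comment> \<open>The segment crosses the centre height of the disk \<open>Suc (w m)\<close>
          only; from all other centres of the stack it keeps the distance
          \<open>H / 2\<close>.\<close>
        have "R\<^sup>2 < ((real (w m) + 1/2 + u) * H - real i * H)\<^sup>2"
        proof (cases "i \<le> w m")
          case True
          then show ?thesis using u by (intro half_far[of "w m"]) auto
        next
          case False
          then have "?i < i" using \<open>i \<noteq> ?i\<close> by simp
          then show ?thesis using u by (intro half_far[of ?i]) auto
        qed
        then show ?thesis using zero_le_power2[of "x - cx m i"]
          unfolding \<open>m' = m\<close> f_le[OF me] l0 lm by linarith
      qed
    next
      case False
      have "m' \<noteq> 0" "m \<noteq> 0" using j m by (auto simp: Q_iff)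
      then have "f (m', i) ?l = f (m', i) (ctr w x)"
        using other[OF False] other[of 0] by (simp add: f_def cyl_fun_def)
      then show ?thesis using ctr_in_D[OF w x] j by (auto simp: D_def)
    qed
    moreover have "0 < ?l i \<and> ?l i < real (N i) * H" if i: "i \<in> {1..e}" for i
    proof -
      note b1 = ctr_bounds[OF w i, of x] and b2 = ctr_bounds[OF w' i, of x]
      have "min (ctr w x i) (ctr ?w x i) \<le> ?l i" by (rule line_between[OF u]) auto
      moreover have "?l i \<le> max (ctr w x i) (ctr ?w x i)" by (rule line_between'[OF u]) auto
      ultimately show ?thesis using b1 b2 by linarith
    qed
    moreover have "?l \<in> E" by (intro line_E ctr_E)
    ultimately show "?l \<in> D" unfolding D_def U_def by auto
  qed
  then show ?thesis using x by blast
qed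

text \<open>The indices are lowered one at a time; each time \<open>x\<close> is shifted to where
  the disk in between can be passed, and back again.\<close>

lemma ctr_connected:
  assumes "cells_ok w" "a < x" "x < b"
  shows "connected_component D (ctr w x) (ctr (\<lambda>_. 0) x)"
  using assms(1)
proof (induction "\<Sum>m\<in>{1..e}. w m" arbitrary: w)
  case 0
  then have "ctr w x = ctr (\<lambda>_. 0) x" by (auto simp: ctr_def)
  then show ?case using ctr_in_D[OF 0(2) assms(2,3)] by (simp add: connected_component_refl)
next
  case (Suc c)
  then obtain m where m: "m \<in> {1..e}" "w m \<noteq> 0" by (metis sum.neutral nat.distinct(1))
  then obtain z where z: "w m = Suc z" by (cases "w m") auto
  have wm: "w m < N m" using Suc(3) m(1) unfolding cells_ok_def by blast
  define w' where "w' = w(m := z)"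
  have w: "w = w'(m := Suc (w' m))" using z by (auto simp: w'_def)
  have ok: "cells_ok w'" using Suc(3) z wm by (auto simp: cells_ok_def w'_def)
  have "(\<Sum>i\<in>{1..e}. w i) = w m + (\<Sum>i\<in>{1..e} - {m}. w i)" using m by (intro sum.remove) auto
  moreover have "(\<Sum>i\<in>{1..e}. w' i) = w' m + (\<Sum>i\<in>{1..e} - {m}. w' i)" using m by (intro sum.remove) auto
  moreover have "(\<Sum>i\<in>{1..e} - {m}. w' i) = (\<Sum>i\<in>{1..e} - {m}. w i)"
    by (intro sum.cong) (auto simp: w'_def)
  ultimately have "c = (\<Sum>i\<in>{1..e}. w' i)" using Suc(2) z by (simp add: w'_def)
  then have 1: "connected_component D (ctr w' x) (ctr (\<lambda>_. 0) x)" using Suc(1) ok by blast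
  have "Suc (w' m) < N m" using wm z by (simp add: w'_def)
  then obtain y where y: "a < y" "y < b" "connected_component D (ctr w' y) (ctr w y)"
    using ctr_step[OF ok m(1)] w by metis
  have "connected_component D (ctr w x) (ctr w y)" by (rule ctr_shift[OF Suc(3) assms(2,3) y(1,2)])
  moreover have "connected_component D (ctr w y) (ctr w' y)" using y(3) by (rule connected_component_sym)
  moreover have "connected_component D (ctr w' y) (ctr w' x)" by (rule ctr_shift[OF ok y(1,2) assms(2,3)])
  ultimately show ?case using 1 by (meson connected_component_trans)
qed

lemma cells_ok_zero: "cells_ok (\<lambda>_. 0)" using N_pos by (force simp: cells_ok_def)

lemma D_nonempty: "D \<noteq> {}"
  using ctr_in_D[OF cells_ok_zero, of "(a + b) / 2"] ab by auto

lemma connected_D: "topological_space_class.connected D"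
proof -
  let ?x = "(a + b) / 2"
  have x: "a < ?x" "?x < b" using ab by auto
  have base: "connected_component D p (ctr (\<lambda>_. 0) ?x)" if p: "p \<in> D" for p
  proof -
    have pU: "p \<in> U" and pC: "p \<in> C" using p D_subset_C by (auto simp: D_def)
    have w: "cells_ok (cell p)" using cell(3)[OF pU] by (auto simp: cells_ok_def)
    have "0 < f (e + 1, 0) p" "0 < f (e + 2, 0) p" using p by (auto simp: D_def Q_iff)
    then have "p 0 \<noteq> a" "p 0 \<noteq> b"
      using zero_le_power2[of "p (e + 1)"] zero_le_power2[of "p (e + 2)"] unfolding f_end1 f_end2 by auto
    then have px: "a < p 0" "p 0 < b" using in_C_x[OF pC] by auto
    show ?thesis using D_to_ctr[OF p] ctr_connected[OF w px] ctr_shift[OF cells_ok_zero px x]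
      by (meson connected_component_trans)
  qed
  show ?thesis unfolding connected_iff_connected_component
    using base by (meson connected_component_sym connected_component_trans)
qed

end

lemma eventually_ball_gt:
  fixes g :: "'b \<Rightarrow> real \<Rightarrow> real"
  assumes "finite A" "\<And>x. x \<in> A \<Longrightarrow> isCont (g x) 0" "\<And>x. x \<in> A \<Longrightarrow> c < g x 0"
  shows "eventually (\<lambda>u. \<forall>x\<in>A. c < g x u) (nhds 0)"
proof -
  have "eventually (\<lambda>u. c < g x u) (nhds 0)" if x: "x \<in> A" for x
  proof -
    have "(g x \<longlongrightarrow> g x 0) (nhds 0)"
      using assms(2)[OF x] unfolding isCont_def tendsto_at_iff_tendsto_nhds .
    then show ?thesis using assms(3)[OF x] by (rule order_tendstoD(1))
  qed
  then show ?thesis by (simp add: eventually_ball_finite_distrib[OF assms(1)])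
qed

lemma DERIV_circle_arc:
  fixes x c b h r u :: real
  assumes "0 < r - (x + u - c)\<^sup>2"
  shows "((\<lambda>u. b + h * sqrt (r - (x + u - c)\<^sup>2)) has_real_derivative
          h * (- (x + u - c) / sqrt (r - (x + u - c)\<^sup>2))) (at u)"
proof -
  have L: "((\<lambda>u. x + u - c) has_real_derivative 1 + 0) (at u)"
    using DERIV_add[OF DERIV_ident DERIV_const[of "x - c"]] by (simp add: algebra_simps)
  have g: "((\<lambda>u. r - (x + u - c)\<^sup>2) has_real_derivative - (2 * (x + u - c))) (at u)"
    using DERIV_diff[OF DERIV_const[of r] DERIV_power[OF L, of 2]] by simp
  have "((\<lambda>u. sqrt (r - (x + u - c)\<^sup>2)) has_real_derivative
      inverse (sqrt (r - (x + u - c)\<^sup>2)) / 2 * - (2 * (x + u - c))) (at u)"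
    by (rule DERIV_chain2[where f = sqrt and g = "\<lambda>u. r - (x + u - c)\<^sup>2" and x = u,
          OF DERIV_real_sqrt[OF assms] g])
  note D = DERIV_add[OF DERIV_const[of b] DERIV_cmult[OF this, of h]]
  have alg: "0 + h * (inverse q / 2 * - (2 * z)) = h * (- z / q)" for q z :: real
    by (cases "q = 0") (simp_all add: field_simps)
  show ?thesis using D unfolding alg .
qed

section \<open>Boundary points, transversality and the RA-region property\<close>

context arrangement
begin

lemma C_upd:
  assumes p: "p \<in> C" and m: "m \<in> {1..e}" and y: "0 \<le> y" "y \<le> real (N m) * H"
    and far: "\<And>i. i \<le> N m \<Longrightarrow> R\<^sup>2 \<le> (p 0 - cx m i)\<^sup>2 + (y - real i * H)\<^sup>2"
  shows "p(m := y) \<in> C"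
proof -
  have m0: "m \<noteq> 0" "m \<le> e" using m by auto
  have "0 \<le> f (m', i) (p(m := y))" if j: "(m', i) \<in> Q" for m' i
  proof (cases "m' = m")
    case True
    then show ?thesis using far[of i] j m0 by (simp add: f_le Q_iff)
  next
    case False
    then have "f (m', i) (p(m := y)) = f (m', i) p" using m0 by (simp add: f_def cyl_fun_def)
    then show ?thesis using p j by (auto simp: C_def)
  qed
  moreover have "p(m := y) \<in> E" using p m by (auto simp: C_def E_def)
  ultimately show ?thesis using p y by (auto simp: C_def)
qed

lemma multiple_far:
  assumes "i \<noteq> (j :: nat)"
  shows "R\<^sup>2 \<le> (real i * H - real j * H)\<^sup>2"
proof -
  have "1 \<le> \<bar>real i - real j\<bar>" using assms by linarith
  then have "1 * H \<le> \<bar>real i - real j\<bar> * H" using H_pos by (intro mult_right_mono) auto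
  also have "\<dots> = \<bar>real i * H - real j * H\<bar>" using H_pos by (simp add: abs_mult flip: left_diff_distrib)
  finally have "\<bar>R\<bar> \<le> \<bar>real i * H - real j * H\<bar>" using R_pos by (simp add: H_def)
  then show ?thesis by (simp only: abs_le_square_iff)
qed

text \<open>The slices of \<open>C\<close> are products, so over \<open>x = s m\<close> the
  coordinate \<open>m\<close> of any point can be moved to the point of tangency, which is far from
  the other disks of the stack.\<close>

lemma touch_point:
  assumes p: "p \<in> C" and m: "m \<in> {1..e}" and i: "0 < i" "i < N m" and x: "p 0 = s m"
  shows "p(m := real i * H) \<in> C" "p(m := real i * H) \<in> S (m, i)"
proof -
  have c: "(p 0 - cx m i)\<^sup>2 = R\<^sup>2" unfolding inner_cx[OF m i] x by auto
  show C: "p(m := real i * H) \<in> C"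
  proof (rule C_upd[OF p m])
    fix i' assume "i' \<le> N m"
    show "R\<^sup>2 \<le> (p 0 - cx m i')\<^sup>2 + (real i * H - real i' * H)\<^sup>2"
    proof (cases "i' = i")
      case False
      then have "R\<^sup>2 \<le> (real i * H - real i' * H)\<^sup>2" by (intro multiple_far) simp
      then show ?thesis using zero_le_power2[of "p 0 - cx m i'"] by linarith
    qed (use c in simp)
  qed (use i H_pos in auto)
  have "m \<noteq> 0" "m \<le> e" using m by auto
  then have "f (m, i) (p(m := real i * H)) = 0" using c by (simp add: f_le)
  then show "p(m := real i * H) \<in> S (m, i)" using C by (simp add: S_iff C_def)
qed

lemma S_meets_C:
  assumes "(m, i) \<in> Q"
  shows "S (m, i) \<inter> C \<noteq> {}"
  using assms
proof (cases rule: Q_cases)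
  case 1
  have m0: "m \<noteq> 0" "m \<le> e" using 1 by auto
  consider "i = 0" | "i = N m" "i \<noteq> 0" | "0 < i" "i < N m" using 1 by linarith
  then show ?thesis
  proof cases
    case 3
    then have "N m \<ge> 2" by simp
    then have s: "a \<le> s m" "s m \<le> b" using s_in 1 by (auto simp: less_imp_le)
    have "ctr (\<lambda>_. 0) (s m) \<in> C" by (rule ctr_in_C[OF cells_ok_zero s])
    moreover have "ctr (\<lambda>_. 0) (s m) 0 = s m" by (simp add: ctr_def)
    ultimately show ?thesis using touch_point[OF _ 1(1) 3] by blast
  next
    case 1
    let ?p = "ctr (\<lambda>_. 0) a"
    have pC: "?p \<in> C" using ab by (intro ctr_in_C[OF cells_ok_zero]) auto
    have p0: "?p 0 = a" by (simp add: ctr_def)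
    \<comment> \<open>Over \<open>a\<close>, the abscissa of its centre, the lowest disk ends at
      height \<open>R\<close>; correspondingly the highest one begins at
      \<open>N m * H - R\<close>.\<close>
    have "?p(m := R) \<in> C"
    proof (rule C_upd[OF pC \<open>m \<in> {1..e}\<close>])
      have "1 * H \<le> real (N m) * H" using N_pos[OF \<open>m \<in> {1..e}\<close>] H_pos by (intro mult_right_mono) auto
      then show "0 \<le> R" "R \<le> real (N m) * H" using R_pos by (auto simp: H_def)
      fix i'
      show "R\<^sup>2 \<le> (?p 0 - cx m i')\<^sup>2 + (R - real i' * H)\<^sup>2"
      proof (cases "i' = 0")
        case False
        then have "1 * H \<le> real i' * H" using H_pos by (intro mult_right_mono) auto
        then have "\<bar>R\<bar> \<le> \<bar>R - real i' * H\<bar>" using R_pos by (auto simp: H_def)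
        then have "R\<^sup>2 \<le> (R - real i' * H)\<^sup>2" by (simp only: abs_le_square_iff)
        then show ?thesis using zero_le_power2[of "?p 0 - cx m i'"] by linarith
      qed simp
    qed
    moreover have "f (m, i) (?p(m := R)) = 0"
      using m0 p0 1 by (simp add: f_le cx_def)
    ultimately show ?thesis by (auto simp: S_iff C_def)
  next
    case 2
    let ?p = "ctr (\<lambda>_. 0) a" and ?y = "real (N m) * H - R"
    have pC: "?p \<in> C" using ab by (intro ctr_in_C[OF cells_ok_zero]) auto
    have p0: "?p 0 = a" by (simp add: ctr_def)
    have "?p(m := ?y) \<in> C"
    proof (rule C_upd[OF pC \<open>m \<in> {1..e}\<close>])
      have "1 * H \<le> real (N m) * H" using N_pos[OF \<open>m \<in> {1..e}\<close>] H_pos by (intro mult_right_mono) auto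
      then show "0 \<le> ?y" "?y \<le> real (N m) * H" using R_pos by (auto simp: H_def)
      fix i' assume i': "i' \<le> N m"
      show "R\<^sup>2 \<le> (?p 0 - cx m i')\<^sup>2 + (?y - real i' * H)\<^sup>2"
      proof (cases "i' = N m")
        case False
        then have "real i' + 1 \<le> real (N m)" using i' by linarith
        then have "(real i' + 1) * H \<le> real (N m) * H" using H_pos by (intro mult_right_mono) auto
        then have "real i' * H + 3 * R \<le> real (N m) * H" unfolding distrib_right by (simp add: H_def)
        then have "\<bar>R\<bar> \<le> \<bar>?y - real i' * H\<bar>" using R_pos by linarith
        then have "R\<^sup>2 \<le> (?y - real i' * H)\<^sup>2" by (simp only: abs_le_square_iff)
        then show ?thesis using zero_le_power2[of "?p 0 - cx m i'"] by linarith
      qed simp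
    qed
    moreover have "f (m, i) (?p(m := ?y)) = 0"
      using m0 p0 2 by (simp add: f_le cx_def)
    ultimately show ?thesis by (auto simp: S_iff C_def)
  qed
next
  case 2
  have "ctr (\<lambda>_. 0) a \<in> C" using ab by (intro ctr_in_C[OF cells_ok_zero]) auto
  moreover have "f (m, i) (ctr (\<lambda>_. 0) a) = 0" unfolding 2 f_end1 by (simp add: ctr_def)
  ultimately show ?thesis by (auto simp: S_iff C_def)
next
  case 3
  have "ctr (\<lambda>_. 0) b \<in> C" using ab by (intro ctr_in_C[OF cells_ok_zero]) auto
  moreover have "f (m, i) (ctr (\<lambda>_. 0) b) = 0" unfolding 3 f_end2 by (simp add: ctr_def)
  ultimately show ?thesis by (auto simp: S_iff C_def)
qed

lemma tangent_S:
  assumes "(m, i) \<in> Q" "p \<in> S (m, i)"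
  shows "tangent_space (S (m, i)) p =
     {v. (\<forall>i\<ge>k. v i = 0) \<and> (p 0 - cx m i) * v 0 + (p m - real i * H) * v m = 0}"
  using assms unfolding S_def by (simp only: fst_conv snd_conv, intro tangent_space_cyl R_pos) (auto simp: Q_iff)

text \<open>Each plane contributes at most one equation. Without a vertical tangent the equation of
  plane \<open>m\<close> determines \<open>v m\<close> from \<open>v 0\<close>. With one,
  necessarily unique, its equation forces \<open>v 0 = 0\<close>, and then the others force their
  \<open>v m\<close> to vanish. Either way there are \<open>card I\<close> pivots.\<close>

lemma transversal:
  assumes p: "p \<in> C" and I: "I \<subseteq> Q" "I \<noteq> {}" and pI: "\<And>j. j \<in> I \<Longrightarrow> p \<in> S j"
  shows "int (fun_dim (\<Inter>j\<in>I. tangent_space (S j) p)) = int k - int (card I)"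
proof -
  have finI: "finite I" using I finite_Q by (rule_tac finite_subset)
  have f0: "f j p = 0" if "j \<in> I" for j using pI[OF that] by (simp add: S_iff)
  have inj: "inj_on fst I"
  proof (rule inj_onI)
    fix j j' assume jj: "j \<in> I" "j' \<in> I" "fst j = fst j'"
    obtain m i i' where "j = (m, i)" "j' = (m, i')" using jj(3) by (metis prod.collapse)
    then show "j = j'" using disk_unique[of m i p i'] f0[OF jj(1)] f0[OF jj(2)] by simp
  qed
  have planes: "fst ` I \<subseteq> {1..e+2}" using I by (auto simp: Q_def)
  have T: "(\<Inter>j\<in>I. tangent_space (S j) p) = {v. (\<forall>i\<ge>k. v i = 0) \<and>
      (\<forall>(m, i)\<in>I. (p 0 - cx m i) * v 0 + (p m - real i * H) * v m = 0)}" (is "_ = ?W")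
  proof -
    have "(\<Inter>j\<in>I. tangent_space (S j) p) =
       (\<Inter>j\<in>I. {v. (\<forall>i\<ge>k. v i = 0) \<and> (p 0 - cx (fst j) (snd j)) * v 0 + (p (fst j) - real (snd j) * H) * v (fst j) = 0})"
    proof (rule INF_cong[OF refl])
      fix j assume j: "j \<in> I"
      show "tangent_space (S j) p = {v. (\<forall>i\<ge>k. v i = 0) \<and> (p 0 - cx (fst j) (snd j)) * v 0 + (p (fst j) - real (snd j) * H) * v (fst j) = 0}"
        using tangent_S[of "fst j" "snd j" p] pI[OF j] I j by auto
    qed
    also have "\<dots> = ?W" using I(2) by (auto simp: case_prod_beta)
    finally show ?thesis .
  qed
  \<comment> \<open>The slope of the circle at \<open>p\<close> in plane \<open>m\<close>, by
    implicit differentiation.\<close>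
  define \<mu> where "\<mu> = (\<lambda>m. - (p 0 - cx m (THE i. (m, i) \<in> I)) / (p m - real (THE i. (m, i) \<in> I) * H))"
  have the: "(THE i. (m, i) \<in> I) = i" if "(m, i) \<in> I" for m i
  proof (rule the_equality[where P = "\<lambda>i. (m, i) \<in> I", OF that])
    fix i' assume "(m, i') \<in> I"
    then show "i' = i" using inj_onD[OF inj, of "(m, i')" "(m, i)"] that by simp
  qed
  show ?thesis
  proof (cases "\<exists>(m, i)\<in>I. p m = real i * H")
    case False
    have W: "?W = {v. (\<forall>i\<ge>k. v i = 0) \<and> (\<forall>m\<in>fst ` I. v m = (if 0 \<in> fst ` I then 0 else \<mu> m * v 0))}"
    proof -
      have "0 \<notin> fst ` I" using planes by auto
      moreover have "(p 0 - cx m i) * v 0 + (p m - real i * H) * v m = 0 \<longleftrightarrow> v m = \<mu> m * v 0"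
        if mi: "(m, i) \<in> I" for m i v
      proof -
        have "p m - real i * H \<noteq> 0" using False mi by auto
        then show ?thesis unfolding \<mu>_def the[OF mi]
          by (simp add: field_simps)
      qed
      ultimately show ?thesis by (intro Collect_cong conj_cong refl) (auto simp: image_iff Ball_def)
    qed
    have "fst ` I \<subseteq> {..<k}" using planes by auto
    then have "fun_dim ?W = k - card (fst ` I)" unfolding W by (rule fun_dim_pivot)
    moreover have "card (fst ` I) \<le> k" using card_mono[OF _ planes] by simp
    ultimately show ?thesis unfolding T using card_image[OF inj] by simp
  next
    case True
    then obtain m0 i0 where c: "(m0, i0) \<in> I" "p m0 = real i0 * H" by blast
    \<comment> \<open>Coordinate \<open>0\<close> takes the place of \<open>m0\<close> among the
      pivots, so their number is unchanged and \<open>v m0\<close> becomes free.\<close>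
    let ?P = "insert 0 (fst ` (I - {(m0, i0)}))"
    have p0: "p 0 \<noteq> cx m0 i0" using critical_level(4)[OF p, of m0 i0] c I f0 by blast
    have nc: "p m - real i * H \<noteq> 0" if "(m, i) \<in> I - {(m0, i0)}" for m i
      using critical_unique[OF p, of m i m0 i0] that c I f0 by auto
    have W: "?W = {v. (\<forall>i\<ge>k. v i = 0) \<and> (\<forall>m\<in>?P. v m = (if 0 \<in> ?P then 0 else \<mu> m * v 0))}"
    proof (intro Collect_cong conj_cong refl)
      fix v :: "nat \<Rightarrow> real"
      show "(\<forall>(m, i)\<in>I. (p 0 - cx m i) * v 0 + (p m - real i * H) * v m = 0) \<longleftrightarrow>
        (\<forall>m\<in>?P. v m = (if 0 \<in> ?P then 0 else \<mu> m * v 0))" (is "?l \<longleftrightarrow> ?r")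
      proof
        assume l: ?l
        have v0: "v 0 = 0" using bspec[OF l c(1)] c(2) p0 by simp
        have "v m = 0" if "(m, i) \<in> I - {(m0, i0)}" for m i
          using l that v0 nc[OF that] by auto
        then have "v m = 0" if "m \<in> ?P" for m using that v0 by (elim insertE imageE) force+
        then show ?r by simp
      next
        assume r: ?r
        then have v0: "v 0 = 0" by simp
        have vm: "v m = 0" if "(m, i) \<in> I - {(m0, i0)}" for m i using r that by force
        have "(p 0 - cx m i) * v 0 + (p m - real i * H) * v m = 0" if "(m, i) \<in> I" for m i
          using v0 vm[of m i] that c(2) by (cases "(m, i) = (m0, i0)") auto
        then show ?l by blast
      qed
    qed
    have P: "?P \<subseteq> {..<k}" using planes by auto
    then have "fun_dim ?W = k - card ?P" unfolding W by (rule fun_dim_pivot)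
    moreover have "card ?P = card I"
    proof -
      have "0 \<notin> fst ` (I - {(m0, i0)})" using planes by auto
      then have "card ?P = Suc (card (fst ` (I - {(m0, i0)})))" using finI by simp
      also have "card (fst ` (I - {(m0, i0)})) = card (I - {(m0, i0)})"
        using inj by (intro card_image) (auto simp: inj_on_def)
      finally show ?thesis using finI c(1) by (metis card_Suc_Diff1)
    qed
    moreover have "card ?P \<le> k" using card_mono[OF _ P] by simp
    ultimately show ?thesis unfolding T by simp
  qed
qed

lemma f_eq_cyl: "f j = (\<lambda>p. \<sigma> (fst j) * cyl_fun (fst j) (cx (fst j) (snd j)) (real (snd j) * H) R p)"
  by (rule ext) (simp add: f_def)

lemma RA_region_arrangement:
  assumes bij: "bij_betw idx {1..l} Q"
  shows "RA_region k l D (\<lambda>j. S (idx j))"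
proof -
  have idx: "idx j \<in> Q" if "j \<in> {1..l}" for j using bij that by (auto simp: bij_betw_def)
  have Q_im: "idx ` {1..l} = Q" using bij by (simp add: bij_betw_def)
  show ?thesis
    unfolding RA_region_def closure_D
  proof (intro conjI allI impI ballI)
    show "D \<noteq> {}" by (rule D_nonempty)
    show "connectedin (Euclidean_space k) D"
      unfolding Euclidean_E connectedin_subtopology connectedin_iff_connected
      using connected_D D_subset_C by (auto simp: C_def)
    show "openin (Euclidean_space k) D" by (rule openin_D)
    show "\<exists>f'. (\<forall>j\<in>{1..l}. nonsingular_hypersurface k (f' j) (S (idx j)) \<and> S (idx j) \<inter> C \<noteq> {}) \<and>
      (\<exists>U. openin (Euclidean_space k) U \<and> C \<subseteq> U \<and> D = U \<inter> {x. \<forall>j\<in>{1..l}. 0 < f' j x} \<and>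
           (\<forall>j\<in>{1..l}. U \<inter> S (idx j) = U \<inter> {x. f' j x = 0}))"
    proof (intro exI[of _ "\<lambda>j. f (idx j)"] exI[of _ U] conjI ballI)
      fix j assume j: "j \<in> {1..l}"
      obtain m i where mi: "idx j = (m, i)" by (cases "idx j")
      have mQ: "(m, i) \<in> Q" using idx[OF j] mi by simp
      then have m: "0 < m" "m < k" by (auto simp: Q_iff)
      show "nonsingular_hypersurface k (f (idx j)) (S (idx j))"
        unfolding f_eq_cyl S_def mi fst_conv snd_conv
        by (rule nonsingular_hypersurface_cyl[OF m R_pos]) (simp add: \<sigma>_def)
      show "S (idx j) \<inter> C \<noteq> {}" unfolding mi by (rule S_meets_C[OF mQ])
      show "U \<inter> S (idx j) = U \<inter> {x. f (idx j) x = 0}" by (auto simp: S_iff U_def)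
    next
      show "D = U \<inter> {x. \<forall>j\<in>{1..l}. 0 < f (idx j) x}" unfolding D_def Q_im[symmetric] by auto
    qed (use openin_U C_subset_U in auto)
    fix I p assume I: "I \<subseteq> {1..l}" "I \<noteq> {}" and p: "p \<in> C \<inter> (\<Inter>j\<in>I. S (idx j))"
    have inj: "inj_on idx I" using bij I by (auto simp: bij_betw_def intro: inj_on_subset)
    have "int (fun_dim (\<Inter>j\<in>idx ` I. tangent_space (S j) p)) = int k - int (card (idx ` I))"
      using p I idx by (intro transversal) auto
    then show "int (fun_dim (\<Inter>j\<in>I. tangent_space (S (idx j)) p)) = int k - int (card I)"
      by (simp add: card_image[OF inj] image_image)
  qed
qed

section \<open>Singular points\<close>

lemma card_active_less:
  assumes inj: "inj_on idx {1..l}" and idx: "\<And>j. j \<in> {1..l} \<Longrightarrow> idx j \<in> Q"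
  shows "card {j \<in> {1..l}. p \<in> S (idx j)} < k"
proof -
  let ?J = "{j \<in> {1..l}. p \<in> S (idx j)}"
  have "inj_on (\<lambda>j. fst (idx j)) ?J"
  proof (rule inj_onI)
    fix j j' assume jj: "j \<in> ?J" "j' \<in> ?J" "fst (idx j) = fst (idx j')"
    obtain m i i' where e: "idx j = (m, i)" "idx j' = (m, i')" using jj(3) by (metis prod.collapse)
    have "f (m, i) p = 0" "f (m, i') p = 0" using jj e by (auto simp: S_iff)
    then have "idx j = idx j'" using disk_unique e by simp
    then show "j = j'" using inj jj by (auto dest: inj_onD)
  qed
  moreover have "(\<lambda>j. fst (idx j)) ` ?J \<subseteq> fst ` Q" using idx by auto
  then have "(\<lambda>j. fst (idx j)) ` ?J \<subseteq> {1..e+2}" by (auto simp: Q_def)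
  \<comment> \<open>There are only \<open>e + 2\<close> planes, one less than \<open>k\<close>, so
    singular points of type (b) cannot occur.\<close>
  ultimately have "card ?J \<le> card {1..e+2}" by (intro card_inj_on_le) auto
  then show ?thesis by simp
qed

text \<open>At a vertical tangent the equation of the tangent hyperplane reduces to a nonzero
  multiple of \<open>v 0 = 0\<close>, and the stratum is contained in this cylinder.\<close>

lemma singular_if_critical:
  assumes bij: "bij_betw idx {1..l} Q" and p: "p \<in> C" and j: "(m, i) \<in> Q" "p \<in> S (m, i)" "p m = real i * H"
  shows "singular_point k l D (\<lambda>j. S (idx j)) p"
proof -
  let ?J = "{j \<in> {1..l}. p \<in> S (idx j)}"
  let ?M = "{x \<in> C. {j \<in> {1..l}. x \<in> S (idx j)} = ?J}"
  have "card ?J < k" using bij by (intro card_active_less) (auto simp: bij_betw_def)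
  moreover have "v 0 = 0" if v: "v \<in> tangent_space ?M p" for v
  proof -
    have "(m, i) \<in> idx ` {1..l}" using bij j(1) by (simp add: bij_betw_def)
    then obtain j0 where j0: "(m, i) = idx j0" "j0 \<in> {1..l}" by (rule imageE)
    note j0 = j0(2) j0(1)[symmetric]
    have Sc: "S (m, i) = cyl k m (cx m i) (real i * H) R" by (simp add: S_def)
    have M: "?M \<subseteq> S (m, i)"
    proof
      fix x assume x: "x \<in> ?M"
      have "j0 \<in> ?J" using j0 j(2) by simp
      then have "j0 \<in> {j \<in> {1..l}. x \<in> S (idx j)}" using x by blast
      then show "x \<in> S (m, i)" using j0 by simp
    qed
    have "(p 0 - cx m i) * v 0 + (p m - real i * H) * v m = 0"
      using tangent_space_cyl_subset(1)[OF M[unfolded Sc] v] .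
    moreover have "p 0 \<noteq> cx m i" using critical_level(4)[OF p j(1)] j by (simp add: S_iff)
    ultimately show ?thesis using j(3) by simp
  qed
  ultimately show ?thesis unfolding singular_point_def Let_def closure_D by blast
qed

text \<open>Away from the levels, moving the first coordinate while sliding along the active circles stays in
  the stratum.\<close>

lemma not_singular:
  assumes bij: "bij_betw idx {1..l} Q" and p: "p \<in> C" and x: "p 0 \<notin> levels"
  shows "\<not> singular_point k l D (\<lambda>j. S (idx j)) p"
proof -
  let ?J = "{j \<in> {1..l}. p \<in> S (idx j)}"
  let ?M = "{x \<in> C. {j \<in> {1..l}. x \<in> S (idx j)} = ?J}"
  have card: "card ?J < k" using bij by (intro card_active_less) (auto simp: bij_betw_def)
  have pE: "p \<in> E" using p by (simp add: C_def)
  define act where "act = (\<lambda>m. \<exists>i. (m, i) \<in> Q \<and> f (m, i) p = 0)"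
  define \<iota> where "\<iota> = (\<lambda>m. SOME i. (m, i) \<in> Q \<and> f (m, i) p = 0)"
  have \<iota>: "(m, \<iota> m) \<in> Q \<and> f (m, \<iota> m) p = 0" if "act m" for m
    using that unfolding act_def \<iota>_def by (rule someI_ex)
  have \<iota>_eq: "\<iota> m = i" if "(m, i) \<in> Q" "f (m, i) p = 0" for m i
    using \<iota>[of m] disk_unique[of m "\<iota> m" p i] that unfolding act_def by blast
  \<comment> \<open>The squared half-chord, over \<open>p 0 + u\<close>, of the circle of plane
    \<open>m\<close> on which \<open>p\<close> lies.\<close>
  define rt where "rt = (\<lambda>m u. R\<^sup>2 - (p 0 + u - cx m (\<iota> m))\<^sup>2)"
  have rt0: "rt m 0 = (p m - real (\<iota> m) * H)\<^sup>2" "rt m 0 > 0" if "act m" for m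
  proof -
    have fz: "(m, \<iota> m) \<in> Q" "f (m, \<iota> m) p = 0" using \<iota>[OF that] by auto
    then show r: "rt m 0 = (p m - real (\<iota> m) * H)\<^sup>2" using f_zeroD[OF fz(2)] by (simp add: rt_def)
    have "p m \<noteq> real (\<iota> m) * H" using critical_level(1,2)[OF p fz] x by auto
    then show "rt m 0 > 0" unfolding r by simp
  qed
  \<comment> \<open>The factor \<open>sgn\<close> keeps the curve on the upper or lower arc on which
    \<open>p\<close> lies; away from the levels \<open>p\<close> is on neither end of the chordless
    diameter, so the sign is not zero.\<close>
  define \<gamma> where "\<gamma> = (\<lambda>u m. if m = 0 then p 0 + u
     else if act m then real (\<iota> m) * H + sgn (p m - real (\<iota> m) * H) * sqrt (rt m u) else p m)"
  have act0: "\<not> act 0" by (auto simp: act_def Q_iff)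
  have cont: "isCont (\<lambda>u. \<gamma> u m) u" for m u
    unfolding \<gamma>_def rt_def by (cases "m = 0"; cases "act m"; simp; intro continuous_intros)
  have \<gamma>0: "\<gamma> 0 = p"
  proof
    fix m
    show "\<gamma> 0 m = p m"
      using rt0(1)[of m] by (auto simp: \<gamma>_def sgn_mult_abs)
  qed
  have \<gamma>E: "\<gamma> u \<in> E" for u
    using pE by (auto simp: \<gamma>_def E_def act_def Q_iff)
  have fcont: "isCont (\<lambda>u. f j (\<gamma> u)) 0" for j
    unfolding f_def cyl_fun_def by (intro continuous_intros cont)
  \<comment> \<open>The open conditions that keep the curve in the stratum: the arcs do not end, no
    further cylinder is met, and the bounds of the coordinates hold.\<close>
  define good where "good u \<longleftrightarrow> (\<forall>m\<in>{m \<in> {1..e+2}. act m}. 0 < rt m u) \<and>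
      (\<forall>j\<in>{j \<in> Q. f j p \<noteq> 0}. 0 < f j (\<gamma> u)) \<and>
      (\<forall>m\<in>{1..e}. 0 < \<gamma> u m) \<and> (\<forall>m\<in>{1..e}. 0 < real (N m) * H - \<gamma> u m)" for u
  have pU: "p \<in> U" using p C_subset_U by blast
  have 1: "eventually (\<lambda>u. \<forall>m\<in>{m \<in> {1..e+2}. act m}. 0 < rt m u) (nhds 0)"
  proof (rule eventually_ball_gt)
    fix m assume "m \<in> {m \<in> {1..e+2}. act m}"
    then show "0 < rt m 0" using rt0(2) by blast
    show "isCont (rt m) 0" unfolding rt_def by (intro continuous_intros)
  qed simp
  have 2: "eventually (\<lambda>u. \<forall>j\<in>{j \<in> Q. f j p \<noteq> 0}. 0 < f j (\<gamma> u)) (nhds 0)"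
  proof (rule eventually_ball_gt)
    fix j assume "j \<in> {j \<in> Q. f j p \<noteq> 0}"
    then show "0 < f j (\<gamma> 0)" unfolding \<gamma>0 using p by (auto simp: C_def less_le)
    show "isCont (\<lambda>u. f j (\<gamma> u)) 0" by (rule fcont)
  qed (simp add: finite_Q)
  have 3: "eventually (\<lambda>u. \<forall>m\<in>{1..e}. 0 < \<gamma> u m) (nhds 0)"
  proof (rule eventually_ball_gt)
    fix m assume "m \<in> {1..e}"
    then show "0 < \<gamma> 0 m" unfolding \<gamma>0 using pU by (auto simp: U_def)
    show "isCont (\<lambda>u. \<gamma> u m) 0" by (rule cont)
  qed simp
  have 4: "eventually (\<lambda>u. \<forall>m\<in>{1..e}. 0 < real (N m) * H - \<gamma> u m) (nhds 0)"
  proof (rule eventually_ball_gt)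
    fix m assume "m \<in> {1..e}"
    then show "0 < real (N m) * H - \<gamma> 0 m" unfolding \<gamma>0 using pU by (auto simp: U_def)
    show "isCont (\<lambda>u. real (N m) * H - \<gamma> u m) 0" by (intro continuous_intros cont)
  qed simp
  have "eventually good (nhds 0)"
    unfolding good_def[abs_def] by (rule eventually_conj[OF 1 eventually_conj[OF 2 eventually_conj[OF 3 4]]])
  then obtain \<epsilon> where \<epsilon>: "\<epsilon> > 0" and good: "\<forall>u. dist u 0 < \<epsilon> \<longrightarrow> good u"
    unfolding eventually_nhds_metric by (elim exE conjE)
  have near: "good u" if "u \<in> {-\<epsilon><..<\<epsilon>}" for u
  proof -
    have "dist u 0 < \<epsilon>" using that by (auto simp: dist_real_def)
    then show ?thesis using good by simp
  qed
  have rtpos: "0 < rt m u" if u: "u \<in> {-\<epsilon><..<\<epsilon>}" and m: "act m" for u m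
  proof -
    have "m \<in> {1..e+2}" using \<iota>[OF m] by (simp add: Q_iff)
    then show ?thesis using near[OF u] m unfolding good_def by blast
  qed
  have f_zero: "f j (\<gamma> u) = 0" if u: "u \<in> {-\<epsilon><..<\<epsilon>}" and j: "j \<in> Q" "f j p = 0" for u j
  proof -
    obtain m i where mi: "j = (m, i)" by (cases j)
    have a: "act m" using j mi by (auto simp: act_def)
    have i: "\<iota> m = i" using \<iota>_eq j mi by simp
    have m0: "m \<noteq> 0" using act0 a by metis
    have ne: "p m - real i * H \<noteq> 0" using rt0[OF a] i by auto
    have "(\<gamma> u m - real i * H)\<^sup>2 = (sgn (p m - real i * H))\<^sup>2 * (sqrt (rt m u))\<^sup>2"
      using m0 a i by (simp add: \<gamma>_def power_mult_distrib)
    also have "(sgn (p m - real i * H))\<^sup>2 = 1" using ne by (simp add: sgn_if)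
    also have "(sqrt (rt m u))\<^sup>2 = rt m u" using rtpos[OF u a] by simp
    finally have "(\<gamma> u m - real i * H)\<^sup>2 = R\<^sup>2 - (p 0 + u - cx m i)\<^sup>2" by (simp add: rt_def i)
    moreover have "\<gamma> u 0 = p 0 + u" by (simp add: \<gamma>_def)
    ultimately show ?thesis unfolding mi f_zero_iff cyl_fun_def fst_conv snd_conv by simp
  qed
  have f_pos: "0 < f j (\<gamma> u)" if u: "u \<in> {-\<epsilon><..<\<epsilon>}" and j: "j \<in> Q" "f j p \<noteq> 0" for u j
    using near[OF u] j unfolding good_def by blast
  have \<gamma>M: "\<gamma> u \<in> ?M" if u: "u \<in> {-\<epsilon><..<\<epsilon>}" for u
  proof -
    have "0 \<le> f j (\<gamma> u)" if "j \<in> Q" for j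
      using f_zero[OF u that] f_pos[OF u that] by (cases "f j p = 0") auto
    moreover have "0 \<le> \<gamma> u m \<and> \<gamma> u m \<le> real (N m) * H" if "m \<in> {1..e}" for m
    proof -
      have "0 < \<gamma> u m" "0 < real (N m) * H - \<gamma> u m" using near[OF u] that unfolding good_def by blast+
      then show ?thesis by linarith
    qed
    ultimately have C: "\<gamma> u \<in> C" using \<gamma>E by (auto simp: C_def)
    have "\<gamma> u \<in> S (idx j) \<longleftrightarrow> p \<in> S (idx j)" if "j \<in> {1..l}" for j
    proof -
      have "idx j \<in> Q" using bij that by (auto simp: bij_betw_def)
      then have "f (idx j) (\<gamma> u) = 0 \<longleftrightarrow> f (idx j) p = 0"
        using f_zero[OF u, of "idx j"] f_pos[OF u, of "idx j"] by force
      then show ?thesis using \<gamma>E pE by (simp add: S_iff)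
    qed
    then show ?thesis using C by blast
  qed
  define \<gamma>' where "\<gamma>' = (\<lambda>m u. if m = 0 then 1 else if act m then
      sgn (p m - real (\<iota> m) * H) * (- (p 0 + u - cx m (\<iota> m)) / sqrt (rt m u)) else 0)"
  have \<gamma>_0: "(\<lambda>u. \<gamma> u 0) = (\<lambda>u. p 0 + u)" "\<gamma>' 0 = (\<lambda>u. 1)"
    by (simp_all add: \<gamma>_def \<gamma>'_def)
  have \<gamma>_act: "(\<lambda>u. \<gamma> u m) = (\<lambda>u. real (\<iota> m) * H + sgn (p m - real (\<iota> m) * H) * sqrt (rt m u))"
    "\<gamma>' m = (\<lambda>u. sgn (p m - real (\<iota> m) * H) * (- (p 0 + u - cx m (\<iota> m)) / sqrt (rt m u)))"
    if "m \<noteq> 0" "act m" for m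
    using that by (simp_all add: \<gamma>_def \<gamma>'_def)
  have \<gamma>_rest: "(\<lambda>u. \<gamma> u m) = (\<lambda>u. p m)" "\<gamma>' m = (\<lambda>u. 0)" if "m \<noteq> 0" "\<not> act m" for m
    using that by (simp_all add: \<gamma>_def \<gamma>'_def)
  have der: "((\<lambda>u. \<gamma> u m) has_real_derivative \<gamma>' m u) (at u)" if u: "u \<in> {-\<epsilon><..<\<epsilon>}" for m u
  proof (cases "m = 0")
    case True
    have "((\<lambda>u. p 0 + u) has_real_derivative 1) (at u)" by (auto intro!: derivative_eq_intros)
    then show ?thesis unfolding True \<gamma>_0 .
  next
    case m: False
    show ?thesis
    proof (cases "act m")
      case True
      have pos: "0 < R\<^sup>2 - (p 0 + u - cx m (\<iota> m))\<^sup>2" using rtpos[OF u True] unfolding rt_def .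
      note D = DERIV_circle_arc[OF pos, of "real (\<iota> m) * H" "sgn (p m - real (\<iota> m) * H)"]
      have "((\<lambda>u. real (\<iota> m) * H + sgn (p m - real (\<iota> m) * H) * sqrt (rt m u)) has_real_derivative
          sgn (p m - real (\<iota> m) * H) * (- (p 0 + u - cx m (\<iota> m)) / sqrt (rt m u))) (at u)"
        using D unfolding rt_def .
      then show ?thesis unfolding \<gamma>_act[OF m True] .
    next
      case False
      show ?thesis unfolding \<gamma>_rest[OF m False] by (rule DERIV_const)
    qed
  qed
  have cont': "continuous_on {-\<epsilon><..<\<epsilon>} (\<gamma>' m)" for m
  proof (cases "m = 0")
    case True
    show ?thesis unfolding True \<gamma>_0 by (rule continuous_on_const)
  next
    case m: False
    show ?thesis
    proof (cases "act m")
      case True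
      have "sqrt (rt m u) \<noteq> 0" if "u \<in> {-\<epsilon><..<\<epsilon>}" for u using rtpos[OF that True] by simp
      then show ?thesis unfolding \<gamma>_act[OF m True] unfolding rt_def
        by (intro continuous_intros) blast
    next
      case False
      show ?thesis unfolding \<gamma>_rest[OF m False] by (rule continuous_on_const)
    qed
  qed
  have C1: "(\<lambda>u. \<gamma> u i) C1_differentiable_on {-\<epsilon><..<\<epsilon>}" for i
    unfolding C1_differentiable_on_def has_real_derivative_iff_has_vector_derivative[symmetric]
    using der[of _ i] cont'[of i] by (intro exI[of _ "\<gamma>' i"] conjI ballI)
  have zero: "0 \<in> {-\<epsilon><..<\<epsilon>}" using \<epsilon> by simp
  note der0 = der[OF zero]
  have tangent: "(\<lambda>m. \<gamma>' m 0) \<in> tangent_space ?M p"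
    using \<epsilon> \<gamma>0 \<gamma>M C1 der0 by (rule tangent_spaceI[where \<gamma> = \<gamma> and \<epsilon> = \<epsilon> and v = "\<lambda>m. \<gamma>' m 0"])
  show ?thesis
  proof
    assume "singular_point k l D (\<lambda>j. S (idx j)) p"
    then have "(card ?J < k \<and> (\<forall>v\<in>tangent_space ?M p. v 0 = 0)) \<or> card ?J = k"
      unfolding singular_point_def Let_def closure_D .
    then have "\<forall>v\<in>tangent_space ?M p. v 0 = 0"
    proof
      assume "card ?J = k"
      then show ?thesis using card by (metis less_irrefl)
    qed (rule conjunct2)
    \<comment> \<open>The contradiction: the curve moves the first coordinate with velocity
      \<open>1\<close>.\<close>
    then have "(\<lambda>m. \<gamma>' m 0) 0 = 0" using tangent by (rule bspec)
    then have "\<gamma>' 0 0 = 0" .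
    then show False unfolding \<gamma>_0 by (rule zero_neq_one[symmetric, THEN notE])
  qed
qed

text \<open>Singularity is found in the class, not at the given point. Over \<open>a\<close> and
  \<open>b\<close> the confining disk has shrunk to a point, and every point is singular. Over an
  inner level the point is first moved to a tangency.\<close>

lemma level_singular:
  assumes bij: "bij_betw idx {1..l} Q" and p: "p \<in> C" and x: "p 0 \<in> levels"
  shows "\<exists>q\<in>Reeb_class k D p. q \<in> C \<and> singular_point k l D (\<lambda>j. S (idx j)) q"
proof -
  have pp: "p \<in> Reeb_class k D p" using p by (simp add: Reeb_class_eq same_side_def)
  consider "p 0 = a" | "p 0 = b" | m where "m \<in> {1..e}" "N m \<ge> 2" "p 0 = s m"
    using x unfolding levels_def by blast
  then show ?thesis
  proof cases
    case 1
    have j: "(e + 1, 0) \<in> Q" by (simp add: Q_iff)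
    then have "f (e + 1, 0) p \<ge> 0" using p by (auto simp: C_def)
    then have z: "p (e + 1) = 0" unfolding f_end1 1 by simp
    have "f (e + 1, 0) p = 0" unfolding f_end1 1 z by simp
    then have "p \<in> S (e + 1, 0)" using p by (simp add: S_iff C_def)
    then have "singular_point k l D (\<lambda>j. S (idx j)) p"
      using z by (intro singular_if_critical[OF bij p j]) auto
    then show ?thesis using pp p by blast
  next
    case 2
    have j: "(e + 2, 0) \<in> Q" by (simp add: Q_iff)
    then have "f (e + 2, 0) p \<ge> 0" using p by (auto simp: C_def)
    then have z: "p (e + 2) = 0" unfolding f_end2 2 by simp
    have "f (e + 2, 0) p = 0" unfolding f_end2 2 z by simp
    then have "p \<in> S (e + 2, 0)" using p by (simp add: S_iff C_def)
    then have "singular_point k l D (\<lambda>j. S (idx j)) p"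
      using z by (intro singular_if_critical[OF bij p j]) auto
    then show ?thesis using pp p by blast
  next
    case 3
    \<comment> \<open>Moving coordinate \<open>m\<close> to the first inner disk stays in the Reeb
      class, as no disk of plane \<open>m\<close> is active at \<open>s m\<close>.\<close>
    let ?q = "p(m := real 1 * H)"
    have i: "0 < (1::nat)" "1 < N m" using 3 by auto
    note q = touch_point[OF p 3(1) i 3(3)]
    have m0: "m \<noteq> 0" using 3 by auto
    have "same_side p ?q" using 3(3) by (auto simp: same_side_def active_def)
    then have "?q \<in> Reeb_class k D p" using q(1) m0 by (simp add: Reeb_class_eq[OF p])
    moreover have "(m, 1) \<in> Q" using 3 by (simp add: Q_iff)
    then have "singular_point k l D (\<lambda>j. S (idx j)) ?q"
      by (rule singular_if_critical[OF bij q(1) _ q(2)]) simp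
    ultimately show ?thesis using q(1) by (intro bexI[of _ ?q] conjI)
  qed
qed

end

section \<open>The theorem\<close>

context two_balanced_trees
begin

abbreviation "e \<equiv> d1 + d2"

text \<open>The number of parts of plane \<open>m\<close>, whose branching takes place at
  \<open>t (m + 1)\<close>. Digit \<open>i\<close> of the reversed tree belongs to plane
  \<open>d1 + 1 - i\<close> and digit \<open>i\<close> of the other tree to plane
  \<open>d1 + i - 1\<close>; both are \<open>d1\<close> for \<open>i = 1\<close>. There
  \<open>n1 1 - 1\<close> and \<open>n2 1 - 1\<close> inner disks make
  \<open>n1 1 + n2 1 - 1\<close> parts. Plane \<open>e\<close> has one part and no inner
  disk.\<close>

definition N :: "nat \<Rightarrow> nat" where
  "N m = (if m < d1 then n1 (d1 + 1 - m) else if m = d1 then n1 1 + n2 1 - 1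
     else if m < e then n2 (m + 1 - d1) else if m = e then 1 else 0)"

text \<open>In the shared plane the disks \<open>1\<close> to \<open>n1 1 - 1\<close> extend to the
  left and the remaining \<open>n2 1 - 1\<close> inner ones to the right.\<close>

definition rightward :: "nat \<Rightarrow> nat \<Rightarrow> bool" where
  "rightward m i \<longleftrightarrow> d1 < m \<or> (m = d1 \<and> n1 1 \<le> i)"

lemma n_one: "n1 1 > 1" "n2 1 > 1" using n1[of 1] n2[of 1] d1 d2 by auto

lemma N_ge: "m \<in> {1..<e} \<Longrightarrow> N m \<ge> 2"
proof -
  assume m: "m \<in> {1..<e}"
  consider "m < d1" | "m = d1" | "d1 < m" by linarith
  then show "N m \<ge> 2"
  proof cases
    case 1
    then have "d1 + 1 - m \<in> {1..d1}" using m by auto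
    then show ?thesis using n1[of "d1 + 1 - m"] 1 by (simp add: N_def)
  next
    case 2
    then show ?thesis using n_one by (simp add: N_def)
  next
    case 3
    then have "m + 1 - d1 \<in> {1..d2}" using m by auto
    then show ?thesis using n2[of "m + 1 - d1"] 3 m by (simp add: N_def)
  qed
qed

lemma N_e: "N e = 1" using d2 by (simp add: N_def)

lemma arrangement_tree:
  assumes "R > b - a" "a = a0" "b = b0" "\<And>m. s m = t (m + 1)"
  shows "arrangement e N s a b R"
  unfolding assms(2,3)
proof
  show "a0 < b0" using r_bounds by simp
  show "b0 - a0 < R" using assms by simp
  show "1 \<le> N m" if "m \<in> {1..e}" for m
    using N_ge[of m] N_e that by (cases "m = e") auto
  show "N (e + 1) = 0" "N (e + 2) = 0" by (auto simp: N_def)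
  have m_less: "m < e" if "m \<in> {1..e}" "2 \<le> N m" for m using that N_e by (cases "m = e") auto
  show "a0 < s m \<and> s m < b0" if "m \<in> {1..e}" "2 \<le> N m" for m
    using m_less[OF that] that t_less[of 1 "m + 1"] t_less[of "m + 1" "e + 1"] unfolding assms(4) by auto
  show "m = m'" if "m \<in> {1..e}" "m' \<in> {1..e}" "2 \<le> N m" "2 \<le> N m'" "s m = s m'" for m m'
    using m_less[OF that(1,3)] m_less[OF that(2,4)] that(5) t_eq_iff[of "m + 1" "m' + 1"]
    unfolding assms(4) by auto
qed

lemma card_disks: "(\<Sum>m\<in>{1..e + 2}. N m + 1) = (\<Sum>i = 1..d1. n1 i + 1) + (\<Sum>i = 1..d2. n2 i + 1) + 2"
proof -
  have split: "{1..e + 2} = {1..<d1} \<union> {d1} \<union> {d1 + 1..<e} \<union> {e} \<union> {e + 1, e + 2}"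
    using d1 d2 by auto
  have "(\<Sum>m\<in>{1..e + 2}. N m + 1) = (\<Sum>m\<in>{1..<d1}. N m + 1) + (N d1 + 1) +
      (\<Sum>m\<in>{d1 + 1..<e}. N m + 1) + (N e + 1) + ((N (e + 1) + 1) + (N (e + 2) + 1))"
    unfolding split using d1 d2 by (subst sum.union_disjoint; auto)+
  also have "(\<Sum>m\<in>{1..<d1}. N m + 1) = (\<Sum>i\<in>{2..d1}. n1 i + 1)"
    by (rule sum.reindex_bij_witness[of _ "\<lambda>i. d1 + 1 - i" "\<lambda>m. d1 + 1 - m"]) (auto simp: N_def)
  also have "(\<Sum>m\<in>{d1 + 1..<e}. N m + 1) = (\<Sum>i\<in>{2..d2}. n2 i + 1)"
    by (rule sum.reindex_bij_witness[of _ "\<lambda>i. d1 + i - 1" "\<lambda>m. m + 1 - d1"]) (auto simp: N_def)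
  also have "N d1 + 1 = (n1 1 + 1) + (n2 1 + 1) - 2" using n_one by (simp add: N_def)
  finally have "(\<Sum>m\<in>{1..e + 2}. N m + 1) = (\<Sum>i\<in>{2..d1}. n1 i + 1) + ((n1 1 + 1) + (n2 1 + 1) - 2) +
      (\<Sum>i\<in>{2..d2}. n2 i + 1) + 2 + 2"
    using N_e by (simp add: N_def)
  moreover have "(\<Sum>i = 1..d1. n1 i + 1) = (n1 1 + 1) + (\<Sum>i\<in>{2..d1}. n1 i + 1)"
    using d1 by (simp add: sum.atLeast_Suc_atMost numeral_2_eq_2)
  moreover have "(\<Sum>i = 1..d2. n2 i + 1) = (n2 1 + 1) + (\<Sum>i\<in>{2..d2}. n2 i + 1)"
    using d2 by (simp add: sum.atLeast_Suc_atMost numeral_2_eq_2)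
  ultimately show ?thesis by linarith
qed

text \<open>The branch taken at a vertex of depth \<open>i - 1\<close> is read off from the part of the stack in which the
  corresponding coordinate lies. The plane \<open>d1\<close> serves both roots: its lower disks separate the
  branches of the reversed tree, its upper disks those of the other one.\<close>

definition digits_of :: "(nat \<Rightarrow> nat) \<Rightarrow> (nat \<Rightarrow> nat) \<times> (nat \<Rightarrow> nat)" where
  "digits_of w = (\<lambda>i. if i = 1 then min (w d1) (n1 1 - 1) else w (d1 + 1 - i),
                  \<lambda>i. if i = 1 then w d1 - (n1 1 - 1) else w (d1 + i - 1))"

lemma digits_of_in:
  assumes w: "\<forall>m\<in>{1..e}. w m < N m"
  shows "digits_of w \<in> L.digits \<times> R.digits"
proof -
  have "w d1 < n1 1 + n2 1 - 1" using bspec[OF w, of d1] d1 by (simp add: N_def)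
  moreover have "w (d1 + 1 - i) < n1 i" if "i \<in> {1..d1}" "i \<noteq> 1" for i
  proof -
    have "d1 + 1 - i \<in> {1..e}" "d1 + 1 - i < d1" "d1 + 1 - (d1 + 1 - i) = i" using that by auto
    then show ?thesis using bspec[OF w, of "d1 + 1 - i"] by (simp add: N_def)
  qed
  moreover have "w (d1 + i - 1) < n2 i" if "i \<in> {1..d2}" "i \<noteq> 1" for i
  proof -
    have "d1 + i - 1 \<in> {1..e}" "\<not> d1 + i - 1 < d1" "d1 + i - 1 \<noteq> d1" "d1 + i - 1 < e" "d1 + i - 1 + 1 - d1 = i"
      using that by auto
    then show ?thesis using bspec[OF w, of "d1 + i - 1"] by (simp add: N_def)
  qed
  ultimately show ?thesis using n_one by (auto simp: digits_of_def)
qed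

text \<open>The height \<open>x\<close> is fixed before \<open>w\<close> because the plane
  \<open>d1\<close> cannot realise every pair of root digits at once. Over a given \<open>x\<close>
  only the digits of one tree count, and the planes of that tree can be filled freely.\<close>

lemma through_digits_surj:
  assumes u: "u \<in> L.digits \<times> R.digits" and x: "x \<in> {a0..b0}"
  shows "\<exists>w. (\<forall>m\<in>{1..e}. w m < N m) \<and> through (digits_of w) x = through u x"
proof -
  have fu: "fst u i < n1 i" if "i \<in> {1..d1}" for i using u that by auto
  have su: "snd u i < n2 i" if "i \<in> {1..d2}" for i using u that by auto
  have N1: "0 < N m" if "m \<in> {1..e}" for m using N_ge[of m] N_e that by (cases "m = e") auto
  show ?thesis
  proof (cases "r \<le> x")
    case True
    \<comment> \<open>The offset \<open>n1 1 - 1\<close> puts the point above all leftward disks of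
      the shared plane, from where the digits of the right tree are counted.\<close>
    define w where "w m = (if m = d1 then n1 1 - 1 + snd u 1 else if d1 < m \<and> m < e then snd u (m + 1 - d1) else 0)" for m
    have w: "w m < N m" if m: "m \<in> {1..e}" for m
    proof -
      consider "m = d1" | "d1 < m" "m < e" | "m < d1" | "m = e" using m by force
      then show ?thesis
      proof cases
        case 1
        then show ?thesis using su[of 1] d2 n_one by (simp add: w_def N_def)
      next
        case 2
        then have "m + 1 - d1 \<in> {1..d2}" by auto
        then show ?thesis using su[of "m + 1 - d1"] 2 by (simp add: w_def N_def)
      qed (use N1[OF m] d2 in \<open>auto simp: w_def\<close>)
    qed
    then have W: "\<forall>m\<in>{1..e}. w m < N m" by blast
    have "through (digits_of w) x = through u x"
      unfolding through_eq_iff[OF digits_of_in[OF W] u x x]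
    proof (intro conjI refl ballI impI)
      fix i assume i: "i \<in> {1..d1}" "x < t (d1 + 2 - i)"
      have "t (d1 + 2 - i) \<le> r" by (rule iffD2[OF t_le]) (use i in auto)
      then show "fst (digits_of w) i = fst u i" using i True by simp
    next
      fix i assume i: "i \<in> {1..d2}" "t (d1 + i) < x"
      show "snd (digits_of w) i = snd u i"
      proof (cases "i = 1")
        case False
        then have "d1 + i - 1 \<noteq> d1" "d1 < d1 + i - 1" "d1 + i - 1 < e" "d1 + i - 1 + 1 - d1 = i" using i by auto
        then show ?thesis using False by (simp add: digits_of_def w_def)
      qed (simp add: digits_of_def w_def)
    qed
    then show ?thesis using W by blast
  next
    case False
    define w where "w m = (if m = d1 then fst u 1 else if m < d1 then fst u (d1 + 1 - m) else 0)" for m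
    have w: "w m < N m" if m: "m \<in> {1..e}" for m
    proof -
      consider "m = d1" | "m < d1" | "d1 < m" by linarith
      then show ?thesis
      proof cases
        case 1
        then show ?thesis using fu[of 1] d1 n_one by (simp add: w_def N_def)
      next
        case 2
        then have "d1 + 1 - m \<in> {1..d1}" using m by auto
        then show ?thesis using fu[of "d1 + 1 - m"] 2 by (simp add: w_def N_def)
      qed (use N1[OF m] in \<open>auto simp: w_def\<close>)
    qed
    then have W: "\<forall>m\<in>{1..e}. w m < N m" by blast
    have "through (digits_of w) x = through u x"
      unfolding through_eq_iff[OF digits_of_in[OF W] u x x]
    proof (intro conjI refl ballI impI)
      fix i assume i: "i \<in> {1..d2}" "t (d1 + i) < x"
      have "r \<le> t (d1 + i)" by (rule iffD2[OF t_le]) (use i in auto)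
      then show "snd (digits_of w) i = snd u i" using i False by simp
    next
      fix i assume i: "i \<in> {1..d1}" "x < t (d1 + 2 - i)"
      show "fst (digits_of w) i = fst u i"
      proof (cases "i = 1")
        case True
        then show ?thesis using fu[of 1] i by (simp add: digits_of_def w_def)
      next
        case False
        then have "d1 + 1 - i \<noteq> d1" "d1 + 1 - i < d1" "d1 + 1 - (d1 + 1 - i) = i" using i by auto
        then show ?thesis using False by (simp add: digits_of_def w_def)
      qed
    qed
    then show ?thesis using W by blast
  qed
qed

text \<open>The threshold to test is \<open>min a (n - 1)\<close> itself. Used in both directions,
  this recovers a truncated number from the thresholds it reaches, that is, from the disks it lies
  above.\<close>

lemma thresholds_min_le:
  fixes a b n :: nat
  assumes "\<And>i. 0 < i \<Longrightarrow> i < n \<Longrightarrow> i \<le> a \<Longrightarrow> i \<le> b"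
  shows "min a (n - 1) \<le> min b (n - 1)"
proof (cases "min a (n - 1) = 0")
  case False
  then have "0 < min a (n - 1)" "min a (n - 1) < n" by linarith+
  then have "min a (n - 1) \<le> b" by (rule assms) simp
  then show ?thesis by simp
qed simp

text \<open>Here \<open>a\<close> itself is the threshold to test, unless it is below
  \<open>c\<close> and the left side is zero.\<close>

lemma thresholds_diff_le:
  fixes a b n c :: nat
  assumes "\<And>i. c \<le> i \<Longrightarrow> i < n \<Longrightarrow> i \<le> a \<Longrightarrow> i \<le> b" "a < n" "0 < c"
  shows "a - (c - 1) \<le> b - (c - 1)"
proof (cases "c \<le> a")
  case True
  then have "a \<le> b" using assms(1)[of a] assms(2) by simp
  then show ?thesis by simp
qed (use assms(3) in simp)

text \<open>Equality of the digits that count over \<open>x\<close> is rewritten as agreement on the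
  thresholds given by the active disks. In this form it matches \<open>same_side\<close>, and so the
  fibres of the map to the tree can be compared with the Reeb classes.\<close>

lemma through_cells_eq_iff:
  assumes w: "\<forall>m\<in>{1..e}. w m < N m" and w': "\<forall>m\<in>{1..e}. w' m < N m"
    and x: "x \<in> {a0..b0}" and y: "y \<in> {a0..b0}"
  shows "through (digits_of w) x = through (digits_of w') y \<longleftrightarrow> x = y \<and>
    (\<forall>m\<in>{1..e}. \<forall>i. 0 < i \<and> i < N m \<and> (if rightward m i then t (m + 1) < x else x < t (m + 1))
       \<longrightarrow> (i \<le> w m \<longleftrightarrow> i \<le> w' m))" (is "_ \<longleftrightarrow> _ \<and> ?B")
proof -
  let ?L = "\<forall>i\<in>{1..d1}. x < t (d1 + 2 - i) \<longrightarrow> fst (digits_of w) i = fst (digits_of w') i"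
  let ?R = "\<forall>i\<in>{1..d2}. t (d1 + i) < x \<longrightarrow> snd (digits_of w) i = snd (digits_of w') i"
  have "?L \<and> ?R \<longleftrightarrow> ?B"
  proof
    assume B: ?B
    have B': "i \<le> w m \<longleftrightarrow> i \<le> w' m"
      if "m \<in> {1..e}" "0 < i" "i < N m" "if rightward m i then t (m + 1) < x else x < t (m + 1)" for m i
      using B that by blast
    have all: "w m = w' m" if m: "m \<in> {1..e}" and "\<And>i. 0 < i \<Longrightarrow> i < N m \<Longrightarrow> i \<le> w m \<longleftrightarrow> i \<le> w' m" for m
    proof -
      have lt: "w m < N m" "w' m < N m" using w w' m by blast+
      have "min (w m) (N m - 1) \<le> min (w' m) (N m - 1)" by (rule thresholds_min_le) (use that(2) in blast)
      moreover have "min (w' m) (N m - 1) \<le> min (w m) (N m - 1)" by (rule thresholds_min_le) (use that(2) in blast)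
      ultimately show ?thesis using lt by linarith
    qed
    show "?L \<and> ?R"
    proof (intro conjI ballI impI)
      fix i assume i: "i \<in> {1..d1}" and xt: "x < t (d1 + 2 - i)"
      show "fst (digits_of w) i = fst (digits_of w') i"
      proof (cases "i = 1")
        case True
        have iff: "j \<le> w d1 \<longleftrightarrow> j \<le> w' d1" if j: "0 < j" "j < n1 1" for j
          by (rule B') (use d1 j n_one xt True in \<open>auto simp: rightward_def N_def\<close>)
        have "min (w d1) (n1 1 - 1) = min (w' d1) (n1 1 - 1)"
          by (rule order.antisym; rule thresholds_min_le) (use iff in blast)+
        then show ?thesis using True by (simp add: digits_of_def)
      next
        case False
        let ?m = "d1 + 1 - i"
        have m: "?m \<in> {1..e}" "\<not> rightward ?m j" "?m + 1 = d1 + 2 - i" for j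
          using False i by (auto simp: rightward_def)
        have "w ?m = w' ?m" by (rule all[OF m(1)], rule B'[OF m(1)]) (use m xt in auto)
        then show ?thesis using False by (simp add: digits_of_def)
      qed
    next
      fix i assume i: "i \<in> {1..d2}" and xt: "t (d1 + i) < x"
      show "snd (digits_of w) i = snd (digits_of w') i"
      proof (cases "i = 1")
        case True
        have iff: "j \<le> w d1 \<longleftrightarrow> j \<le> w' d1" if j: "n1 1 \<le> j" "j < N d1" for j
          by (rule B') (use d1 j n_one xt True in \<open>auto simp: rightward_def\<close>)
        have "d1 \<in> {1..e}" using d1 by simp
        then have lt: "w d1 < N d1" "w' d1 < N d1" using w w' by blast+
        have pos: "0 < n1 1" using n_one by simp
        have "w d1 - (n1 1 - 1) \<le> w' d1 - (n1 1 - 1)"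
          by (rule thresholds_diff_le[OF _ lt(1) pos]) (use iff in blast)
        moreover have "w' d1 - (n1 1 - 1) \<le> w d1 - (n1 1 - 1)"
          by (rule thresholds_diff_le[OF _ lt(2) pos]) (use iff in blast)
        ultimately have "w d1 - (n1 1 - 1) = w' d1 - (n1 1 - 1)" by simp
        then show ?thesis using True by (simp add: digits_of_def)
      next
        case False
        let ?m = "d1 + i - 1"
        have m: "?m \<in> {1..e}" "rightward ?m j" "?m + 1 = d1 + i" for j
          using False i by (auto simp: rightward_def)
        have "w ?m = w' ?m" by (rule all[OF m(1)], rule B'[OF m(1)]) (use m xt in auto)
        then show ?thesis using False by (simp add: digits_of_def)
      qed
    qed
  next
    assume LR: "?L \<and> ?R"
    show ?B
    proof (intro ballI allI impI)
      fix m i assume m: "m \<in> {1..e}"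
        and i: "0 < i \<and> i < N m \<and> (if rightward m i then t (m + 1) < x else x < t (m + 1))"
      consider "m < d1" | "m = d1" "i < n1 1" | "m = d1" "n1 1 \<le> i" | "d1 < m" "m < e" | "m = e" using m by force
      then show "i \<le> w m \<longleftrightarrow> i \<le> w' m"
      proof cases
        case 1
        have e: "d1 + 1 - m \<in> {1..d1}" "d1 + 2 - (d1 + 1 - m) = m + 1" "d1 + 1 - m \<noteq> 1" "d1 + 1 - (d1 + 1 - m) = m"
          using 1 m by auto
        have "x < t (d1 + 2 - (d1 + 1 - m))" unfolding e(2) using i 1 by (auto simp: rightward_def)
        then have "fst (digits_of w) (d1 + 1 - m) = fst (digits_of w') (d1 + 1 - m)" using LR e(1) by blast
        then show ?thesis using e(3,4) by (simp add: digits_of_def)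
      next
        case 2
        have "x < t (d1 + 2 - 1)" using i 2 by (auto simp: rightward_def)
        moreover have "1 \<in> {1..d1}" using d1 by simp
        ultimately have "fst (digits_of w) 1 = fst (digits_of w') 1" using LR by blast
        then have "min (w m) (n1 1 - 1) = min (w' m) (n1 1 - 1)" using 2 by (simp add: digits_of_def)
        then show ?thesis using 2(2) by (auto simp: min_def split: if_splits)
      next
        case 3
        have "t (d1 + 1) < x" using i 3 by (auto simp: rightward_def)
        moreover have "1 \<in> {1..d2}" using d2 by simp
        ultimately have "snd (digits_of w) 1 = snd (digits_of w') 1" using LR by blast
        then have "w m - (n1 1 - 1) = w' m - (n1 1 - 1)" using 3 by (simp add: digits_of_def)
        then show ?thesis using 3(2) n_one by auto
      next
        case 4
        have e: "m + 1 - d1 \<in> {1..d2}" "d1 + (m + 1 - d1) = m + 1" "m + 1 - d1 \<noteq> 1" "d1 + (m + 1 - d1) - 1 = m"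
          using 4 by auto
        have "t (d1 + (m + 1 - d1)) < x" unfolding e(2) using i 4 by (auto simp: rightward_def)
        then have "snd (digits_of w) (m + 1 - d1) = snd (digits_of w') (m + 1 - d1)" using LR e(1) by blast
        then show ?thesis using e(3,4) by (simp add: digits_of_def)
      next
        case 5
        then show ?thesis using i N_e by simp
      qed
    qed
  qed
  then show ?thesis unfolding through_eq_iff[OF digits_of_in[OF w] digits_of_in[OF w'] x y] by blast
qed

lemma realization:
  assumes R: "R > b0 - a0" and l: "l = (\<Sum>i = 1..d1. n1 i + 1) + (\<Sum>i = 1..d2. n2 i + 1) + 2"
  shows "\<exists>k\<ge>2. \<exists>D S. RA_region k l D S \<and> compactin (Euclidean_space k) (Euclidean_space k closure_of D) \<and>
     (\<forall>j\<in>{1..l}. is_cylinder k (circle R) (S j)) \<and> top_digraph_iso (PR_digraph k l D S) W \<and>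
     PR_fun ` tverts (PR_digraph k l D S) = t ` {1..e + 1}"
proof -
  define a b s where "a = a0" and "b = b0" and "s = (\<lambda>m. t (m + 1))"
  have ab: "{a0..b0} = {a..b}" by (simp add: a_def b_def)
  interpret A: arrangement e N rightward s a b R
    by (rule arrangement_tree) (use R in \<open>simp_all add: a_def b_def s_def\<close>)
  have "card A.Q = l" unfolding A.Q_def l card_disks[symmetric] by simp
  then obtain idx where bij: "bij_betw idx {1..l} A.Q"
    using ex_bij_betw_nat_finite_1[OF A.finite_Q] by blast
  let ?S = "\<lambda>j. A.S (idx j)"
  have C_E: "A.C \<subseteq> A.E" unfolding A.C_def by blast
  have compact: "compactin (Euclidean_space A.k) A.C"
    unfolding A.Euclidean_E using A.compact_C C_E by (simp add: compactin_subtopology)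
  have cyl: "is_cylinder A.k (circle R) (?S j)" if "j \<in> {1..l}" for j
  proof -
    have "idx j \<in> A.Q" using bij that by (auto simp: bij_betw_def)
    then have "0 < fst (idx j)" "fst (idx j) < A.k" by (auto simp: A.Q_def)
    then show ?thesis unfolding A.S_def by (rule is_cylinder_cyl[OF _ _ A.R_pos])
  qed
  \<comment> \<open>The tree point of height \<open>p 0\<close> on the path whose branches are read
    off from the parts of the stacks in which \<open>p\<close> lies.\<close>
  define g where "g p = through (digits_of (A.cell p)) (p 0)" for p
  have cellN: "\<forall>m\<in>{1..e}. A.cell p m < N m" if "p \<in> A.C" for p
    using A.cell(3) A.C_subset_U that by blast
  have px: "p 0 \<in> {a0..b0}" if "p \<in> A.C" for p using A.in_C_x[OF that] by (simp add: a_def b_def)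
  have act_iff: "A.active m i x \<longleftrightarrow> 0 < i \<and> i < N m \<and> (if rightward m i then t (m + 1) < x else x < t (m + 1))" for m i x
    unfolding A.active_def unfolding s_def by (rule refl)
  note cells_iff = through_cells_eq_iff[folded act_iff]
  have side: "i \<le> A.cell p m \<longleftrightarrow> real i * A.H < p m"
    if p: "p \<in> A.C" and m: "m \<in> {1..e}" and act: "A.active m i (p 0)" for p m i
  proof -
    have pU: "p \<in> A.U" using p A.C_subset_U by blast
    note c = A.cell(1,2)[OF pU m]
    show ?thesis
    proof
      assume "i \<le> A.cell p m"
      then have "real i * A.H \<le> real (A.cell p m) * A.H" using A.H_pos by simp
      then show "real i * A.H < p m" using c(1) A.active_neq[OF p m act] by simp
    next
      assume "real i * A.H < p m"
      then have "real i * A.H < (real (A.cell p m) + 1) * A.H" using c(2) by simp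
      then have "real i < real (A.cell p m) + 1" using A.H_pos by simp
      then show "i \<le> A.cell p m" by linarith
    qed
  qed
  \<comment> \<open>The box of \<open>w\<close> is closed here. A point on the common face of two
    boxes may be assigned either branch vector: by \<open>active_neq\<close> the face does not lie
    at the centre height of an active disk, so the digits that count are the same.\<close>
  have g_cells: "g p = through (digits_of w) (p 0)"
    if p: "p \<in> A.C" and w: "\<forall>m\<in>{1..e}. w m < N m"
      and in_cell: "\<And>m. m \<in> {1..e} \<Longrightarrow> real (w m) * A.H \<le> p m \<and> p m \<le> (real (w m) + 1) * A.H" for p w
    unfolding g_def cells_iff[OF cellN[OF p] w px[OF p] px[OF p]]
  proof (intro conjI refl ballI allI impI)
    fix m i assume m: "m \<in> {1..e}" and act: "A.active m i (p 0)"
    note ic = in_cell[OF m]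
    have "real i * A.H < p m \<longleftrightarrow> i \<le> w m"
    proof
      assume "i \<le> w m"
      then have "real i * A.H \<le> real (w m) * A.H" using A.H_pos by simp
      then show "real i * A.H < p m" using ic A.active_neq[OF p m act] by simp
    next
      assume "real i * A.H < p m"
      then have "real i * A.H < (real (w m) + 1) * A.H" using ic by simp
      then have "real i < real (w m) + 1" using A.H_pos by simp
      then show "i \<le> w m" by linarith
    qed
    then show "i \<le> A.cell p m \<longleftrightarrow> i \<le> w m" using side[OF p m act] by simp
  qed
  have g_iff: "g p = g q \<longleftrightarrow> p 0 = q 0 \<and> A.same_side p q" if p: "p \<in> A.C" and q: "q \<in> A.C" for p q
    unfolding g_def cells_iff[OF cellN[OF p] cellN[OF q] px[OF p] px[OF q]] A.same_side_def
  proof (intro conj_cong refl ball_cong all_cong)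
    fix m i assume "p 0 = q 0" "m \<in> {1..e}" "A.active m i (p 0)"
    then show "(i \<le> A.cell p m \<longleftrightarrow> i \<le> A.cell q m) \<longleftrightarrow> (real i * A.H < p m \<longleftrightarrow> real i * A.H < q m)"
      using side[OF p, of m i] side[OF q, of m i] by simp
  qed
  have Reeb_mem: "q \<in> Reeb_class A.k A.D p \<longleftrightarrow> q \<in> A.C \<and> g p = g q" if "p \<in> A.C" for p q
    unfolding A.Reeb_class_eq[OF that] mem_Collect_eq using g_iff[OF that, of q] by metis
  have g_fibre: "g p = g q \<longleftrightarrow> Reeb_class A.k A.D p = Reeb_class A.k A.D q" if p: "p \<in> A.C" and q: "q \<in> A.C" for p q
  proof
    assume eq: "g p = g q"
    show "Reeb_class A.k A.D p = Reeb_class A.k A.D q"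
      by (intro equalityI subsetI) (simp_all only: Reeb_mem[OF p] Reeb_mem[OF q] eq)
  next
    assume eq: "Reeb_class A.k A.D p = Reeb_class A.k A.D q"
    have "q \<in> Reeb_class A.k A.D q" using q by (simp only: Reeb_mem[OF q])
    then show "g p = g q" unfolding eq[symmetric] by (simp only: Reeb_mem[OF p])
  qed
  have X: "subtopology (Euclidean_space A.k) A.C = top_of_set A.C"
  proof -
    have "A.E \<inter> A.C = A.C" using C_E by blast
    then show ?thesis unfolding A.Euclidean_E subtopology_subtopology by simp
  qed
  \<comment> \<open>On each closed box \<open>g\<close> is a fixed path applied to the first
    coordinate. Extensional vectors are used so that there are finitely many boxes.\<close>
  have g_cont: "continuous_map (top_of_set A.C) (tspace W) g"
  proof (rule pasting_lemma_closed[where I = "Pi\<^sub>E {1..e} (\<lambda>m. {..<N m})"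
        and T = "\<lambda>w. {p \<in> A.C. \<forall>m\<in>{1..e}. real (w m) * A.H \<le> p m \<and> p m \<le> (real (w m) + 1) * A.H}"
        and f = "\<lambda>w p. through (digits_of w) (p 0)"])
    show "finite (Pi\<^sub>E {1..e} (\<lambda>m. {..<N m}))" by (intro finite_PiE) auto
    fix w assume w: "w \<in> Pi\<^sub>E {1..e} (\<lambda>m. {..<N m})"
    have wN: "\<forall>m\<in>{1..e}. w m < N m" using PiE_mem[OF w] by simp
    let ?T = "{p \<in> A.C. \<forall>m\<in>{1..e}. real (w m) * A.H \<le> p m \<and> p m \<le> (real (w m) + 1) * A.H}"
    have "?T = A.C \<inter> (\<Inter>m\<in>{1..e}. {p. real (w m) * A.H \<le> p m \<and> p m \<le> (real (w m) + 1) * A.H})" by auto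
    moreover have "closed (A.C \<inter> (\<Inter>m\<in>{1..e}. {p. real (w m) * A.H \<le> p m \<and> p m \<le> (real (w m) + 1) * A.H}))"
      by (intro closed_Int A.closed_C closed_INT ballI A.closed_coord)
    ultimately have "closed ?T" by simp
    then show "closedin (top_of_set A.C) ?T" by (intro closed_subset) auto
    have "continuous_map (top_of_set ?T) (top_of_set {a0..b0}) (\<lambda>p. p 0)"
      unfolding continuous_map_in_subtopology continuous_map_iff_continuous topspace_euclidean_subtopology
      using px continuous_on_coord[of ?T 0] by blast
    then have "continuous_map (top_of_set ?T) (tspace W) (through (digits_of w) \<circ> (\<lambda>p. p 0))"
      by (rule continuous_map_compose[OF _ through_continuous[OF digits_of_in[OF wN]]])
    moreover have "A.C \<inter> ?T = ?T" by auto
    ultimately show "continuous_map (subtopology (top_of_set A.C) ?T) (tspace W) (\<lambda>p. through (digits_of w) (p 0))"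
      unfolding subtopology_subtopology by (simp add: comp_def)
  next
    fix w w' p assume w: "w \<in> Pi\<^sub>E {1..e} (\<lambda>m. {..<N m})" "w' \<in> Pi\<^sub>E {1..e} (\<lambda>m. {..<N m})"
      and p: "p \<in> topspace (top_of_set A.C) \<inter>
        {p \<in> A.C. \<forall>m\<in>{1..e}. real (w m) * A.H \<le> p m \<and> p m \<le> (real (w m) + 1) * A.H} \<inter>
        {p \<in> A.C. \<forall>m\<in>{1..e}. real (w' m) * A.H \<le> p m \<and> p m \<le> (real (w' m) + 1) * A.H}"
    have pC: "p \<in> A.C" using p by simp
    have wN: "\<forall>m\<in>{1..e}. w m < N m" "\<forall>m\<in>{1..e}. w' m < N m" using PiE_mem[OF w(1)] PiE_mem[OF w(2)] by simp_all
    have "g p = through (digits_of w) (p 0)" by (rule g_cells[OF pC wN(1)]) (use p in blast)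
    moreover have "g p = through (digits_of w') (p 0)" by (rule g_cells[OF pC wN(2)]) (use p in blast)
    ultimately show "through (digits_of w) (p 0) = through (digits_of w') (p 0)" by simp
  next
    fix p assume "p \<in> topspace (top_of_set A.C)"
    then have p: "p \<in> A.C" by simp
    let ?w = "restrict (A.cell p) {1..e}"
    have pU: "p \<in> A.U" using p A.C_subset_U by blast
    have wN: "\<forall>m\<in>{1..e}. ?w m < N m" using cellN[OF p] by simp
    have cell: "real (?w m) * A.H \<le> p m \<and> p m \<le> (real (?w m) + 1) * A.H" if "m \<in> {1..e}" for m
      using A.cell(1,2)[OF pU that] that by (simp add: less_imp_le)
    have "g p = through (digits_of ?w) (p 0)" by (rule g_cells[OF p wN cell])
    moreover have "?w \<in> Pi\<^sub>E {1..e} (\<lambda>m. {..<N m})" using cellN[OF p] by (simp add: restrict_PiE_iff)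
    ultimately show "\<exists>j. j \<in> Pi\<^sub>E {1..e} (\<lambda>m. {..<N m}) \<and>
        p \<in> {p \<in> A.C. \<forall>m\<in>{1..e}. real (j m) * A.H \<le> p m \<and> p m \<le> (real (j m) + 1) * A.H} \<and>
        g p = through (digits_of j) (p 0)"
      using p cell by blast
  qed
  have g_surj: "\<exists>p\<in>A.C. g p = through u x" if u: "u \<in> L.digits \<times> R.digits" and x: "x \<in> {a0..b0}" for u x
  proof -
    obtain w where w: "\<forall>m\<in>{1..e}. w m < N m" "through (digits_of w) x = through u x"
      using through_digits_surj[OF u x] by blast
    have C: "A.ctr w x \<in> A.C" using w(1) x by (intro A.ctr_in_C) (simp_all add: A.cells_ok_def a_def b_def)
    have "g (A.ctr w x) = through (digits_of w) (A.ctr w x 0)"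
    proof (rule g_cells[OF C w(1)])
      show "real (w m) * A.H \<le> A.ctr w x m \<and> A.ctr w x m \<le> (real (w m) + 1) * A.H" if "m \<in> {1..e}" for m
        using that A.H_pos by (simp add: A.ctr_def distrib_right)
    qed
    then have "g (A.ctr w x) = through u x" using w(2) by (simp add: A.ctr_def)
    then show ?thesis using C by blast
  qed
  have levels: "A.levels = t ` {1..e + 1}"
  proof -
    have "2 \<le> N m \<longleftrightarrow> m < e" if "m \<in> {1..e}" for m
      using N_ge[of m] N_e that by (cases "m = e") auto
    then have "{m \<in> {1..e}. 2 \<le> N m} = {1..<e}" by auto
    then have "A.levels = {t 1, t (e + 1)} \<union> (\<lambda>m. t (m + 1)) ` {1..<e}"
      unfolding A.levels_def unfolding a_def b_def s_def by (simp only:)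
    also have "\<dots> = t ` ({1, e + 1} \<union> Suc ` {1..<e})"
      by (simp only: image_Un image_insert image_empty image_image Suc_eq_plus1)
    also have "{1, e + 1} \<union> Suc ` {1..<e} = {1..e + 1}" using d1 unfolding image_Suc_atLeastLessThan by auto
    finally show ?thesis .
  qed
  have verts: "PR_verts A.k l A.D ?S = Reeb_class A.k A.D ` {p \<in> A.C. p 0 \<in> t ` {1..e + 1}}"
    unfolding PR_verts_def A.closure_D levels[symmetric]
  proof (intro equalityI subsetI)
    fix c assume "c \<in> Reeb_class A.k A.D ` {p \<in> A.C. singular_point A.k l A.D ?S p}"
    then obtain p where c: "c = Reeb_class A.k A.D p" and p: "p \<in> {p \<in> A.C. singular_point A.k l A.D ?S p}"
      by (rule imageE)
    from p have pC: "p \<in> A.C" and sing: "singular_point A.k l A.D ?S p"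
      unfolding mem_Collect_eq by (rule conjunct1, rule conjunct2)
    have "p 0 \<in> A.levels"
    proof (rule ccontr)
      assume "p 0 \<notin> A.levels"
      from A.not_singular[OF bij pC this] sing show False by (rule notE)
    qed
    with pC have "p \<in> {p \<in> A.C. p 0 \<in> A.levels}" by simp
    then show "c \<in> Reeb_class A.k A.D ` {p \<in> A.C. p 0 \<in> A.levels}" unfolding c by (rule imageI)
  next
    fix c assume "c \<in> Reeb_class A.k A.D ` {p \<in> A.C. p 0 \<in> A.levels}"
    then obtain p where c: "c = Reeb_class A.k A.D p" and p: "p \<in> {p \<in> A.C. p 0 \<in> A.levels}"
      by (rule imageE)
    from p have pC: "p \<in> A.C" and lev: "p 0 \<in> A.levels"
      unfolding mem_Collect_eq by (rule conjunct1, rule conjunct2)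
    from A.level_singular[OF bij pC lev] obtain q where q: "q \<in> Reeb_class A.k A.D p"
      and qC: "q \<in> A.C \<and> singular_point A.k l A.D ?S q" by (rule bexE)
    have "g p = g q" using q unfolding Reeb_mem[OF pC] by (rule conjunct2)
    then have cq: "c = Reeb_class A.k A.D q" unfolding c g_fibre[OF pC conjunct1[OF qC]] .
    have "q \<in> {p \<in> A.C. singular_point A.k l A.D ?S p}" unfolding mem_Collect_eq by (rule qC)
    then show "c \<in> Reeb_class A.k A.D ` {p \<in> A.C. singular_point A.k l A.D ?S p}"
      unfolding cq by (rule imageI)
  qed
  have g_through: "p 0 \<in> {t 1..t (e + 1)} \<and> (\<exists>u\<in>L.digits \<times> R.digits. g p = through u (p 0))" if p: "p \<in> A.C" for p
  proof (rule conjI[OF px[OF p]])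
    have "g p = through (digits_of (A.cell p)) (p 0)" by (rule g_def)
    then show "\<exists>u\<in>L.digits \<times> R.digits. g p = through u (p 0)"
      using digits_of_in[OF cellN[OF p]] by (rule bexI[where x = "digits_of (A.cell p)"])
  qed
  \<comment> \<open>All is in place for the comparison: a compact source, a continuous map with the
    Reeb classes as fibres, onto the paths, and vertices determined by their heights.\<close>
  have iso: "top_digraph_iso (PR_digraph A.k l A.D ?S) W"
    using compact g_cont g_fibre g_through g_surj verts
    by (rule PR_digraph_iso[of A.k A.D g l ?S, unfolded A.closure_D X])
  have "tverts (PR_digraph A.k l A.D ?S) = PR_verts A.k l A.D ?S" by (simp add: PR_digraph_def)
  moreover have "PR_fun ` PR_verts A.k l A.D ?S = t ` {1..e + 1}"
  proof (intro equalityI subsetI)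
    have PRf: "PR_fun (Reeb_class A.k A.D p) = p 0" if "p \<in> A.C" for p
      by (rule PR_fun_Reeb_class) (simp only: A.closure_D that)
    {
      fix x assume "x \<in> PR_fun ` PR_verts A.k l A.D ?S"
      then obtain c where c: "x = PR_fun c" "c \<in> PR_verts A.k l A.D ?S" by (rule imageE)
      from c(2) obtain p where p: "c = Reeb_class A.k A.D p" "p \<in> {p \<in> A.C. p 0 \<in> t ` {1..e + 1}}"
        unfolding verts by (rule imageE)
      from p(2) have "p \<in> A.C" "p 0 \<in> t ` {1..e + 1}" unfolding mem_Collect_eq by (rule conjunct1, rule conjunct2)
      then show "x \<in> t ` {1..e + 1}" unfolding c(1) p(1) by (simp only: PRf)
    next
      fix x assume x: "x \<in> t ` {1..e + 1}"
      then have "x \<in> {a..b}" using level_in unfolding ab[symmetric] by blast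
      then have C: "A.ctr (\<lambda>_. 0) x \<in> A.C" by (intro A.ctr_in_C A.cells_ok_zero) simp_all
      have x0: "A.ctr (\<lambda>_. 0) x 0 = x" by (simp add: A.ctr_def)
      have "A.ctr (\<lambda>_. 0) x \<in> {p \<in> A.C. p 0 \<in> t ` {1..e + 1}}"
        unfolding mem_Collect_eq x0 using C x by (rule conjI)
      then have "Reeb_class A.k A.D (A.ctr (\<lambda>_. 0) x) \<in> PR_verts A.k l A.D ?S"
        unfolding verts by (rule imageI)
      then have "PR_fun (Reeb_class A.k A.D (A.ctr (\<lambda>_. 0) x)) \<in> PR_fun ` PR_verts A.k l A.D ?S"
        by (rule imageI)
      then show "x \<in> PR_fun ` PR_verts A.k l A.D ?S" unfolding PRf[OF C] x0 .
    }
  qed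
  ultimately have "PR_fun ` tverts (PR_digraph A.k l A.D ?S) = t ` {1..e + 1}" by (simp only:)
  moreover have "RA_region A.k l A.D ?S" by (rule A.RA_region_arrangement[OF bij])
  moreover have "compactin (Euclidean_space A.k) (Euclidean_space A.k closure_of A.D)"
    unfolding A.closure_D by (rule compact)
  moreover have "2 \<le> A.k" by simp
  moreover have "\<forall>j\<in>{1..l}. is_cylinder A.k (circle R) (?S j)" using cyl by (rule ballI)
  ultimately show ?thesis using iso by (intro exI[of _ A.k] exI[of _ A.D] exI[of _ ?S] conjI)
qed

end

theorem theorem2:
  fixes d1 d2 l :: nat and t :: "nat \<Rightarrow> real" and n1 n2 :: "nat \<Rightarrow> nat"
    and T1 :: "'a top_digraph" and v1 :: 'a
    and T2 :: "'b top_digraph" and v2 :: 'b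
    and G :: "('a + 'b) top_digraph"
  assumes "d1 > 0" and "d2 > 0"
    and "strict_mono_on {1..d1 + d2 + 1} t"
    and "\<forall>i \<in> {1..d1}. n1 i > 1" and "\<forall>i \<in> {1..d2}. n2 i > 1"
    and "balanced_tree T1 v1 n1 d1" and "balanced_tree T2 v2 n2 d2"
    and "G = wedge_digraph (reverse_digraph T1) v1 T2 v2"
    and "l = (\<Sum>i = 1..d1. n1 i + 1) + (\<Sum>i = 1..d2. n2 i + 1) + 2"
  shows "\<exists>R0 > 0. \<forall>R > R0. \<exists>k \<ge> 2. \<exists>D S.
           RA_region k l D S \<and>
           compactin (Euclidean_space k) (Euclidean_space k closure_of D) \<and>
           (\<forall>j \<in> {1..l}. is_cylinder k (circle R) (S j)) \<and>
           top_digraph_iso (PR_digraph k l D S) G \<and>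
           PR_fun ` tverts (PR_digraph k l D S) = t ` {1..d1 + d2 + 1}"
proof -
  interpret two_balanced_trees d1 d2 t n1 n2 T1 v1 T2 v2
    using assms by unfold_locales auto
  \<comment> \<open>The bound \<open>R0\<close> is the length of the range of the first coordinate,
    as needed for each tangent disk to reach the end of this range.\<close>
  have "b0 - a0 > 0" using r_bounds by simp
  then show ?thesis unfolding assms(8) using realization[OF _ assms(9)] by (intro exI[of _ "b0 - a0"]) blast
qed

end
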